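(* Let $(\mathcal{P},\omega)$ be a symplectic manifold, $H\in\mathcal{C}^\infty(\mathcal{P})$, $\mathcal{M}\subset\mathcal{P}$ a submanifold, and let $\nu$ be the pull-back of $\omega$ to $\mathcal{M}$, where $\ker\nu$ has constant dimension. Let $\varphi_h$ be a symplectic method for which SHAKE and RATTLE are well defined on the open set $O\subset\mathcal{M}$, $O\supset\mathcal{M}^H$. Then the corresponding SHAKE map $S_h$ and RATTLE map $R_h$, regarded as mappings of (the open subset $O$ of) $\mathcal{M}$ into $\mathcal{M}$, are presymplectic, i.e. $S_h^*\nu=\nu$ and $R_h^*\nu=\nu$ on $O$.
   Context: $X_H$ is the Hamiltonian vector field, $\omega(X_H,\cdot)=\mathrm{d}H$. $\ker\nu$ is integrable and the fibre $[x]$ is the leaf through $x\in\mathcal{M}$. The hidden constraint set is $\mathcal{M}^H=\{z\in\mathcal{M}:\mathrm{d}(H|_{\mathcal{M}})(z)\in\nu(T_z\mathcal{M})\}$, $\nu(T_z\mathcal{M})=\{\nu_z(u,\cdot):u\in T_z\mathcal{M}\}$. A method is a family of diffeomorphisms $\varphi_h\colon\mathcal{P}\to\mathcal{P}$, for $h$ in an open interval around $0$, smooth in $(h,z)$, with $\varphi_0=\mathrm{id}$ and $\frac{\partial}{\partial h}\varphi_h|_{h=0}=X_H$; it is symplectic if $\varphi_h^*\omega=\omega$ for all $h$. For $O\subset\mathcal{M}$ open and $z\in O$, the local fibre $[z]_O$ is the connected component (in the leaf topology) of $[z]\cap O$ containing $z$. SHAKE and RATTLE are well defined on an open set $O\supset\mathcal{M}^H$,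 for $0<|h|<h_0$, if: (i) for every $x\in O$, $[x]_O\cap\mathcal{M}^H$ is a single point $\Pi(x)$, and $\Pi\colon O\to\mathcal{M}$ is smooth; (ii) for every $0<|h|<h_0$ and $z\in O$ there is exactly one $z^+\in[z]_O$ with $\varphi_h(z^+)\in\mathcal{M}$; the map $\Gamma_h\colon O\to O$, $\Gamma_h(z)=z^+$, is smooth, and $\varphi_h(\Gamma_h(O))\subset O$. The SHAKE map is $S_h=\varphi_h\circ\Gamma_h\colon O\to O$ and the RATTLE map is $R_h=\Pi\circ S_h$. *)

theory Defs
  imports "HOL-Analysis.Analysis"
begin

section \<open>Smooth maps between Euclidean spaces\<close>

text \<open>Only used on open sets, so that the derivatives are unambiguous.\<close>

fun times_differentiable_on ::
    "nat \<Rightarrow> 'a::real_normed_vector set \<Rightarrow> ('a \<Rightarrow> 'b::real_normed_vector) \<Rightarrow> bool" where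
  "times_differentiable_on 0 S f \<longleftrightarrow> continuous_on S f"
| "times_differentiable_on (Suc n) S f \<longleftrightarrow>
     (\<forall>x\<in>S. f differentiable (at x)) \<and>
     (\<forall>v. times_differentiable_on n S (\<lambda>x. frechet_derivative f (at x) v))"

definition smooth_on ::
    "'a::real_normed_vector set \<Rightarrow> ('a \<Rightarrow> 'b::real_normed_vector) \<Rightarrow> bool" where
  "smooth_on S f \<longleftrightarrow> (\<forall>n. times_differentiable_on n S f)"


section \<open>Smooth manifolds\<close>

text \<open>A manifold is a type (a Hausdorff, second countable space) together with a smooth atlas
  with values in a Euclidean space; the atlas need not be maximal.  A chart is a pair of its
  domain and its coordinate map, which is meaningful on the domain only.\<close>

type_synonym ('p, 'e) chart = "'p set \<times> ('p \<Rightarrow> 'e)"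

abbreviation chart_inv :: "('p, 'e) chart \<Rightarrow> 'e \<Rightarrow> 'p" where
  "chart_inv c \<equiv> inv_into (fst c) (snd c)"

definition is_chart :: "('p::topological_space, 'e::euclidean_space) chart \<Rightarrow> bool" where
  "is_chart c \<longleftrightarrow> open (fst c) \<and> open (snd c ` fst c) \<and>
     (\<exists>g. homeomorphism (fst c) (snd c ` fst c) (snd c) g)"

definition smooth_transition ::
    "('p::topological_space, 'e::euclidean_space) chart \<Rightarrow> ('p, 'e) chart \<Rightarrow> bool" where
  "smooth_transition c d \<longleftrightarrow> smooth_on (snd c ` (fst c \<inter> fst d)) (snd d \<circ> chart_inv c)"

definition smooth_atlas :: "('p::topological_space, 'e::euclidean_space) chart set \<Rightarrow> bool" where
  "smooth_atlas A \<longleftrightarrow> (\<Union>c\<in>A. fst c) = UNIV \<and> (\<forall>c\<in>A. is_chart c) \<and>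
     (\<forall>c\<in>A. \<forall>d\<in>A. smooth_transition c d)"

text \<open>The charts of the maximal atlas containing \<open>A\<close>.\<close>

definition maximal_atlas ::
    "('p::topological_space, 'e::euclidean_space) chart set \<Rightarrow> ('p, 'e) chart set" where
  "maximal_atlas A =
     {c. is_chart c \<and> (\<forall>d\<in>A. smooth_transition c d \<and> smooth_transition d c)}"

definition std_atlas :: "('e, 'e) chart set" where
  "std_atlas = {(UNIV, \<lambda>x. x)}"

definition prod_atlas ::
    "('p, 'e) chart set \<Rightarrow> ('q, 'f) chart set \<Rightarrow> ('p \<times> 'q, 'e \<times> 'f) chart set" where
  "prod_atlas A B = {(fst c \<times> fst d, map_prod (snd c) (snd d)) | c d. c \<in> A \<and> d \<in> B}"

definition smooth_map_open ::
    "('p::topological_space, 'e::euclidean_space) chart set \<Rightarrow>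
     ('q::topological_space, 'f::euclidean_space) chart set \<Rightarrow> 'p set \<Rightarrow> ('p \<Rightarrow> 'q) \<Rightarrow> bool" where
  "smooth_map_open A B U f \<longleftrightarrow> open U \<and> continuous_on U f \<and>
     (\<forall>c\<in>A. \<forall>d\<in>B. smooth_on (snd c ` (fst c \<inter> U \<inter> f -` fst d)) (snd d \<circ> f \<circ> chart_inv c))"

text \<open>Smoothness on an arbitrary subset \<open>S\<close>, by local smooth extensions.  For an (open subset
  of an) embedded submanifold this is smoothness with respect to the submanifold structure.\<close>

definition smooth_map ::
    "('p::topological_space, 'e::euclidean_space) chart set \<Rightarrow>
     ('q::topological_space, 'f::euclidean_space) chart set \<Rightarrow> 'p set \<Rightarrow> ('p \<Rightarrow> 'q) \<Rightarrow> bool" where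
  "smooth_map A B S f \<longleftrightarrow>
     (\<forall>z\<in>S. \<exists>U g. z \<in> U \<and> smooth_map_open A B U g \<and> (\<forall>x\<in>U \<inter> S. g x = f x))"

definition diffeomorphism ::
    "('p::topological_space, 'e::euclidean_space) chart set \<Rightarrow> ('p \<Rightarrow> 'p) \<Rightarrow> bool" where
  "diffeomorphism A f \<longleftrightarrow> bij f \<and> smooth_map A A UNIV f \<and> smooth_map A A UNIV (inv f)"


section \<open>Tangent vectors and differential forms\<close>

text \<open>At every point \<open>z\<close> one chart \<open>chart_at A z\<close> is singled out, and a tangent
  vector at \<open>z\<close> is represented by its coordinates in that chart.  So every tangent space of the
  manifold is a copy of the model space, and a \<open>2\<close>-form is a function
  \<open>'p \<Rightarrow> 'e \<Rightarrow> 'e \<Rightarrow> real\<close> whose last two arguments are tangent vectors at the first one.\<close>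

definition chart_at :: "('p, 'e) chart set \<Rightarrow> 'p \<Rightarrow> ('p, 'e) chart" where
  "chart_at A z = (SOME c. c \<in> A \<and> z \<in> fst c)"

text \<open>The differential at \<open>z\<close> of a map \<open>f\<close> defined on \<open>S\<close>.  If \<open>S\<close> is not open the derivative
  within the chart image of \<open>S\<close> is not unique as a linear map on the model space, but for a
  smooth \<open>f\<close> on an (open subset of an) embedded submanifold \<open>S\<close> its values on the tangent
  vectors to \<open>S\<close> are; it is only applied to those.\<close>

definition tangent_map ::
    "('p::topological_space, 'e::euclidean_space) chart set \<Rightarrow>
     ('q::topological_space, 'f::euclidean_space) chart set \<Rightarrow> 'p set \<Rightarrow> ('p \<Rightarrow> 'q) \<Rightarrow>
     'p \<Rightarrow> 'e \<Rightarrow> 'f" where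
  "tangent_map A B S f z =
     (let c = chart_at A z; d = chart_at B (f z)
      in frechet_derivative (snd d \<circ> f \<circ> chart_inv c) (at (snd c z) within snd c ` (fst c \<inter> S)))"

definition pullback_form ::
    "('p::topological_space, 'e::euclidean_space) chart set \<Rightarrow>
     ('q::topological_space, 'f::euclidean_space) chart set \<Rightarrow> 'p set \<Rightarrow> ('p \<Rightarrow> 'q) \<Rightarrow>
     ('q \<Rightarrow> 'f \<Rightarrow> 'f \<Rightarrow> real) \<Rightarrow> 'p \<Rightarrow> 'e \<Rightarrow> 'e \<Rightarrow> real" where
  "pullback_form A B S f \<alpha> z u v =
     \<alpha> (f z) (tangent_map A B S f z u) (tangent_map A B S f z v)"

definition form_in_chart ::
    "('p::topological_space, 'e::euclidean_space) chart set \<Rightarrow> ('p, 'e) chart \<Rightarrow>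
     ('p \<Rightarrow> 'e \<Rightarrow> 'e \<Rightarrow> real) \<Rightarrow> 'e \<Rightarrow> 'e \<Rightarrow> 'e \<Rightarrow> real" where
  "form_in_chart A c \<alpha> = pullback_form std_atlas A (snd c ` fst c) (chart_inv c) \<alpha>"

definition smooth_two_form ::
    "('p::topological_space, 'e::euclidean_space) chart set \<Rightarrow> ('p \<Rightarrow> 'e \<Rightarrow> 'e \<Rightarrow> real) \<Rightarrow> bool"
  where
  "smooth_two_form A \<alpha> \<longleftrightarrow>
     (\<forall>z. bilinear (\<alpha> z) \<and> (\<forall>u. \<alpha> z u u = 0)) \<and>
     (\<forall>c\<in>A. \<forall>u v. smooth_on (snd c ` fst c) (\<lambda>x. form_in_chart A c \<alpha> x u v))"

text \<open>\<open>d\<alpha> = 0\<close>, the exterior derivative being evaluated on constant vector fields in a chart.\<close>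

definition closed_two_form ::
    "('p::topological_space, 'e::euclidean_space) chart set \<Rightarrow> ('p \<Rightarrow> 'e \<Rightarrow> 'e \<Rightarrow> real) \<Rightarrow> bool"
  where
  "closed_two_form A \<alpha> \<longleftrightarrow>
     (\<forall>c\<in>A. \<forall>x\<in>snd c ` fst c. \<forall>u v w.
        frechet_derivative (\<lambda>y. form_in_chart A c \<alpha> y v w) (at x) u
      - frechet_derivative (\<lambda>y. form_in_chart A c \<alpha> y u w) (at x) v
      + frechet_derivative (\<lambda>y. form_in_chart A c \<alpha> y u v) (at x) w = 0)"

definition symplectic_manifold ::
    "('p::{t2_space,second_countable_topology}, 'e::euclidean_space) chart set \<Rightarrow>
     ('p \<Rightarrow> 'e \<Rightarrow> 'e \<Rightarrow> real) \<Rightarrow> bool" where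
  "symplectic_manifold A \<omega> \<longleftrightarrow> smooth_atlas A \<and> smooth_two_form A \<omega> \<and> closed_two_form A \<omega> \<and>
     (\<forall>z u. (\<forall>v. \<omega> z u v = 0) \<longrightarrow> u = 0)"

definition hamiltonian_vector_field ::
    "('p::topological_space, 'e::euclidean_space) chart set \<Rightarrow> ('p \<Rightarrow> 'e \<Rightarrow> 'e \<Rightarrow> real) \<Rightarrow>
     ('p \<Rightarrow> real) \<Rightarrow> 'p \<Rightarrow> 'e" where
  "hamiltonian_vector_field A \<omega> H z =
     (THE u. \<forall>v. \<omega> z u v = tangent_map A std_atlas UNIV H z v)"


section \<open>Submanifolds, leaves\<close>

text \<open>Embedded submanifolds, by slice charts.\<close>

definition submanifold ::
    "('p::topological_space, 'e::euclidean_space) chart set \<Rightarrow> nat \<Rightarrow> 'p set \<Rightarrow> bool" where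
  "submanifold A m N \<longleftrightarrow>
     (\<forall>z\<in>N. \<exists>c\<in>maximal_atlas A. \<exists>L. z \<in> fst c \<and> subspace L \<and> dim L = m \<and>
        snd c ` (fst c \<inter> N) = snd c ` fst c \<inter> L)"

text \<open>The velocities at \<open>z\<close> of the smooth curves in \<open>N\<close>.\<close>

definition tangent_space ::
    "('p::topological_space, 'e::euclidean_space) chart set \<Rightarrow> 'p set \<Rightarrow> 'p \<Rightarrow> 'e set" where
  "tangent_space A N z =
     {tangent_map std_atlas A {-e<..<e} \<gamma> (0::real) 1 | \<gamma> e.
        e > 0 \<and> smooth_map std_atlas A {-e<..<e} \<gamma> \<and> \<gamma> ` {-e<..<e} \<subseteq> N \<and> \<gamma> 0 = z}"

definition integral_manifold ::
    "('p::topological_space, 'e::euclidean_space) chart set \<Rightarrow> 'p set \<Rightarrow> ('p \<Rightarrow> 'e set) \<Rightarrow>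
     'p set \<Rightarrow> bool" where
  "integral_manifold A M D N \<longleftrightarrow> N \<subseteq> M \<and> (\<exists>k. submanifold A k N) \<and>
     (\<forall>z\<in>N. tangent_space A N z = D z)"

text \<open>The leaf topology on \<open>M\<close> of an integrable distribution \<open>D\<close> has the embedded integral
  manifolds of \<open>D\<close> as a basis; the leaves are its connected components.\<close>

definition leaf_topology ::
    "('p::topological_space, 'e::euclidean_space) chart set \<Rightarrow> 'p set \<Rightarrow> ('p \<Rightarrow> 'e set) \<Rightarrow>
     'p topology" where
  "leaf_topology A M D = topology_generated_by {N. integral_manifold A M D N}"

definition leaf ::
    "('p::topological_space, 'e::euclidean_space) chart set \<Rightarrow> 'p set \<Rightarrow> ('p \<Rightarrow> 'e set) \<Rightarrow>
     'p \<Rightarrow> 'p set" where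
  "leaf A M D x = connected_component_of_set (leaf_topology A M D) x"

definition form_kernel ::
    "('p::topological_space, 'e::euclidean_space) chart set \<Rightarrow> 'p set \<Rightarrow>
     ('p \<Rightarrow> 'e \<Rightarrow> 'e \<Rightarrow> real) \<Rightarrow> 'p \<Rightarrow> 'e set" where
  "form_kernel A M \<nu> z = {u \<in> tangent_space A M z. \<forall>v\<in>tangent_space A M z. \<nu> z u v = 0}"

definition fibre ::
    "('p::topological_space, 'e::euclidean_space) chart set \<Rightarrow> 'p set \<Rightarrow>
     ('p \<Rightarrow> 'e \<Rightarrow> 'e \<Rightarrow> real) \<Rightarrow> 'p \<Rightarrow> 'p set" where
  "fibre A M \<nu> x = leaf A M (form_kernel A M \<nu>) x"

definition local_fibre ::
    "('p::topological_space, 'e::euclidean_space) chart set \<Rightarrow> 'p set \<Rightarrow>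
     ('p \<Rightarrow> 'e \<Rightarrow> 'e \<Rightarrow> real) \<Rightarrow> 'p set \<Rightarrow> 'p \<Rightarrow> 'p set" where
  "local_fibre A M \<nu> W z = connected_component_of_set
     (subtopology (leaf_topology A M (form_kernel A M \<nu>)) (fibre A M \<nu> z \<inter> W)) z"


section \<open>Methods, SHAKE and RATTLE\<close>

definition hidden_constraint_set ::
    "('p::topological_space, 'e::euclidean_space) chart set \<Rightarrow> 'p set \<Rightarrow>
     ('p \<Rightarrow> 'e \<Rightarrow> 'e \<Rightarrow> real) \<Rightarrow> ('p \<Rightarrow> real) \<Rightarrow> 'p set" where
  "hidden_constraint_set A M \<nu> H =
     {z \<in> M. \<exists>u\<in>tangent_space A M z. \<forall>v\<in>tangent_space A M z.
        tangent_map A std_atlas M H z v = \<nu> z u v}"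

text \<open>The values of \<open>\<phi>\<close> at step sizes outside the interval \<open>I\<close> are irrelevant.\<close>

definition is_method ::
    "('p::topological_space, 'e::euclidean_space) chart set \<Rightarrow> ('p \<Rightarrow> 'e \<Rightarrow> 'e \<Rightarrow> real) \<Rightarrow>
     ('p \<Rightarrow> real) \<Rightarrow> real set \<Rightarrow> (real \<Rightarrow> 'p \<Rightarrow> 'p) \<Rightarrow> bool" where
  "is_method A \<omega> H I \<phi> \<longleftrightarrow>
     open I \<and> is_interval I \<and> 0 \<in> I \<and>
     (\<forall>h\<in>I. diffeomorphism A (\<phi> h)) \<and>
     smooth_map (prod_atlas std_atlas A) A (I \<times> UNIV) (\<lambda>(h, z). \<phi> h z) \<and>
     (\<forall>z. \<phi> 0 z = z) \<and>
     (\<forall>z. tangent_map std_atlas A I (\<lambda>h. \<phi> h z) 0 1 = hamiltonian_vector_field A \<omega> H z)"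

definition symplectic_method ::
    "('p::topological_space, 'e::euclidean_space) chart set \<Rightarrow> ('p \<Rightarrow> 'e \<Rightarrow> 'e \<Rightarrow> real) \<Rightarrow>
     ('p \<Rightarrow> real) \<Rightarrow> real set \<Rightarrow> (real \<Rightarrow> 'p \<Rightarrow> 'p) \<Rightarrow> bool" where
  "symplectic_method A \<omega> H I \<phi> \<longleftrightarrow> is_method A \<omega> H I \<phi> \<and>
     (\<forall>h\<in>I. pullback_form A A UNIV (\<phi> h) \<omega> = \<omega>)"

definition hidden_projection ::
    "('p::topological_space, 'e::euclidean_space) chart set \<Rightarrow> 'p set \<Rightarrow>
     ('p \<Rightarrow> 'e \<Rightarrow> 'e \<Rightarrow> real) \<Rightarrow> ('p \<Rightarrow> real) \<Rightarrow> 'p set \<Rightarrow> 'p \<Rightarrow> 'p" where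
  "hidden_projection A M \<nu> H W x =
     (THE y. y \<in> local_fibre A M \<nu> W x \<inter> hidden_constraint_set A M \<nu> H)"

definition fibre_step ::
    "('p::topological_space, 'e::euclidean_space) chart set \<Rightarrow> 'p set \<Rightarrow>
     ('p \<Rightarrow> 'e \<Rightarrow> 'e \<Rightarrow> real) \<Rightarrow> (real \<Rightarrow> 'p \<Rightarrow> 'p) \<Rightarrow> 'p set \<Rightarrow> real \<Rightarrow> 'p \<Rightarrow> 'p" where
  "fibre_step A M \<nu> \<phi> W h z = (THE y. y \<in> local_fibre A M \<nu> W z \<and> \<phi> h y \<in> M)"

definition shake ::
    "('p::topological_space, 'e::euclidean_space) chart set \<Rightarrow> 'p set \<Rightarrow>
     ('p \<Rightarrow> 'e \<Rightarrow> 'e \<Rightarrow> real) \<Rightarrow> (real \<Rightarrow> 'p \<Rightarrow> 'p) \<Rightarrow> 'p set \<Rightarrow> real \<Rightarrow> 'p \<Rightarrow> 'p" where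
  "shake A M \<nu> \<phi> W h = \<phi> h \<circ> fibre_step A M \<nu> \<phi> W h"

definition rattle ::
    "('p::topological_space, 'e::euclidean_space) chart set \<Rightarrow> 'p set \<Rightarrow>
     ('p \<Rightarrow> 'e \<Rightarrow> 'e \<Rightarrow> real) \<Rightarrow> ('p \<Rightarrow> real) \<Rightarrow> (real \<Rightarrow> 'p \<Rightarrow> 'p) \<Rightarrow> 'p set \<Rightarrow> real \<Rightarrow> 'p \<Rightarrow> 'p"
  where
  "rattle A M \<nu> H \<phi> W h = hidden_projection A M \<nu> H W \<circ> shake A M \<nu> \<phi> W h"

definition shake_rattle_well_defined ::
    "('p::topological_space, 'e::euclidean_space) chart set \<Rightarrow> 'p set \<Rightarrow>
     ('p \<Rightarrow> 'e \<Rightarrow> 'e \<Rightarrow> real) \<Rightarrow> ('p \<Rightarrow> real) \<Rightarrow> (real \<Rightarrow> 'p \<Rightarrow> 'p) \<Rightarrow> 'p set \<Rightarrow> real \<Rightarrow> bool"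
  where
  "shake_rattle_well_defined A M \<nu> H \<phi> W h0 \<longleftrightarrow>
     openin (top_of_set M) W \<and> hidden_constraint_set A M \<nu> H \<subseteq> W \<and> h0 > 0 \<and>
     (\<forall>x\<in>W. \<exists>!y. y \<in> local_fibre A M \<nu> W x \<inter> hidden_constraint_set A M \<nu> H) \<and>
     smooth_map A A W (hidden_projection A M \<nu> H W) \<and>
     (\<forall>h. 0 < \<bar>h\<bar> \<and> \<bar>h\<bar> < h0 \<longrightarrow>
        (\<forall>z\<in>W. \<exists>!y. y \<in> local_fibre A M \<nu> W z \<and> \<phi> h y \<in> M) \<and>
        smooth_map A A W (fibre_step A M \<nu> \<phi> W h) \<and>
        \<phi> h ` fibre_step A M \<nu> \<phi> W h ` W \<subseteq> W)"

text \<open>\<open>f\<close>, defined on an open subset \<open>W\<close> of \<open>M\<close> with values in \<open>M\<close>, satisfies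
  \<open>f\<^sup>* \<nu> = \<nu>\<close> on \<open>W\<close>.\<close>

definition presymplectic_map ::
    "('p::topological_space, 'e::euclidean_space) chart set \<Rightarrow> 'p set \<Rightarrow>
     ('p \<Rightarrow> 'e \<Rightarrow> 'e \<Rightarrow> real) \<Rightarrow> 'p set \<Rightarrow> ('p \<Rightarrow> 'p) \<Rightarrow> bool" where
  "presymplectic_map A M \<nu> W f \<longleftrightarrow>
     f ` W \<subseteq> M \<and> smooth_map A A W f \<and>
     (\<forall>z\<in>W. \<forall>u\<in>tangent_space A M z. \<forall>v\<in>tangent_space A M z.
        pullback_form A A W f \<nu> z u v = \<nu> z u v)"

end

theory Submission
  imports Defs
begin

text \<open>
  Both \<open>\<Gamma>\<^sub>h\<close> and \<open>\<Pi>\<close> are smooth maps \<open>f\<close> that send every point into its local fibre and are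
  constant on local fibres; in particular they are idempotent.  For such an \<open>f\<close> one has
  \<open>f\<^sup>*\<nu> = \<nu>\<close>.  At a fixed point \<open>y\<close> the differential of \<open>f\<close> is a projection; its kernel contains the
  kernel of \<open>\<nu>\<close> and is not larger, since the fibre of \<open>f\<close> through \<open>y\<close> lies in a single leaf, which
  is a countable union of plaques; so \<open>f\<^sup>*\<nu> = \<nu>\<close> at \<open>y\<close>.  The form \<open>f\<^sup>*\<nu> - \<nu>\<close> is closed and annihilates the
  kernel of \<open>\<nu>\<close>; hence its coefficients satisfy a linear differential inequality along curves in the leaves,
  and its vanishing at \<open>y = f z\<close> propagates along the local fibre to \<open>z\<close>.  Finally
  \<open>S\<^sub>h = \<phi>\<^sub>h \<circ> \<Gamma>\<^sub>h\<close> and \<open>R\<^sub>h = \<Pi> \<circ> S\<^sub>h\<close>, and \<open>\<phi>\<^sub>h\<close> preserves \<open>\<omega>\<close>.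
\<close>

section \<open>Calculus of smooth maps\<close>

text \<open>In a Frobenius chart a closed form that annihilates the kernel of \<nu> has coefficients
  that are constant along the plaques. No such chart is constructed: the foliation is given only by
  embedded integral manifolds, and the constant dimension of the kernel enters through one
  quantitative consequence, that the kernel is locally Lipschitz as a field of subspaces. Gronwall's
  inequality takes the place of straightening, for the transport of
  \<open>f\<^sup>*\<nu> - \<nu>\<close> and also for the local uniqueness of integral manifolds,
  without which the leaf topology could not be compared with that of the manifold.

  The count of plaques answers an obstacle. A level set of \<open>f\<close> is controlled in the
  topology of \<open>M\<close>, a local fibre in the leaf topology. A leaf may return to a
  neighbourhood infinitely often, so a smooth curve in \<open>M\<close> whose points all lie in one
  leaf could a priori jump between plaques, and its velocity need not visibly be tangent to the
  leaf. Countability excludes this at enough times to decide the velocity in the limit.\<close>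

lemma times_differentiable_on_subset:
  "times_differentiable_on n T f \<Longrightarrow> S \<subseteq> T \<Longrightarrow> times_differentiable_on n S f"
  by (induction n arbitrary: f) (auto intro: continuous_on_subset)

text \<open>All derivatives are taken in full neighbourhoods (\<open>at x\<close>), so
  differentiability of any order can be tested near each point, and \<open>S\<close> itself may be
  arbitrary.\<close>

lemma times_differentiable_on_local:
  assumes "\<And>x. x \<in> S \<Longrightarrow> \<exists>T. open T \<and> x \<in> T \<and> times_differentiable_on n T f"
  shows "times_differentiable_on n S f"
  using assms
proof (induction n arbitrary: f)
  case 0
  have "continuous (at x within S) f" if x: "x \<in> S" for x
  proof -
    obtain T where "open T" "x \<in> T" "continuous_on T f"
      using 0[OF x] by auto
    then show ?thesis
      by (metis continuous_on_eq_continuous_at continuous_at_imp_continuous_at_within)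
  qed
  then show ?case by (simp add: continuous_on_eq_continuous_within)
next
  case (Suc n)
  have "times_differentiable_on n S (\<lambda>x. frechet_derivative f (at x) v)" for v
    by (rule Suc.IH) (use Suc.prems in fastforce)
  moreover have "f differentiable (at x)" if "x \<in> S" for x
    using Suc.prems that by fastforce
  ultimately show ?case by auto
qed

text \<open>Equality holds even where neither map is differentiable:
  \<open>frechet_derivative\<close> is a choice among the derivatives, and the two maps have the
  same ones.\<close>

lemma frechet_derivative_cong_open:
  assumes "open S" "x \<in> S" "\<And>y. y \<in> S \<Longrightarrow> f y = g y"
  shows "frechet_derivative f (at x) = frechet_derivative g (at x)"
proof -
  have "(f has_derivative D) (at x) \<longleftrightarrow> (g has_derivative D) (at x)" for D
    by (metis (mono_tags) assms has_derivative_transform_within_open)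
  then show ?thesis unfolding frechet_derivative_def by simp
qed

lemma times_differentiable_on_cong:
  assumes "open S" "\<And>y. y \<in> S \<Longrightarrow> f y = g y"
  shows "times_differentiable_on n S f \<longleftrightarrow> times_differentiable_on n S g"
  using assms(2)
proof (induction n arbitrary: f g)
  case 0
  then show ?case using continuous_on_cong by force
next
  case (Suc n)
  have "f differentiable (at x) \<longleftrightarrow> g differentiable (at x)" if "x \<in> S" for x
    unfolding differentiable_def
    by (metis (mono_tags) Suc.prems assms(1) has_derivative_transform_within_open that)
  moreover have "times_differentiable_on n S (\<lambda>x. frechet_derivative f (at x) v) \<longleftrightarrow>
      times_differentiable_on n S (\<lambda>x. frechet_derivative g (at x) v)" for v
    by (rule Suc.IH) (metis assms(1) Suc.prems frechet_derivative_cong_open)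
  ultimately show ?case by auto
qed

text \<open>Admits an explicit formula for the derivative in place of the chosen
  \<open>frechet_derivative\<close>; the sum, product and chain rules below go through it.\<close>

lemma times_differentiable_on_SucI:
  assumes "open S" "\<And>x. x \<in> S \<Longrightarrow> (f has_derivative f' x) (at x)"
    and "\<And>v. times_differentiable_on n S (\<lambda>x. f' x v)"
  shows "times_differentiable_on (Suc n) S f"
proof -
  have "frechet_derivative f (at x) = f' x" if "x \<in> S" for x
    using frechet_derivative_at[OF assms(2)[OF that]] by simp
  then have "times_differentiable_on n S (\<lambda>x. frechet_derivative f (at x) v)" for v
    by (subst times_differentiable_on_cong[OF assms(1)]) (auto simp: assms(3))
  then show ?thesis using assms(2) by (auto simp: differentiable_def)
qed

lemma times_differentiable_on_SucD:
  assumes "times_differentiable_on (Suc n) S f"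
  shows "x \<in> S \<Longrightarrow> (f has_derivative frechet_derivative f (at x)) (at x)"
    and "times_differentiable_on n S (\<lambda>x. frechet_derivative f (at x) v)"
  using assms frechet_derivative_works by auto

lemma times_differentiable_on_Suc_imp:
  "times_differentiable_on (Suc n) S f \<Longrightarrow> times_differentiable_on n S f"
proof (induction n arbitrary: f)
  case 0
  then show ?case
    by (auto intro!: continuous_at_imp_continuous_on differentiable_imp_continuous_within)
next
  case (Suc n)
  then show ?case by (metis times_differentiable_on.simps(2))
qed

lemma times_differentiable_on_const:
  "times_differentiable_on n S (\<lambda>x. c)"
  by (induction n arbitrary: c) auto

lemma times_differentiable_on_linear:
  assumes "bounded_linear f"
  shows "times_differentiable_on n S f"
proof (cases n)
  case 0
  then show ?thesis
    using assms by (simp add: linear_continuous_on)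
next
  case (Suc k)
  have "frechet_derivative f (at x) = f" for x
    using assms bounded_linear_imp_has_derivative frechet_derivative_at by metis
  then show ?thesis
    using assms by (auto simp: Suc times_differentiable_on_const bounded_linear_imp_differentiable)
qed

lemma times_differentiable_on_compose_linear:
  assumes "bounded_linear L" "open S" "times_differentiable_on n S f"
  shows "times_differentiable_on n S (\<lambda>x. L (f x))"
  using assms(3)
proof (induction n arbitrary: f)
  case 0
  then show ?case using assms(1) by (simp add: bounded_linear.continuous_on)
next
  case (Suc n)
  show ?case
    by (rule times_differentiable_on_SucI[OF assms(2)
          bounded_linear.has_derivative[OF assms(1) times_differentiable_on_SucD(1)[OF Suc.prems]]])
      (simp_all add: Suc.IH times_differentiable_on_SucD(2)[OF Suc.prems])
qed

lemma times_differentiable_on_add: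
  assumes "open S" "times_differentiable_on n S f" "times_differentiable_on n S g"
  shows "times_differentiable_on n S (\<lambda>x. f x + g x)"
  using assms(2,3)
proof (induction n arbitrary: f g)
  case 0
  then show ?case by (simp add: continuous_on_add)
next
  case (Suc n)
  show ?case
    by (rule times_differentiable_on_SucI[OF assms(1) has_derivative_add[OF
          times_differentiable_on_SucD(1)[OF Suc.prems(1)] times_differentiable_on_SucD(1)[OF Suc.prems(2)]]])
      (simp_all add: Suc.IH times_differentiable_on_SucD(2)[OF Suc.prems(1)]
        times_differentiable_on_SucD(2)[OF Suc.prems(2)])
qed

lemma times_differentiable_on_sum:
  assumes "open S" "\<And>i. i \<in> J \<Longrightarrow> times_differentiable_on n S (f i)"
  shows "times_differentiable_on n S (\<lambda>x. \<Sum>i\<in>J. f i x)"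
  using assms(2)
  by (induction J rule: infinite_finite_induct)
    (auto intro: times_differentiable_on_const times_differentiable_on_add assms(1))

text \<open>The derivative of \<open>B (f x) (g x)\<close> is a sum of two terms of the same shape,
  each with one factor differentiated. The other factor is needed at the lower order, hence
  \<open>low\<close>.\<close>

lemma times_differentiable_on_bilinear:
  assumes "bounded_bilinear B" "open S" "times_differentiable_on n S f" "times_differentiable_on n S g"
  shows "times_differentiable_on n S (\<lambda>x. B (f x) (g x))"
  using assms(3,4)
proof (induction n arbitrary: f g)
  case 0
  then show ?case using assms(1) by (simp add: bounded_bilinear.continuous_on)
next
  case (Suc n)
  note low = Suc.prems[THEN times_differentiable_on_Suc_imp]
  note D = Suc.prems[THEN times_differentiable_on_SucD(1)]
  note D2 = Suc.prems[THEN times_differentiable_on_SucD(2)]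
  show ?case
    by (rule times_differentiable_on_SucI[OF assms(2) bounded_bilinear.FDERIV[OF assms(1) D]])
      (assumption | rule times_differentiable_on_add[OF assms(2)] Suc.IH low D2)+
qed

lemma linear_expand_Basis:
  fixes F :: "'a::euclidean_space \<Rightarrow> 'b::real_vector"
  assumes "linear F"
  shows "F w = (\<Sum>i\<in>Basis. (w \<bullet> i) *\<^sub>R F i)"
proof -
  have "F w = F (\<Sum>i\<in>Basis. (w \<bullet> i) *\<^sub>R i)" by (simp only: euclidean_representation)
  also have "\<dots> = (\<Sum>i\<in>Basis. (w \<bullet> i) *\<^sub>R F i)"
    using assms by (simp add: linear_sum linear_cmul)
  finally show ?thesis .
qed

text \<open>The derivative of \<open>g\<close> at \<open>f x\<close> is applied to a direction that
  varies with \<open>x\<close>, so the induction hypothesis does not fit it directly. Expanding that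
  direction in \<open>Basis\<close> leaves derivatives of \<open>g\<close> in fixed directions,
  multiplied by scalar functions.\<close>

lemma times_differentiable_on_compose:
  fixes f :: "'a::real_normed_vector \<Rightarrow> 'b::euclidean_space"
  assumes "open S" "times_differentiable_on n S f" "times_differentiable_on n T g" "f ` S \<subseteq> T"
  shows "times_differentiable_on n S (\<lambda>x. g (f x))"
  using assms(2,3)
proof (induction n arbitrary: g)
  case 0
  then show ?case using continuous_on_compose2[of T g S f] assms(4) by simp
next
  case (Suc n)
  note Df = Suc.prems(1)[THEN times_differentiable_on_SucD(1)]
  note Dg = Suc.prems(2)[THEN times_differentiable_on_SucD(1)]
  have D: "((\<lambda>x. g (f x)) has_derivative
      (\<lambda>v. \<Sum>i\<in>Basis. (frechet_derivative f (at x) v \<bullet> i) *\<^sub>R frechet_derivative g (at (f x)) i)) (at x)"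
    if "x \<in> S" for x
  proof -
    have fx: "f x \<in> T" using that assms(4) by auto
    show ?thesis using has_derivative_compose[OF Df[OF that] Dg[OF fx]]
      unfolding linear_expand_Basis[OF has_derivative_linear[OF Dg[OF fx]], symmetric] .
  qed
  show ?case
  proof (rule times_differentiable_on_SucI[OF assms(1) D])
    fix v
    have 1: "times_differentiable_on n S (\<lambda>x. frechet_derivative g (at (f x)) i)" for i
      by (rule Suc.IH[OF times_differentiable_on_Suc_imp[OF Suc.prems(1)]])
        (rule times_differentiable_on_SucD(2)[OF Suc.prems(2)])
    have 2: "times_differentiable_on n S (\<lambda>x. frechet_derivative f (at x) v \<bullet> i)" for i
      by (rule times_differentiable_on_compose_linear[OF bounded_linear_inner_left assms(1)])
        (rule times_differentiable_on_SucD(2)[OF Suc.prems(1)])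
    show "times_differentiable_on n S
       (\<lambda>x. \<Sum>i\<in>Basis. (frechet_derivative f (at x) v \<bullet> i) *\<^sub>R frechet_derivative g (at (f x)) i)"
      by (intro times_differentiable_on_sum assms(1)
          times_differentiable_on_bilinear[OF bounded_bilinear_scaleR] 1 2)
  qed
qed

lemma smooth_on_subset: "smooth_on T f \<Longrightarrow> S \<subseteq> T \<Longrightarrow> smooth_on S f"
  unfolding smooth_on_def using times_differentiable_on_subset by blast

lemma smooth_on_cong:
  assumes "open S" "\<And>y. y \<in> S \<Longrightarrow> f y = g y"
  shows "smooth_on S f \<longleftrightarrow> smooth_on S g"
  unfolding smooth_on_def by (simp add: times_differentiable_on_cong[OF assms])

lemma smooth_on_local:
  assumes "\<And>x. x \<in> S \<Longrightarrow> \<exists>T. open T \<and> x \<in> T \<and> smooth_on T f"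
  shows "smooth_on S f"
  unfolding smooth_on_def
  using times_differentiable_on_local assms[unfolded smooth_on_def] by metis

lemma smooth_on_const: "smooth_on S (\<lambda>x. c)"
  unfolding smooth_on_def using times_differentiable_on_const by blast

lemma smooth_on_linear: "bounded_linear f \<Longrightarrow> smooth_on S f"
  unfolding smooth_on_def using times_differentiable_on_linear by blast

lemma smooth_on_id: "smooth_on S (\<lambda>x. x)"
  by (rule smooth_on_linear) (rule bounded_linear_ident)

lemma smooth_on_add:
  "open S \<Longrightarrow> smooth_on S f \<Longrightarrow> smooth_on S g \<Longrightarrow> smooth_on S (\<lambda>x. f x + g x)"
  by (simp add: smooth_on_def times_differentiable_on_add)

lemma smooth_on_sum:
  "open S \<Longrightarrow> (\<And>i. i \<in> J \<Longrightarrow> smooth_on S (f i)) \<Longrightarrow> smooth_on S (\<lambda>x. \<Sum>i\<in>J. f i x)"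
  by (simp add: smooth_on_def times_differentiable_on_sum)

lemma smooth_on_bilinear:
  "bounded_bilinear B \<Longrightarrow> open S \<Longrightarrow> smooth_on S f \<Longrightarrow> smooth_on S g \<Longrightarrow> smooth_on S (\<lambda>x. B (f x) (g x))"
  by (simp add: smooth_on_def times_differentiable_on_bilinear)

lemma smooth_on_compose_linear:
  "bounded_linear L \<Longrightarrow> open S \<Longrightarrow> smooth_on S f \<Longrightarrow> smooth_on S (\<lambda>x. L (f x))"
  by (simp add: smooth_on_def times_differentiable_on_compose_linear)

lemma smooth_on_compose:
  fixes f :: "'a::real_normed_vector \<Rightarrow> 'b::euclidean_space"
  assumes "open S" "smooth_on S f" "smooth_on T g" "f ` S \<subseteq> T"
  shows "smooth_on S (\<lambda>x. g (f x))"
  using assms times_differentiable_on_compose unfolding smooth_on_def by metis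

lemma smooth_on_has_derivative:
  assumes "smooth_on S f" "x \<in> S"
  shows "(f has_derivative frechet_derivative f (at x)) (at x)"
  using assms times_differentiable_on.simps(2)[of 0 S f] frechet_derivative_works
  unfolding smooth_on_def by blast

lemma smooth_on_frechet_derivative:
  "smooth_on S f \<Longrightarrow> smooth_on S (\<lambda>x. frechet_derivative f (at x) v)"
  unfolding smooth_on_def by (metis times_differentiable_on.simps(2))

lemma smooth_on_imp_continuous_on: "smooth_on S f \<Longrightarrow> continuous_on S f"
  unfolding smooth_on_def by (metis times_differentiable_on.simps(1))

lemma linear_frechet_derivative_smooth:
  assumes "smooth_on S f" "x \<in> S"
  shows "linear (frechet_derivative f (at x))" "bounded_linear (frechet_derivative f (at x))"
proof -
  show "bounded_linear (frechet_derivative f (at x))"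
    by (rule has_derivative_bounded_linear[OF smooth_on_has_derivative[OF assms]])
  then show "linear (frechet_derivative f (at x))" by (rule bounded_linear.linear)
qed

section \<open>Derivative bounds, Gronwall's inequality and symmetry of second derivatives\<close>

lemma smooth_on_locally_bounded_derivative:
  fixes f :: "'a::euclidean_space \<Rightarrow> 'b::real_normed_vector"
  assumes "smooth_on S f" "open S" "x0 \<in> S"
  obtains r C where "r > 0" "C > 0" "ball x0 r \<subseteq> S"
    "\<And>x v. x \<in> ball x0 r \<Longrightarrow> norm (frechet_derivative f (at x) v) \<le> C * norm v"
    "\<And>x y. x \<in> ball x0 r \<Longrightarrow> y \<in> ball x0 r \<Longrightarrow> norm (f x - f y) \<le> C * norm (x - y)"
proof -
  obtain e where e: "e > 0" "cball x0 e \<subseteq> S"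
    using assms open_contains_cball by blast
  have "\<exists>M. \<forall>x\<in>cball x0 e. norm (frechet_derivative f (at x) i) \<le> M" for i
  proof -
    have "continuous_on (cball x0 e) (\<lambda>x. frechet_derivative f (at x) i)"
      using smooth_on_imp_continuous_on[OF smooth_on_frechet_derivative[OF assms(1)]] e(2)
        continuous_on_subset by blast
    then have "bounded ((\<lambda>x. frechet_derivative f (at x) i) ` cball x0 e)"
      using compact_continuous_image compact_cball compact_imp_bounded by blast
    then show ?thesis by (auto simp: bounded_iff)
  qed
  then obtain M where M: "\<And>i x. x \<in> cball x0 e \<Longrightarrow> norm (frechet_derivative f (at x) i) \<le> M i"
    by metis
  \<comment> \<open>Compactness of the closed ball bounds the derivative in each coordinate
    direction separately; the sum of these bounds serves all directions, and the summand 1 makes it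
    positive.\<close>
  define C where "C = (\<Sum>i\<in>(Basis::'a set). \<bar>M i\<bar>) + 1"
  have C: "C > 0" unfolding C_def by (simp add: add_nonneg_pos sum_nonneg)
  have bd: "norm (frechet_derivative f (at x) v) \<le> C * norm v" if "x \<in> ball x0 e" for x v
  proof -
    have x: "x \<in> S" "x \<in> cball x0 e" using that e by auto
    interpret linear "frechet_derivative f (at x)"
      by (rule linear_frechet_derivative_smooth(1)[OF assms(1) x(1)])
    have "norm (frechet_derivative f (at x) v) = norm (\<Sum>i\<in>Basis. (v \<bullet> i) *\<^sub>R frechet_derivative f (at x) i)"
      by (subst linear_expand_Basis[OF linear_axioms]) simp
    also have "\<dots> \<le> (\<Sum>i\<in>Basis. norm v * \<bar>M i\<bar>)"
    proof (rule sum_norm_le)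
      fix i :: 'a assume "i \<in> Basis"
      then have "\<bar>v \<bullet> i\<bar> \<le> norm v" by (simp add: Basis_le_norm)
      moreover have "norm (frechet_derivative f (at x) i) \<le> \<bar>M i\<bar>" using M[OF x(2), of i] by simp
      ultimately show "norm ((v \<bullet> i) *\<^sub>R frechet_derivative f (at x) i) \<le> norm v * \<bar>M i\<bar>"
        by (simp add: mult_mono)
    qed
    also have "\<dots> \<le> C * norm v"
      unfolding C_def by (simp add: sum_distrib_left[symmetric] algebra_simps)
    finally show ?thesis .
  qed
  have "norm (f x - f y) \<le> C * norm (x - y)" if "x \<in> ball x0 e" "y \<in> ball x0 e" for x y
  proof (rule differentiable_bound[OF convex_ball[of x0 e] _ _ that])
    fix x assume x: "x \<in> ball x0 e"
    then have "x \<in> S" using e by auto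
    then show "(f has_derivative frechet_derivative f (at x)) (at x within ball x0 e)"
      by (rule has_derivative_at_withinI[OF smooth_on_has_derivative[OF assms(1)]])
    show "onorm (frechet_derivative f (at x)) \<le> C"
      by (rule onorm_le) (rule bd[OF x])
  qed
  then show ?thesis using that[of e C] e bd C by (meson ball_subset_cball order_trans)
qed

text \<open>The function \<open>h t * exp (- C * t)\<close> starts at 0 and has nonpositive
  derivative, so \<open>h t \<le> 0\<close>; nonnegativity of \<open>h t\<close> gives the
  rest.\<close>

lemma gronwall_zero:
  fixes h h' :: "real \<Rightarrow> real"
  assumes "\<And>t. t \<in> {0..1} \<Longrightarrow> (h has_real_derivative h' t) (at t)"
    and "\<And>t. t \<in> {0..1} \<Longrightarrow> \<bar>h' t\<bar> \<le> C * h t" and "h 0 = 0" and "t \<in> {0..1}"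
    and nonneg: "h t \<ge> 0"
  shows "h t = 0"
proof -
  define g where "g = (\<lambda>t. h t * exp (- C * t))"
  have "\<exists>y. (g has_real_derivative y) (at s) \<and> y \<le> 0" if "0 \<le> s" "s \<le> t" for s
  proof -
    have s: "s \<in> {0..1}" using that assms(4) by auto
    have "(g has_real_derivative (h' s * exp (- C * s) + h s * (exp (- C * s) * (- C)))) (at s)"
      unfolding g_def using assms(1)[OF s] by (auto intro!: derivative_eq_intros)
    moreover have "h' s * exp (- C * s) + h s * (exp (- C * s) * (- C)) = (h' s - C * h s) * exp (- C * s)"
      by (simp add: algebra_simps)
    moreover have "h' s - C * h s \<le> 0" using assms(2)[OF s] by linarith
    ultimately show ?thesis
      by (intro exI[of _ "(h' s - C * h s) * exp (- C * s)"]) (simp add: mult_nonpos_nonneg)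
  qed
  then have "g t \<le> g 0"
    using assms(4) DERIV_nonpos_imp_nonincreasing[of 0 t g] by simp
  then have "h t * exp (- C * t) \<le> 0" by (simp add: g_def assms(3))
  then have "h t \<le> 0" by (simp add: mult_le_0_iff)
  then show ?thesis using nonneg by simp
qed

text \<open>The mean value theorem is applied in the direction \<open>u\<close> to a difference in
  the direction \<open>v\<close>, and again in the direction \<open>v\<close>. The left-hand side is
  symmetric in \<open>u\<close> and \<open>v\<close>, the right-hand side is not visibly so; this is
  what yields the symmetry of second derivatives.\<close>

lemma second_difference_mvt:
  fixes f :: "'a::euclidean_space \<Rightarrow> real"
  assumes "smooth_on S f" "ball x r \<subseteq> S" "s > 0" "s * (norm u + norm v) < r"
  shows "\<exists>y. y \<in> ball x r \<and>
    f (x + s *\<^sub>R u + s *\<^sub>R v) - f (x + s *\<^sub>R u) - f (x + s *\<^sub>R v) + f x =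
    s * s * frechet_derivative (\<lambda>z. frechet_derivative f (at z) u) (at y) v"
proof -
  have bd: "norm (a *\<^sub>R u + b *\<^sub>R v) \<le> s * (norm u + norm v)" if "0 \<le> a" "a \<le> s" "0 \<le> b" "b \<le> s" for a b
  proof -
    have "norm (a *\<^sub>R u + b *\<^sub>R v) \<le> a * norm u + b * norm v"
      using that norm_triangle_ineq[of "a *\<^sub>R u" "b *\<^sub>R v"] by simp
    also have "\<dots> \<le> s * norm u + s * norm v"
      using that by (intro add_mono mult_right_mono) auto
    finally show ?thesis by (simp add: algebra_simps)
  qed
  have inb: "x + (a *\<^sub>R u + b *\<^sub>R v) \<in> ball x r" if "0 \<le> a" "a \<le> s" "0 \<le> b" "b \<le> s" for a b
  proof -
    have "dist x (x + w) = norm w" for w by (simp add: dist_norm)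
    then show ?thesis using bd[OF that] assms(4) by simp
  qed
  have inS: "x + a *\<^sub>R u + b *\<^sub>R v \<in> S" if "0 \<le> a" "a \<le> s" "0 \<le> b" "b \<le> s" for a b
    using inb[OF that] assms(2) by (auto simp: add.assoc)
  define g where "g = (\<lambda>a. f (x + a *\<^sub>R u + s *\<^sub>R v) - f (x + a *\<^sub>R u))"
  have D: "((\<lambda>a. f (x + a *\<^sub>R u + b *\<^sub>R v)) has_real_derivative
      frechet_derivative f (at (x + a *\<^sub>R u + b *\<^sub>R v)) u) (at a)"
    if "0 \<le> a" "a \<le> s" "0 \<le> b" "b \<le> s" for a b
  proof -
    have "((\<lambda>a. x + a *\<^sub>R u + b *\<^sub>R v) has_derivative (\<lambda>t. t *\<^sub>R u)) (at a)"
      by (auto intro!: derivative_eq_intros)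
    from has_derivative_compose[OF this smooth_on_has_derivative[OF assms(1) inS[OF that]]]
    have "((\<lambda>a. f (x + a *\<^sub>R u + b *\<^sub>R v)) has_derivative
      (\<lambda>t. frechet_derivative f (at (x + a *\<^sub>R u + b *\<^sub>R v)) (t *\<^sub>R u))) (at a)" .
    moreover have "frechet_derivative f (at (x + a *\<^sub>R u + b *\<^sub>R v)) (t *\<^sub>R u) =
       frechet_derivative f (at (x + a *\<^sub>R u + b *\<^sub>R v)) u * t" for t
      using linear_frechet_derivative_smooth(1)[OF assms(1) inS[OF that]] by (simp add: linear_cmul)
    ultimately show ?thesis by (simp add: has_field_derivative_def)
  qed
  have "(g has_real_derivative frechet_derivative f (at (x + a *\<^sub>R u + s *\<^sub>R v)) u
      - frechet_derivative f (at (x + a *\<^sub>R u)) u) (at a)" if "0 \<le> a" "a \<le> s" for a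
    unfolding g_def using DERIV_diff[OF D[OF that, of s] D[OF that, of 0]] assms(3) by simp
  then obtain a where a: "0 < a" "a < s" and
    ga: "g s - g 0 = (s - 0) * (frechet_derivative f (at (x + a *\<^sub>R u + s *\<^sub>R v)) u
      - frechet_derivative f (at (x + a *\<^sub>R u)) u)"
    using MVT2[OF assms(3), of g "\<lambda>a. frechet_derivative f (at (x + a *\<^sub>R u + s *\<^sub>R v)) u
      - frechet_derivative f (at (x + a *\<^sub>R u)) u"] by auto
  define G where "G = (\<lambda>z. frechet_derivative f (at z) u)"
  have G: "smooth_on S G" unfolding G_def by (rule smooth_on_frechet_derivative[OF assms(1)])
  have "((\<lambda>b. G (x + a *\<^sub>R u + b *\<^sub>R v)) has_real_derivative
      frechet_derivative G (at (x + a *\<^sub>R u + b *\<^sub>R v)) v) (at b)"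
    if "0 \<le> b" "b \<le> s" for b
  proof -
    have xS: "x + a *\<^sub>R u + b *\<^sub>R v \<in> S" using inS that a by auto
    have "((\<lambda>b. x + a *\<^sub>R u + b *\<^sub>R v) has_derivative (\<lambda>t. t *\<^sub>R v)) (at b)"
      by (auto intro!: derivative_eq_intros)
    from has_derivative_compose[OF this smooth_on_has_derivative[OF G xS]]
    have "((\<lambda>b. G (x + a *\<^sub>R u + b *\<^sub>R v)) has_derivative
      (\<lambda>t. frechet_derivative G (at (x + a *\<^sub>R u + b *\<^sub>R v)) (t *\<^sub>R v))) (at b)" .
    moreover have "frechet_derivative G (at (x + a *\<^sub>R u + b *\<^sub>R v)) (t *\<^sub>R v) =
       frechet_derivative G (at (x + a *\<^sub>R u + b *\<^sub>R v)) v * t" for t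
      using linear_frechet_derivative_smooth(1)[OF G xS] by (simp add: linear_cmul)
    ultimately show ?thesis by (simp add: has_field_derivative_def)
  qed
  then obtain b where b: "0 < b" "b < s" and
    gb: "G (x + a *\<^sub>R u + s *\<^sub>R v) - G (x + a *\<^sub>R u + 0 *\<^sub>R v)
       = (s - 0) * frechet_derivative G (at (x + a *\<^sub>R u + b *\<^sub>R v)) v"
    using MVT2[OF assms(3), of "\<lambda>b. G (x + a *\<^sub>R u + b *\<^sub>R v)"
       "\<lambda>b. frechet_derivative G (at (x + a *\<^sub>R u + b *\<^sub>R v)) v"] by auto
  define y where "y = x + a *\<^sub>R u + b *\<^sub>R v"
  have "y \<in> ball x r"
    using inb[of a b] a b by (auto simp: y_def add.assoc)
  moreover have "f (x + s *\<^sub>R u + s *\<^sub>R v) - f (x + s *\<^sub>R u) - f (x + s *\<^sub>R v) + f x = g s - g 0"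
    by (simp add: g_def)
  moreover have "g s - g 0 = s * s * frechet_derivative G (at y) v"
  proof -
    have "g s - g 0 = s * (G (x + a *\<^sub>R u + s *\<^sub>R v) - G (x + a *\<^sub>R u))"
      using ga by (simp add: G_def)
    also have "G (x + a *\<^sub>R u + s *\<^sub>R v) - G (x + a *\<^sub>R u) = s * frechet_derivative G (at y) v"
      using gb by (simp add: y_def)
    finally show ?thesis by (simp add: mult.assoc)
  qed
  ultimately show ?thesis unfolding G_def by metis
qed

lemma frechet_derivative_symmetric_real:
  fixes f :: "'a::euclidean_space \<Rightarrow> real"
  assumes "smooth_on S f" "open S" "x \<in> S"
  shows "frechet_derivative (\<lambda>z. frechet_derivative f (at z) u) (at x) v =
         frechet_derivative (\<lambda>z. frechet_derivative f (at z) v) (at x) u"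
proof (rule ccontr)
  define A where "A = (\<lambda>x. frechet_derivative (\<lambda>z. frechet_derivative f (at z) u) (at x) v)"
  define B where "B = (\<lambda>x. frechet_derivative (\<lambda>z. frechet_derivative f (at z) v) (at x) u)"
  assume "\<not> ?thesis"
  then have ne: "\<bar>A x - B x\<bar> > 0" by (simp add: A_def B_def)
  \<comment> \<open>Half of the assumed gap: a common value of \<open>A\<close> and \<open>B\<close>
    at nearby points would lie strictly within this distance of both \<open>A x\<close> and
    \<open>B x\<close>.\<close>
  define \<epsilon> where "\<epsilon> = \<bar>A x - B x\<bar> / 2"
  have \<epsilon>: "\<epsilon> > 0" using ne by (simp add: \<epsilon>_def)
  have "continuous_on S A" "continuous_on S B"
    unfolding A_def B_def
    by (intro smooth_on_imp_continuous_on smooth_on_frechet_derivative assms(1))+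
  then have "isCont A x" "isCont B x"
    using assms by (auto simp: continuous_on_eq_continuous_at)
  note cont = \<open>isCont A x\<close>[unfolded continuous_at_eps_delta, rule_format, OF \<epsilon>]
    \<open>isCont B x\<close>[unfolded continuous_at_eps_delta, rule_format, OF \<epsilon>]
  obtain d1 where d1: "d1 > 0" "\<And>y. dist y x < d1 \<Longrightarrow> dist (A y) (A x) < \<epsilon>"
    using cont(1) by (auto simp: dist_norm)
  obtain d2 where d2: "d2 > 0" "\<And>y. dist y x < d2 \<Longrightarrow> dist (B y) (B x) < \<epsilon>"
    using cont(2) by (auto simp: dist_norm)
  note d = d1(1) d2(1) d1(2) d2(2)
  obtain d3 where d3: "d3 > 0" "ball x d3 \<subseteq> S" using assms(2,3) open_contains_ball by blast
  define r where "r = min d1 (min d2 d3)"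
  have r: "r > 0" "ball x r \<subseteq> S" using d d3 by (auto simp: r_def)
  \<comment> \<open>Small enough for the whole parallelogram spanned by \<open>s *\<^sub>R u\<close>
    and \<open>s *\<^sub>R v\<close> to lie in the ball; the summand 1 covers the case that both
    vectors are zero.\<close>
  define s where "s = r / (2 * (norm u + norm v + 1))"
  have pos: "norm u + norm v + 1 > 0" by (simp add: add_nonneg_pos)
  have s: "s > 0" using r pos by (simp add: s_def)
  have "s * (norm u + norm v) < s * (2 * (norm u + norm v + 1))" using s
    by (intro mult_strict_left_mono) (auto simp: add_nonneg_pos)
  also have "\<dots> = r" using pos by (simp add: s_def)
  finally have sr: "s * (norm u + norm v) < r" .
  obtain y where y: "y \<in> ball x r"
     "f (x + s *\<^sub>R u + s *\<^sub>R v) - f (x + s *\<^sub>R u) - f (x + s *\<^sub>R v) + f x = s * s * A y"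
    using second_difference_mvt[OF assms(1) r(2) s sr] unfolding A_def by metis
  have sr': "s * (norm v + norm u) < r" using sr by (simp add: algebra_simps)
  obtain z where z: "z \<in> ball x r"
     "f (x + s *\<^sub>R v + s *\<^sub>R u) - f (x + s *\<^sub>R v) - f (x + s *\<^sub>R u) + f x = s * s * B z"
    using second_difference_mvt[OF assms(1) r(2) s sr'] unfolding B_def by metis
  have eq: "x + s *\<^sub>R v + s *\<^sub>R u = x + s *\<^sub>R u + s *\<^sub>R v" by (simp add: algebra_simps)
  have "s * s * A y = s * s * B z" using y(2) z(2) unfolding eq by linarith
  then have "A y = B z" using s by simp
  moreover have "dist (A y) (A x) < \<epsilon>" "dist (B z) (B x) < \<epsilon>"
    using d(3)[of y] d(4)[of z] y(1) z(1) by (simp_all add: r_def dist_commute[of x])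
  ultimately show False
    unfolding \<epsilon>_def dist_real_def by (smt (verit) field_sum_of_halves)
qed

lemma frechet_derivative_symmetric:
  fixes f :: "'a::euclidean_space \<Rightarrow> 'b::euclidean_space"
  assumes "smooth_on S f" "open S" "x \<in> S"
  shows "frechet_derivative (\<lambda>z. frechet_derivative f (at z) u) (at x) v =
         frechet_derivative (\<lambda>z. frechet_derivative f (at z) v) (at x) u"
proof (rule euclidean_eqI)
  fix b :: 'b assume "b \<in> Basis"
  have sm: "smooth_on S (\<lambda>x. f x \<bullet> b)"
    by (rule smooth_on_compose_linear[OF bounded_linear_inner_left assms(2,1)])
  have 1: "frechet_derivative (\<lambda>x. g x \<bullet> b) (at z) w = frechet_derivative g (at z) w \<bullet> b"
    if "smooth_on S g" "z \<in> S" for z w and g :: "'a \<Rightarrow> 'b"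
    using frechet_derivative_at[OF bounded_linear.has_derivative[OF bounded_linear_inner_left
        smooth_on_has_derivative[OF that]]] by metis
  have 2: "frechet_derivative (\<lambda>z. frechet_derivative f (at z) u) (at x) v \<bullet> b =
     frechet_derivative (\<lambda>z. frechet_derivative (\<lambda>x. f x \<bullet> b) (at z) u) (at x) v" for u v
  proof -
    have "frechet_derivative (\<lambda>z. frechet_derivative (\<lambda>x. f x \<bullet> b) (at z) u) (at x) =
          frechet_derivative (\<lambda>z. frechet_derivative f (at z) u \<bullet> b) (at x)"
      by (rule frechet_derivative_cong_open[OF assms(2,3)]) (rule 1[OF assms(1)])
    then show ?thesis using 1[OF smooth_on_frechet_derivative[OF assms(1)] assms(3)] by metis
  qed
  show "frechet_derivative (\<lambda>z. frechet_derivative f (at z) u) (at x) v \<bullet> b =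
         frechet_derivative (\<lambda>z. frechet_derivative f (at z) v) (at x) u \<bullet> b"
    unfolding 2 by (rule frechet_derivative_symmetric_real[OF sm assms(2,3)])
qed

section \<open>Closed two-forms in coordinates\<close>

definition smooth_form_on :: "'a::euclidean_space set \<Rightarrow> ('a \<Rightarrow> 'a \<Rightarrow> 'a \<Rightarrow> real) \<Rightarrow> bool" where
  "smooth_form_on S \<Omega> \<longleftrightarrow> (\<forall>x\<in>S. bilinear (\<Omega> x) \<and> (\<forall>u. \<Omega> x u u = 0)) \<and>
     (\<forall>u v. smooth_on S (\<lambda>x. \<Omega> x u v))"

text \<open>The invariant formula for the exterior derivative on three constant vector fields, for
  which the bracket terms vanish.\<close>

definition ext_deriv :: "('a::euclidean_space \<Rightarrow> 'a \<Rightarrow> 'a \<Rightarrow> real) \<Rightarrow> 'a \<Rightarrow> 'a \<Rightarrow> 'a \<Rightarrow> 'a \<Rightarrow> real" where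
  "ext_deriv \<Omega> x u v w = frechet_derivative (\<lambda>y. \<Omega> y v w) (at x) u
      - frechet_derivative (\<lambda>y. \<Omega> y u w) (at x) v + frechet_derivative (\<lambda>y. \<Omega> y u v) (at x) w"

definition closed_form_on :: "'a::euclidean_space set \<Rightarrow> ('a \<Rightarrow> 'a \<Rightarrow> 'a \<Rightarrow> real) \<Rightarrow> bool" where
  "closed_form_on S \<Omega> \<longleftrightarrow> smooth_form_on S \<Omega> \<and> (\<forall>x\<in>S. \<forall>u v w. ext_deriv \<Omega> x u v w = 0)"

definition pull :: "('a::euclidean_space \<Rightarrow> 'b::euclidean_space) \<Rightarrow> ('b \<Rightarrow> 'b \<Rightarrow> 'b \<Rightarrow> real) \<Rightarrow>
    'a \<Rightarrow> 'a \<Rightarrow> 'a \<Rightarrow> real" where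
  "pull h \<Omega> x u v = \<Omega> (h x) (frechet_derivative h (at x) u) (frechet_derivative h (at x) v)"

lemma bilinear_expand_Basis:
  fixes B :: "'a::euclidean_space \<Rightarrow> 'b::euclidean_space \<Rightarrow> real"
  assumes "bilinear B"
  shows "B u v = (\<Sum>i\<in>Basis. \<Sum>j\<in>Basis. (u \<bullet> i) * (v \<bullet> j) * B i j)"
proof -
  have "B u v = (\<Sum>i\<in>Basis. (u \<bullet> i) *\<^sub>R B i v)"
    using linear_expand_Basis[of "\<lambda>u. B u v" u] assms by (simp add: bilinear_def)
  also have "\<dots> = (\<Sum>i\<in>Basis. (u \<bullet> i) *\<^sub>R (\<Sum>j\<in>Basis. (v \<bullet> j) *\<^sub>R B i j))"
    using linear_expand_Basis[of "\<lambda>v. B i v" v for i] assms by (simp add: bilinear_def)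
  finally show ?thesis by (simp add: sum_distrib_left mult.assoc)
qed

lemma smooth_form_on_linear:
  assumes "smooth_form_on S \<Omega>" "x \<in> S"
  shows "linear (\<Omega> x u)" "linear (\<lambda>u. \<Omega> x u v)"
  using assms unfolding smooth_form_on_def bilinear_def by blast+

lemma smooth_form_on_bilinear: "smooth_form_on S \<Omega> \<Longrightarrow> x \<in> S \<Longrightarrow> bilinear (\<Omega> x)"
  unfolding smooth_form_on_def by blast

lemma alternating_skew:
  fixes B :: "'a::real_vector \<Rightarrow> 'a \<Rightarrow> real"
  assumes "bilinear B" "\<And>u. B u u = 0"
  shows "B u v = - B v u"
proof -
  have "B (u + v) (u + v) = B u u + B u v + B v u + B v v"
    using assms(1) by (simp add: bilinear_ladd bilinear_radd)
  then show ?thesis using assms(2) by simp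
qed

lemma smooth_form_on_skew: "smooth_form_on S \<Omega> \<Longrightarrow> x \<in> S \<Longrightarrow> \<Omega> x u v = - \<Omega> x v u"
  unfolding smooth_form_on_def using alternating_skew by metis

text \<open>Smoothness of a form is given for fixed arguments only; expanding \<open>a x\<close> and
  \<open>b x\<close> in \<open>Basis\<close> reduces varying arguments to this case.\<close>

lemma smooth_on_form_apply:
  fixes h :: "'a::euclidean_space \<Rightarrow> 'b::euclidean_space"
  assumes "smooth_form_on T \<Omega>" "open S" "smooth_on S h" "h ` S \<subseteq> T" "smooth_on S a" "smooth_on S b"
  shows "smooth_on S (\<lambda>x. \<Omega> (h x) (a x) (b x))"
proof -
  have 1: "smooth_on S (\<lambda>x. \<Omega> (h x) i j)" for i j
    using smooth_on_compose[OF assms(2,3) _ assms(4), of "\<lambda>y. \<Omega> y i j"] assms(1)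
    unfolding smooth_form_on_def by blast
  have 2: "smooth_on S (\<lambda>x. a x \<bullet> i)" "smooth_on S (\<lambda>x. b x \<bullet> i)" for i
    by (rule smooth_on_compose_linear[OF bounded_linear_inner_left assms(2)], rule assms)+
  have "smooth_on S (\<lambda>x. \<Sum>i\<in>Basis. \<Sum>j\<in>Basis. (a x \<bullet> i) * (b x \<bullet> j) * \<Omega> (h x) i j)"
    by (intro smooth_on_sum smooth_on_bilinear[OF bounded_bilinear_mult] assms(2) 1 2)
  moreover have "\<Omega> (h x) (a x) (b x) = (\<Sum>i\<in>Basis. \<Sum>j\<in>Basis. (a x \<bullet> i) * (b x \<bullet> j) * \<Omega> (h x) i j)"
    if "x \<in> S" for x
    using assms(1,4) that by (intro bilinear_expand_Basis smooth_form_on_bilinear) auto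
  ultimately show ?thesis
    using smooth_on_cong[OF assms(2), of "\<lambda>x. \<Omega> (h x) (a x) (b x)"] by simp
qed

text \<open>The Leibniz rule for a form whose base point and both arguments move. The form is
  written through its coefficients in \<open>Basis\<close>, differentiated as a sum of products, and
  the three groups of terms are reassembled.\<close>

lemma has_derivative_form_apply:
  fixes h :: "'a::euclidean_space \<Rightarrow> 'b::euclidean_space"
  assumes "smooth_form_on T \<Omega>" "open T" "h x \<in> T"
    and h: "(h has_derivative h') (at x)" and a: "(a has_derivative a') (at x)"
    and b: "(b has_derivative b') (at x)"
  shows "((\<lambda>x. \<Omega> (h x) (a x) (b x)) has_derivative
     (\<lambda>w. frechet_derivative (\<lambda>y. \<Omega> y (a x) (b x)) (at (h x)) (h' w)
        + \<Omega> (h x) (a' w) (b x) + \<Omega> (h x) (a x) (b' w))) (at x)"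
proof -
  let ?D = "\<lambda>i j. frechet_derivative (\<lambda>y. \<Omega> y i j) (at (h x))"
  have Om: "((\<lambda>y. \<Omega> y i j) has_derivative ?D i j) (at (h x))" for i j
    using assms(1,3) smooth_on_has_derivative unfolding smooth_form_on_def by blast
  have Omh: "((\<lambda>x. \<Omega> (h x) i j) has_derivative (\<lambda>w. ?D i j (h' w))) (at x)" for i j
    by (rule has_derivative_compose[OF h Om])
  have "((\<lambda>y. \<Sum>i\<in>Basis. \<Sum>j\<in>Basis. (a x \<bullet> i) * (b x \<bullet> j) * \<Omega> y i j) has_derivative
      (\<lambda>w. \<Sum>i\<in>Basis. \<Sum>j\<in>Basis. (a x \<bullet> i) * (b x \<bullet> j) * ?D i j w)) (at (h x))"
    by (intro has_derivative_sum has_derivative_mult_right Om)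
  then have "((\<lambda>y. \<Omega> y (a x) (b x)) has_derivative
      (\<lambda>w. \<Sum>i\<in>Basis. \<Sum>j\<in>Basis. (a x \<bullet> i) * (b x \<bullet> j) * ?D i j w)) (at (h x))"
    by (rule has_derivative_transform_within_open[OF _ assms(2,3)])
      (rule bilinear_expand_Basis[OF smooth_form_on_bilinear[OF assms(1)], symmetric])
  from frechet_derivative_at[OF this]
  have D: "frechet_derivative (\<lambda>y. \<Omega> y (a x) (b x)) (at (h x)) =
    (\<lambda>w. \<Sum>i\<in>Basis. \<Sum>j\<in>Basis. (a x \<bullet> i) * (b x \<bullet> j) * ?D i j w)" by simp
  have ab: "((\<lambda>x. (a x \<bullet> i) * (b x \<bullet> j)) has_derivative
      (\<lambda>w. (a x \<bullet> i) * (b' w \<bullet> j) + (a' w \<bullet> i) * (b x \<bullet> j))) (at x)" for i j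
    by (intro has_derivative_mult bounded_linear.has_derivative[OF bounded_linear_inner_left] a b)
  have "((\<lambda>x. \<Sum>i\<in>Basis. \<Sum>j\<in>Basis. (a x \<bullet> i) * (b x \<bullet> j) * \<Omega> (h x) i j) has_derivative
     (\<lambda>w. \<Sum>i\<in>Basis. \<Sum>j\<in>Basis. (a x \<bullet> i) * (b x \<bullet> j) * ?D i j (h' w) +
        ((a x \<bullet> i) * (b' w \<bullet> j) + (a' w \<bullet> i) * (b x \<bullet> j)) * \<Omega> (h x) i j)) (at x)"
    by (intro has_derivative_sum has_derivative_mult ab Omh)
  moreover have "(\<lambda>w. \<Sum>i\<in>Basis. \<Sum>j\<in>Basis. (a x \<bullet> i) * (b x \<bullet> j) * ?D i j (h' w) +
        ((a x \<bullet> i) * (b' w \<bullet> j) + (a' w \<bullet> i) * (b x \<bullet> j)) * \<Omega> (h x) i j) =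
     (\<lambda>w. frechet_derivative (\<lambda>y. \<Omega> y (a x) (b x)) (at (h x)) (h' w)
        + \<Omega> (h x) (a' w) (b x) + \<Omega> (h x) (a x) (b' w))"
  proof
    fix w
    note e = bilinear_expand_Basis[OF smooth_form_on_bilinear[OF assms(1,3)]]
    show "(\<Sum>i\<in>Basis. \<Sum>j\<in>Basis. (a x \<bullet> i) * (b x \<bullet> j) * ?D i j (h' w) +
        ((a x \<bullet> i) * (b' w \<bullet> j) + (a' w \<bullet> i) * (b x \<bullet> j)) * \<Omega> (h x) i j) =
      frechet_derivative (\<lambda>y. \<Omega> y (a x) (b x)) (at (h x)) (h' w)
        + \<Omega> (h x) (a' w) (b x) + \<Omega> (h x) (a x) (b' w)"
      unfolding D e[of "a' w" "b x"] e[of "a x" "b' w"] by (simp add: sum.distrib algebra_simps)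
  qed
  ultimately have "((\<lambda>x. \<Sum>i\<in>Basis. \<Sum>j\<in>Basis. (a x \<bullet> i) * (b x \<bullet> j) * \<Omega> (h x) i j) has_derivative
     (\<lambda>w. frechet_derivative (\<lambda>y. \<Omega> y (a x) (b x)) (at (h x)) (h' w)
        + \<Omega> (h x) (a' w) (b x) + \<Omega> (h x) (a x) (b' w))) (at x)" by simp
  moreover have "\<forall>\<^sub>F z in at x. h z \<in> T"
    using has_derivative_continuous[OF h] assms(2,3) unfolding continuous_at
    by (metis topological_tendstoD)
  then have "\<forall>\<^sub>F z in at x. (\<Sum>i\<in>Basis. \<Sum>j\<in>Basis. (a z \<bullet> i) * (b z \<bullet> j) * \<Omega> (h z) i j) = \<Omega> (h z) (a z) (b z)"
    by eventually_elim (rule bilinear_expand_Basis[OF smooth_form_on_bilinear[OF assms(1)], symmetric])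
  ultimately show ?thesis
    by (rule has_derivative_transform_eventually)
      (rule bilinear_expand_Basis[OF smooth_form_on_bilinear[OF assms(1,3)], symmetric], simp)
qed

lemma pull_smooth:
  fixes h :: "'a::euclidean_space \<Rightarrow> 'b::euclidean_space"
  assumes "smooth_form_on T \<Omega>" "open S" "smooth_on S h" "h ` S \<subseteq> T"
  shows "smooth_form_on S (pull h \<Omega>)"
  unfolding smooth_form_on_def
proof (intro conjI ballI allI)
  fix x assume x: "x \<in> S"
  then have hx: "h x \<in> T" using assms(4) by auto
  note l = linear_frechet_derivative_smooth(1)[OF assms(3) x]
  show "bilinear (pull h \<Omega> x)"
    unfolding bilinear_def pull_def
    using linear_compose[OF l smooth_form_on_linear(1)[OF assms(1) hx]]
      linear_compose[OF l smooth_form_on_linear(2)[OF assms(1) hx]] by (simp add: o_def)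
  show "pull h \<Omega> x u u = 0" for u
    using assms(1) hx unfolding pull_def smooth_form_on_def by blast
next
  fix u v
  show "smooth_on S (\<lambda>x. pull h \<Omega> x u v)"
    unfolding pull_def
    by (intro smooth_on_form_apply[OF assms(1,2,3,4)] smooth_on_frechet_derivative assms(3))
qed

text \<open>The second derivatives of \<open>h\<close> cancel because they are symmetric.\<close>

lemma pull_closed:
  fixes h :: "'a::euclidean_space \<Rightarrow> 'b::euclidean_space"
  assumes "closed_form_on T \<Omega>" "open T" "open S" "smooth_on S h" "h ` S \<subseteq> T"
  shows "closed_form_on S (pull h \<Omega>)"
  unfolding closed_form_on_def
proof (intro conjI ballI allI)
  have sf: "smooth_form_on T \<Omega>" using assms(1) unfolding closed_form_on_def by blast
  then show "smooth_form_on S (pull h \<Omega>)" using pull_smooth assms by blast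
  fix x u v w assume x: "x \<in> S"
  then have hx: "h x \<in> T" using assms(5) by auto
  let ?d = "frechet_derivative h (at x)"
  let ?dd = "\<lambda>u v. frechet_derivative (\<lambda>x. frechet_derivative h (at x) u) (at x) v"
  have D: "frechet_derivative (\<lambda>y. pull h \<Omega> y a b) (at x) c =
     frechet_derivative (\<lambda>y. \<Omega> y (?d a) (?d b)) (at (h x)) (?d c)
        + \<Omega> (h x) (?dd a c) (?d b) + \<Omega> (h x) (?d a) (?dd b c)" for a b c
    unfolding pull_def
    by (subst frechet_derivative_at[OF has_derivative_form_apply[OF sf assms(2) hx
        smooth_on_has_derivative[OF assms(4) x]
        smooth_on_has_derivative[OF smooth_on_frechet_derivative[OF assms(4)] x]
        smooth_on_has_derivative[OF smooth_on_frechet_derivative[OF assms(4)] x]], symmetric]) simp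
  have "ext_deriv \<Omega> (h x) (?d u) (?d v) (?d w) = 0"
    using assms(1) hx unfolding closed_form_on_def by blast
  moreover have sym: "?dd a b = ?dd b a" for a b
    by (rule frechet_derivative_symmetric[OF assms(4,3) x])
  \<comment> \<open>Of the six terms with second derivatives, two pairs cancel once the order of
    differentiation is normalised. The last pair differs in the slot of the form that holds the
    second derivative, so it cancels by skew-symmetry.\<close>
  ultimately show "ext_deriv (pull h \<Omega>) x u v w = 0"
    unfolding ext_deriv_def D sym[of v u] sym[of w u] sym[of w v]
    using smooth_form_on_skew[OF sf hx, of "?d v" "?dd u w"] by linarith
qed

lemma closed_form_on_diff:
  assumes "closed_form_on S \<alpha>" "closed_form_on S \<beta>" "open S"
  shows "closed_form_on S (\<lambda>x u v. \<alpha> x u v - \<beta> x u v)"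
proof -
  have a: "smooth_form_on S \<alpha>" and b: "smooth_form_on S \<beta>"
    using assms(1,2) unfolding closed_form_on_def by blast+
  have sm: "smooth_on S (\<lambda>x. \<alpha> x u v)" "smooth_on S (\<lambda>x. \<beta> x u v)" for u v
    using a b unfolding smooth_form_on_def by blast+
  have "smooth_on S (\<lambda>x. \<alpha> x u v + (- 1) * \<beta> x u v)" for u v
    by (intro smooth_on_add smooth_on_compose_linear[OF bounded_linear_mult_right] assms(3) sm)
  then have 1: "smooth_on S (\<lambda>x. \<alpha> x u v - \<beta> x u v)" for u v by simp
  have D: "frechet_derivative (\<lambda>y. \<alpha> y u v - \<beta> y u v) (at x) w =
     frechet_derivative (\<lambda>y. \<alpha> y u v) (at x) w - frechet_derivative (\<lambda>y. \<beta> y u v) (at x) w"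
    if "x \<in> S" for x u v w
    using frechet_derivative_at[OF has_derivative_diff[OF smooth_on_has_derivative[OF sm(1) that]
        smooth_on_has_derivative[OF sm(2) that]]] by metis
  have "smooth_form_on S (\<lambda>x u v. \<alpha> x u v - \<beta> x u v)"
    using a b 1 unfolding smooth_form_on_def bilinear_def by (auto intro!: linear_compose_sub)
  moreover have "ext_deriv (\<lambda>x u v. \<alpha> x u v - \<beta> x u v) x u v w = 0" if "x \<in> S" for x u v w
  proof -
    have "ext_deriv \<alpha> x u v w = 0" "ext_deriv \<beta> x u v w = 0"
      using assms(1,2) that unfolding closed_form_on_def by blast+
    then show ?thesis unfolding ext_deriv_def D[OF that] by simp
  qed
  ultimately show ?thesis unfolding closed_form_on_def by blast
qed

section \<open>Forms of constant rank and transport along their kernels\<close>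

text \<open>Precomposition with \<pi> turns conditions on the vectors of \<open>L\<close> into
  conditions on all vectors, to which expansions in \<open>Basis\<close> apply.\<close>

lemma subspace_projection_exists:
  fixes L :: "'a::euclidean_space set"
  assumes "subspace L"
  obtains \<pi> :: "'a \<Rightarrow> 'a" where "bounded_linear \<pi>" "\<And>w. \<pi> w \<in> L" "\<And>w. w \<in> L \<Longrightarrow> \<pi> w = w"
proof -
  obtain B where B: "B \<subseteq> L" "pairwise orthogonal B" "\<And>x. x \<in> B \<Longrightarrow> norm x = 1" "independent B" "span B = L"
    using orthonormal_basis_subspace[OF assms] by metis
  define \<pi> where "\<pi> w = (\<Sum>b\<in>B. (w \<bullet> b) *\<^sub>R b)" for w
  have lin: "linear \<pi>" unfolding \<pi>_def
    by (auto intro!: linearI simp: inner_add_left sum.distrib scaleR_add_left scaleR_right.sum)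
  have "finite B" using B(4) independent_imp_finite by blast
  have "\<pi> b = b" if "b \<in> B" for b
  proof -
    have "\<pi> b = (\<Sum>c\<in>B. if c = b then b else 0)"
      unfolding \<pi>_def
    proof (rule sum.cong)
      fix c assume "c \<in> B"
      have "b \<bullet> b = 1" using B(3)[OF that] by (simp add: norm_eq_1)
      moreover have "b \<bullet> c = 0" if "c \<noteq> b"
        using B(2) \<open>b \<in> B\<close> \<open>c \<in> B\<close> that by (auto simp: pairwise_def orthogonal_def)
      ultimately show "(b \<bullet> c) *\<^sub>R c = (if c = b then b else 0)" by auto
    qed simp
    then show ?thesis using \<open>finite B\<close> that by simp
  qed
  then have "\<pi> w = w" if "w \<in> L" for w
    using linear_eq_on_span[OF lin linear_ident, of B w] that B(5) by simp
  moreover have "\<pi> w \<in> L" for w unfolding \<pi>_def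
    using B(1) by (auto intro!: subspace_sum[OF assms] subspace_scale[OF assms])
  ultimately show ?thesis using that lin linear_conv_bounded_linear by blast
qed

lemma smooth_on_family_lipschitz:
  fixes f :: "'i \<Rightarrow> 'a::euclidean_space \<Rightarrow> 'b::real_normed_vector"
  assumes "finite J" "\<And>i. i \<in> J \<Longrightarrow> smooth_on S (f i)" "open S" "x0 \<in> S"
  shows "\<exists>r>0. \<exists>C>0. ball x0 r \<subseteq> S \<and>
    (\<forall>i\<in>J. \<forall>x\<in>ball x0 r. \<forall>y\<in>ball x0 r. norm (f i x - f i y) \<le> C * norm (x - y))"
  using assms(1,2)
proof (induction J rule: finite_induct)
  case empty
  obtain r where "r > 0" "ball x0 r \<subseteq> S" using assms(3,4) open_contains_ball by blast
  then show ?case by (intro exI[of _ r] conjI exI[of _ "1::real"]) auto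
next
  case (insert j J)
  then obtain r C where r: "r > 0" "C > 0" "ball x0 r \<subseteq> S"
    "\<forall>i\<in>J. \<forall>x\<in>ball x0 r. \<forall>y\<in>ball x0 r. norm (f i x - f i y) \<le> C * norm (x - y)"
    by (metis insertI2)
  have sm: "smooth_on S (f j)" using insert by simp
  obtain r' C' where r': "r' > 0" "C' > 0" "ball x0 r' \<subseteq> S"
    "\<And>x y. x \<in> ball x0 r' \<Longrightarrow> y \<in> ball x0 r' \<Longrightarrow> norm (f j x - f j y) \<le> C' * norm (x - y)"
    using smooth_on_locally_bounded_derivative[OF sm assms(3,4)] by metis
  have "norm (f i x - f i y) \<le> (C + C') * norm (x - y)"
    if "i \<in> insert j J" "x \<in> ball x0 (min r r')" "y \<in> ball x0 (min r r')" for i x y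
  proof -
    have "x \<in> ball x0 r" "y \<in> ball x0 r" "x \<in> ball x0 r'" "y \<in> ball x0 r'" using that by auto
    then have "norm (f i x - f i y) \<le> C * norm (x - y) \<or> norm (f i x - f i y) \<le> C' * norm (x - y)"
      using that(1) r(4) r'(4) by blast
    then show ?thesis
      using r(2) r'(2) mult_right_mono[of C "C + C'" "norm (x - y)"] mult_right_mono[of C' "C + C'" "norm (x - y)"] by auto
  qed
  moreover have "min r r' > 0" "C + C' > 0" "ball x0 (min r r') \<subseteq> S" using r r' by auto
  ultimately show ?case by blast
qed

lemma smooth_form_on_lipschitz:
  fixes \<Omega> :: "'a::euclidean_space \<Rightarrow> 'a \<Rightarrow> 'a \<Rightarrow> real"
  assumes "smooth_form_on S \<Omega>" "open S" "x0 \<in> S"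
  obtains r C where "r > 0" "C > 0" "ball x0 r \<subseteq> S"
    "\<And>x y u v. x \<in> ball x0 r \<Longrightarrow> y \<in> ball x0 r \<Longrightarrow>
       \<bar>\<Omega> x u v - \<Omega> y u v\<bar> \<le> C * norm (x - y) * norm u * norm v"
proof -
  have sm: "smooth_on S (\<lambda>x. \<Omega> x (fst p) (snd p))" for p
    using assms(1) unfolding smooth_form_on_def by blast
  obtain r C where r: "r > 0" "C > 0" "ball x0 r \<subseteq> S"
    "\<forall>p\<in>Basis\<times>Basis. \<forall>x\<in>ball x0 r. \<forall>y\<in>ball x0 r.
       norm (\<Omega> x (fst p) (snd p) - \<Omega> y (fst p) (snd p)) \<le> C * norm (x - y)"
    using smooth_on_family_lipschitz[of "Basis\<times>Basis" S "\<lambda>p x. \<Omega> x (fst p) (snd p)" x0] sm assms(2,3)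
    by auto
  \<comment> \<open>The number of coefficients of the form; each contributes at most
    \<open>C * norm (x - y) * norm u * norm v\<close>.\<close>
  define n where "n = real (card ((Basis::'a set)\<times>(Basis::'a set)))"
  have n: "n > 0" by (simp add: n_def card_gt_0_iff)
  have "\<bar>\<Omega> x u v - \<Omega> y u v\<bar> \<le> (n * C) * norm (x - y) * norm u * norm v"
    if xy: "x \<in> ball x0 r" "y \<in> ball x0 r" for x y u v
  proof -
    have xyS: "x \<in> S" "y \<in> S" using xy r by auto
    have "\<Omega> x u v - \<Omega> y u v =
       (\<Sum>i\<in>Basis. \<Sum>j\<in>Basis. (u \<bullet> i) * (v \<bullet> j) * (\<Omega> x i j - \<Omega> y i j))"
      unfolding bilinear_expand_Basis[OF smooth_form_on_bilinear[OF assms(1) xyS(1)], of u v]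
        bilinear_expand_Basis[OF smooth_form_on_bilinear[OF assms(1) xyS(2)], of u v]
      by (simp add: sum_subtractf[symmetric] right_diff_distrib)
    also have "\<dots> = (\<Sum>p\<in>Basis\<times>Basis. (u \<bullet> fst p) * (v \<bullet> snd p) * (\<Omega> x (fst p) (snd p) - \<Omega> y (fst p) (snd p)))"
      by (simp add: sum.cartesian_product case_prod_beta)
    also have "\<bar>\<dots>\<bar> \<le> (\<Sum>p\<in>(Basis::'a set)\<times>(Basis::'a set). norm u * norm v * (C * norm (x - y)))"
    proof (rule order_trans[OF sum_abs sum_mono])
      fix p :: "'a \<times> 'a" assume p: "p \<in> Basis \<times> Basis"
      have "\<bar>u \<bullet> fst p\<bar> \<le> norm u" "\<bar>v \<bullet> snd p\<bar> \<le> norm v" using p by (auto intro: Basis_le_norm)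
      moreover have "\<bar>\<Omega> x (fst p) (snd p) - \<Omega> y (fst p) (snd p)\<bar> \<le> C * norm (x - y)"
        using r(4) p xy by auto
      ultimately show "\<bar>(u \<bullet> fst p) * (v \<bullet> snd p) * (\<Omega> x (fst p) (snd p) - \<Omega> y (fst p) (snd p))\<bar>
          \<le> norm u * norm v * (C * norm (x - y))"
        unfolding abs_mult by (intro mult_mono) auto
    qed
    finally show ?thesis by (simp add: n_def algebra_simps)
  qed
  moreover have "n * C > 0" using n r by simp
  ultimately show ?thesis using that r by blast
qed

lemma smooth_on_derivative_lipschitz:
  fixes f :: "'a::euclidean_space \<Rightarrow> 'b::real_normed_vector"
  assumes "smooth_on S f" "open S" "x0 \<in> S"
  obtains r C where "r > 0" "C > 0" "ball x0 r \<subseteq> S"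
    "\<And>x y v. x \<in> ball x0 r \<Longrightarrow> y \<in> ball x0 r \<Longrightarrow>
       norm (frechet_derivative f (at x) v - frechet_derivative f (at y) v) \<le> C * norm (x - y) * norm v"
proof -
  obtain r C where r: "r > 0" "C > 0" "ball x0 r \<subseteq> S"
    "\<forall>i\<in>Basis. \<forall>x\<in>ball x0 r. \<forall>y\<in>ball x0 r.
       norm (frechet_derivative f (at x) i - frechet_derivative f (at y) i) \<le> C * norm (x - y)"
    using smooth_on_family_lipschitz[of Basis S "\<lambda>i x. frechet_derivative f (at x) i" x0]
      smooth_on_frechet_derivative[OF assms(1)] assms(2,3) by auto
  define n where "n = real DIM('a)"
  have n: "n > 0" by (simp add: n_def)
  have "norm (frechet_derivative f (at x) v - frechet_derivative f (at y) v) \<le> (n * C) * norm (x - y) * norm v"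
    if xy: "x \<in> ball x0 r" "y \<in> ball x0 r" for x y v
  proof -
    have xyS: "x \<in> S" "y \<in> S" using xy r by auto
    have "frechet_derivative f (at x) v - frechet_derivative f (at y) v =
       (\<Sum>i\<in>Basis. (v \<bullet> i) *\<^sub>R (frechet_derivative f (at x) i - frechet_derivative f (at y) i))"
      unfolding linear_expand_Basis[OF linear_frechet_derivative_smooth(1)[OF assms(1) xyS(1)], of v]
        linear_expand_Basis[OF linear_frechet_derivative_smooth(1)[OF assms(1) xyS(2)], of v]
      by (simp add: sum_subtractf[symmetric] scaleR_diff_right)
    also have "norm \<dots> \<le> (\<Sum>i\<in>(Basis::'a set). norm v * (C * norm (x - y)))"
    proof (rule sum_norm_le)
      fix i :: 'a assume i: "i \<in> Basis"
      have "\<bar>v \<bullet> i\<bar> \<le> norm v" using i by (rule Basis_le_norm)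
      moreover have "norm (frechet_derivative f (at x) i - frechet_derivative f (at y) i) \<le> C * norm (x - y)"
        using r(4) i xy by auto
      ultimately show "norm ((v \<bullet> i) *\<^sub>R (frechet_derivative f (at x) i - frechet_derivative f (at y) i))
          \<le> norm v * (C * norm (x - y))"
        by (simp add: mult_mono)
    qed
    finally show ?thesis by (simp add: n_def algebra_simps)
  qed
  moreover have "n * C > 0" using n r by simp
  ultimately show ?thesis using that r by blast
qed

text \<open>In a slice chart of \<open>M\<close> the subspace \<open>L\<close> is the coordinate
  image of every tangent space, so this is the kernel of \<nu> in coordinates, moving inside one
  fixed space.\<close>

definition fkernel :: "'a set \<Rightarrow> ('a::euclidean_space \<Rightarrow> 'a \<Rightarrow> 'a \<Rightarrow> real) \<Rightarrow> 'a \<Rightarrow> 'a set" where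
  "fkernel L \<Omega> x = {u\<in>L. \<forall>v\<in>L. \<Omega> x u v = 0}"

lemma subspace_fkernel:
  assumes "subspace L" "smooth_form_on S \<Omega>" "x \<in> S"
  shows "subspace (fkernel L \<Omega> x)"
proof -
  note l = smooth_form_on_linear(2)[OF assms(2,3)]
  show ?thesis
    using assms(1) unfolding fkernel_def
    by (auto simp: subspace_def linear_add[OF l] linear_cmul[OF l] linear_0[OF l])
qed

text \<open>Regularity of a field of subspaces without the choice of a local frame: a vector at one
  point can be replaced by one at another point, with an error proportional to the distance and to
  its length.\<close>

definition lipschitz_distribution :: "real \<Rightarrow> 'a set \<Rightarrow> ('a::euclidean_space \<Rightarrow> 'a set) \<Rightarrow> bool" where
  "lipschitz_distribution C X K \<longleftrightarrow> (\<forall>x\<in>X. \<forall>y\<in>X. \<forall>v\<in>K x. \<exists>v'\<in>K y. norm (v - v') \<le> C * norm (x - y) * norm v)"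

text \<open>Near \<open>x0\<close> the form stays injective on a fixed complement \<open>Q\<close> of its kernel at \<open>x0\<close>; by the
  constant rank, \<open>Q\<close> is a complement of all nearby kernels, and the \<open>Q\<close>-component of a vector is
  controlled by the value of the form on it.\<close>

lemma fkernel_lipschitz:
  fixes \<Omega> :: "'a::euclidean_space \<Rightarrow> 'a \<Rightarrow> 'a \<Rightarrow> real"
  assumes "smooth_form_on V \<Omega>" "open V" "subspace L" "x0 \<in> V" "x0 \<in> X"
    and k: "\<And>x. x \<in> V \<Longrightarrow> x \<in> X \<Longrightarrow> dim (fkernel L \<Omega> x) = k"
  obtains r C where "r > 0" "C > 0" "ball x0 r \<subseteq> V" "lipschitz_distribution C (ball x0 r \<inter> X) (fkernel L \<Omega>)"
proof -
  obtain \<pi> :: "'a \<Rightarrow> 'a" where \<pi>: "bounded_linear \<pi>" "\<And>w. \<pi> w \<in> L" "\<And>w. w \<in> L \<Longrightarrow> \<pi> w = w"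
    using subspace_projection_exists[OF assms(3)] by metis
  obtain r0 C0 where r0: "r0 > 0" "C0 > 0" "ball x0 r0 \<subseteq> V"
    "\<And>x y u v. x \<in> ball x0 r0 \<Longrightarrow> y \<in> ball x0 r0 \<Longrightarrow>
       \<bar>\<Omega> x u v - \<Omega> y u v\<bar> \<le> C0 * norm (x - y) * norm u * norm v"
    using smooth_form_on_lipschitz[OF assms(1,2,4)] by metis
  \<comment> \<open>Encodes the functional \<open>\<Omega> x u\<close> on \<open>L\<close> as a
    vector, so that the kernel becomes the null space of a linear map that depends on
    \<open>x\<close> in a Lipschitz way.\<close>
  define T where "T x u = (\<Sum>i\<in>Basis. \<Omega> x u (\<pi> i) *\<^sub>R i)" for x u
  have T0: "T x u = 0 \<longleftrightarrow> (\<forall>v\<in>L. \<Omega> x u v = 0)" if "x \<in> V" for x u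
  proof
    assume "T x u = 0"
    then have 0: "\<Omega> x u (\<pi> i) = 0" if "i \<in> Basis" for i
    proof -
      have "T x u \<bullet> i = \<Omega> x u (\<pi> i)" unfolding T_def using that by (rule inner_sum_left_Basis)
      then show ?thesis using \<open>T x u = 0\<close> by simp
    qed
    have lin: "linear (\<lambda>v. \<Omega> x u (\<pi> v))"
      using linear_compose[OF bounded_linear.linear[OF \<pi>(1)] smooth_form_on_linear(1)[OF assms(1) that]]
      by (simp add: o_def)
    have "\<Omega> x u (\<pi> v) = 0" for v
      using linear_expand_Basis[OF lin, of v] 0 by simp
    then show "\<forall>v\<in>L. \<Omega> x u v = 0" using \<pi>(3) by metis
  next
    assume "\<forall>v\<in>L. \<Omega> x u v = 0"
    then show "T x u = 0" using \<pi>(2) by (simp add: T_def)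
  qed
  have linT: "linear (T x)" if "x \<in> V" for x
  proof -
    have l: "linear (\<lambda>u. \<Omega> x u v)" for v using smooth_form_on_linear(2)[OF assms(1) that] .
    show ?thesis unfolding T_def
      by (rule linearI) (simp_all add: linear_add[OF l] linear_cmul[OF l] sum.distrib scaleR_add_left scaleR_right.sum)
  qed
  define C1 where "C1 = C0 * (\<Sum>i\<in>(Basis::'a set). norm (\<pi> i)) + 1"
  have C1: "C1 > 0" unfolding C1_def using r0(2) by (simp add: add_nonneg_pos sum_nonneg)
  have TL: "norm (T x u - T y u) \<le> C1 * norm (x - y) * norm u" if "x \<in> ball x0 r0" "y \<in> ball x0 r0" for x y u
  proof -
    have "T x u - T y u = (\<Sum>i\<in>Basis. (\<Omega> x u (\<pi> i) - \<Omega> y u (\<pi> i)) *\<^sub>R i)"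
      unfolding T_def by (simp add: sum_subtractf[symmetric] scaleR_diff_left)
    also have "norm \<dots> \<le> (\<Sum>i\<in>Basis. C0 * norm (x - y) * norm u * norm (\<pi> i))"
      using r0(4)[OF that] by (intro sum_norm_le) auto
    also have "\<dots> = (C0 * (\<Sum>i\<in>(Basis::'a set). norm (\<pi> i))) * (norm (x - y) * norm u)"
      by (simp add: sum_distrib_left algebra_simps)
    also have "\<dots> \<le> C1 * (norm (x - y) * norm u)"
      by (intro mult_right_mono) (auto simp: C1_def)
    finally show ?thesis by (simp add: algebra_simps)
  qed
  define K where "K = fkernel L \<Omega>"
  have K: "K x = {u\<in>L. T x u = 0}" if "x \<in> V" for x
    unfolding K_def fkernel_def using T0[OF that] by auto
  have subK: "subspace (K x)" if "x \<in> V" for x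
    unfolding K_def by (rule subspace_fkernel[OF assms(3,1) that])
  define Q where "Q = {y\<in>L. \<forall>x\<in>K x0. orthogonal x y}"
  have KL: "K x0 \<subseteq> L" unfolding K_def fkernel_def by auto
  have dimQ: "dim Q + dim (K x0) = dim L"
    unfolding Q_def by (rule dim_subspace_orthogonal_to_vectors[OF subK[OF assms(4)] assms(3) KL])
  have subQ: "subspace Q"
    using assms(3) unfolding Q_def orthogonal_def subspace_def by (auto simp: inner_add_right)
  have QL: "Q \<subseteq> L" unfolding Q_def by auto
  have "q = 0" if "q \<in> Q" "T x0 q = 0" for q
  proof -
    have "q \<in> K x0" using that K[OF assms(4)] QL by auto
    then show ?thesis using that(1) unfolding Q_def orthogonal_def by auto
  qed
  then obtain e where e: "e > 0" "\<And>q. q \<in> Q \<Longrightarrow> norm (T x0 q) \<ge> e * norm q"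
    using injective_imp_isometric[OF closed_subspace[OF subQ] subQ, of "T x0"]
      linT[OF assms(4)] linear_conv_bounded_linear by blast
  \<comment> \<open>Within \<open>e / (2 * C1)\<close> of \<open>x0\<close> the map \<open>T\<close>
    changes on a vector \<open>q\<close> by at most \<open>e / 2 * norm q\<close>, so half of the
    lower bound \<open>e\<close> on \<open>Q\<close> survives.\<close>
  define r where "r = min r0 (e / (2 * C1))"
  have r: "r > 0" using r0(1) e(1) C1 by (simp add: r_def)
  have rV: "ball x0 r \<subseteq> V" using r0(3) by (auto simp: r_def)
  have lower: "norm (T x q) \<ge> (e / 2) * norm q" if "q \<in> Q" "x \<in> ball x0 r" for q x
  proof -
    have "norm (T x0 q - T x q) \<le> C1 * norm (x0 - x) * norm q"
      using that r0(1) by (intro TL) (auto simp: r_def)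
    also have "\<dots> \<le> C1 * (e / (2 * C1)) * norm q"
      using that C1 by (intro mult_right_mono mult_left_mono) (auto simp: r_def dist_norm)
    also have "\<dots> = (e / 2) * norm q" using C1 by simp
    finally have "norm (T x0 q - T x q) \<le> (e / 2) * norm q" .
    moreover have "norm (T x0 q) \<le> norm (T x0 q - T x q) + norm (T x q)"
      using norm_triangle_ineq[of "T x0 q - T x q" "T x q"] by simp
    ultimately show ?thesis using e(2)[OF that(1)] by (simp add: field_simps)
  qed
  have decomp: "\<exists>v'\<in>K y. \<exists>q\<in>Q. v = v' + q" if "y \<in> ball x0 r" "y \<in> X" "v \<in> L" for y v
  proof -
    have y: "y \<in> V" using that rV by auto
    have "K y \<inter> Q = {0}"
    proof
      show "K y \<inter> Q \<subseteq> {0}"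
      proof
        fix q assume q: "q \<in> K y \<inter> Q"
        then have "T y q = 0" using K[OF y] by auto
        then have "e / 2 * norm q \<le> 0" using lower[of q y] that q by auto
        then show "q \<in> {0}" using e(1) by (simp add: mult_le_0_iff)
      qed
      show "{0} \<subseteq> K y \<inter> Q" using subK[OF y] subQ subspace_0 by auto
    qed
    then have "dim {a + b |a b. a \<in> K y \<and> b \<in> Q} = dim (K y) + dim Q"
      using dim_sums_Int[OF subK[OF y] subQ] by simp
    \<comment> \<open>Here the constant rank enters: since \<open>Q\<close> meets \<open>K y\<close>
      only in 0, equal dimensions of \<open>K y\<close> and \<open>K x0\<close> make the two span
      \<open>L\<close>.\<close>
    also have "\<dots> = dim L" using dimQ k[of y] k[of x0] assms(4,5) y that(2) unfolding K_def by simp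
    finally have d: "dim {a + b |a b. a \<in> K y \<and> b \<in> Q} = dim L" .
    have "K y \<subseteq> L" unfolding K_def fkernel_def by auto
    then have "{a + b |a b. a \<in> K y \<and> b \<in> Q} \<subseteq> L"
      using QL subspace_add[OF assms(3)] by blast
    then have "{a + b |a b. a \<in> K y \<and> b \<in> Q} = L"
      using subspace_dim_equal[OF subspace_sums[OF subK[OF y] subQ] assms(3)] d by simp
    then show ?thesis using that(3) by blast
  qed
  have "\<exists>v'\<in>K y. norm (v - v') \<le> (2 / e * C1) * norm (x - y) * norm v"
    if "x \<in> ball x0 r" "y \<in> ball x0 r" "y \<in> X" "v \<in> K x" for x y v
  proof -
    have xV: "x \<in> V" and yV: "y \<in> V" using that rV by auto
    have vL: "v \<in> L" and Tx: "T x v = 0" using that(4) K[OF xV] by auto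
    note d = decomp[OF that(2,3) vL]
    obtain v' q where v': "v' \<in> K y" "q \<in> Q" "v = v' + q" using d by blast
    \<comment> \<open>\<open>T y\<close> sees only the \<open>Q\<close>-component of
      \<open>v\<close>, while \<open>T x v = 0\<close>. So \<open>T y q\<close> is the variation of
      \<open>T\<close> between the two points, and the lower bound on \<open>Q\<close> converts this
      into a bound for \<open>q\<close>.\<close>
    have "T y v = T y v' + T y q" using linear_add[OF linT[OF yV]] v'(3) by simp
    also have "T y v' = 0" using v'(1) K[OF yV] by auto
    finally have "T y q = T y v - T x v" using Tx by simp
    then have "norm (T y q) \<le> C1 * norm (y - x) * norm v"
      using TL[of y x v] that by (simp add: r_def)
    moreover have "(e / 2) * norm q \<le> norm (T y q)" using lower v'(2) that(2) by blast
    ultimately have "(e / 2) * norm q \<le> C1 * norm (x - y) * norm v" by (simp add: norm_minus_commute)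
    then have "norm q \<le> (2 / e * C1) * norm (x - y) * norm v" using e(1) by (simp add: field_simps)
    then show ?thesis using v' by (intro bexI[of _ v']) auto
  qed
  moreover have "2 / e * C1 > 0" using e C1 by simp
  ultimately show ?thesis using that[of r "2 / e * C1"] r rV unfolding K_def lipschitz_distribution_def by blast
qed

section \<open>Transport estimates along curves tangent to a distribution\<close>

text \<open>The squared norm, unlike the norm, is differentiable also where \<open>g\<close>
  vanishes; it satisfies the scalar inequality with the constant \<open>2 * C\<close>.\<close>

lemma gronwall_zero_vector:
  fixes g g' :: "real \<Rightarrow> 'a::real_inner"
  assumes "\<And>t. t \<in> {0..1} \<Longrightarrow> (g has_vector_derivative g' t) (at t)"
    and "\<And>t. t \<in> {0..1} \<Longrightarrow> norm (g' t) \<le> C * norm (g t)" and "g 0 = 0" and "t \<in> {0..1}"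
  shows "g t = 0"
proof -
  have "g t \<bullet> g t = 0"
  proof (rule gronwall_zero[where h = "\<lambda>t. g t \<bullet> g t" and h' = "\<lambda>t. 2 * (g t \<bullet> g' t)" and C = "2 * C"])
    fix s :: real assume s: "s \<in> {0..1}"
    show "((\<lambda>t. g t \<bullet> g t) has_real_derivative 2 * (g s \<bullet> g' s)) (at s)"
      using has_derivative_inner[OF assms(1)[OF s, unfolded has_vector_derivative_def]
         assms(1)[OF s, unfolded has_vector_derivative_def]]
      unfolding has_field_derivative_def
      by (rule has_derivative_eq_rhs) (auto simp: inner_commute algebra_simps)
    have "\<bar>g s \<bullet> g' s\<bar> \<le> norm (g s) * norm (g' s)" by (rule Cauchy_Schwarz_ineq2)
    also have "\<dots> \<le> norm (g s) * (C * norm (g s))" using assms(2)[OF s] by (intro mult_left_mono) auto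
    also have "\<dots> = C * (g s \<bullet> g s)" by (simp add: dot_square_norm power2_eq_square)
    finally show "\<bar>2 * (g s \<bullet> g' s)\<bar> \<le> 2 * C * (g s \<bullet> g s)" by simp
  qed (use assms in auto)
  then show ?thesis by simp
qed

text \<open>Transport of a closed form \<open>\<beta>\<close> that annihilates the distribution \<open>K\<close>: by \<open>d\<beta> = 0\<close> and the
  Lipschitz continuity of \<open>K\<close>, along curves tangent to \<open>K\<close> the coefficients of \<open>\<beta>\<close> satisfy
  a linear differential inequality.\<close>

lemma closed_form_transport_zero:
  fixes \<beta> :: "'a::euclidean_space \<Rightarrow> 'a \<Rightarrow> 'a \<Rightarrow> real" and \<gamma> :: "real \<Rightarrow> 'a"
  assumes "closed_form_on V \<beta>" "open V" "subspace L"
    and lip: "lipschitz_distribution C (V \<inter> L) K" and "C > 0"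
    and KL: "\<And>x. x \<in> V \<inter> L \<Longrightarrow> K x \<subseteq> L"
    and ann: "\<And>x e w. x \<in> V \<inter> L \<Longrightarrow> e \<in> K x \<Longrightarrow> w \<in> L \<Longrightarrow> \<beta> x e w = 0"
    and \<gamma>: "\<And>t. t \<in> {0..1} \<Longrightarrow> \<gamma> t \<in> V \<inter> L"
      "\<And>t. t \<in> {0..1} \<Longrightarrow> (\<gamma> has_vector_derivative \<gamma>' t) (at t)"
      "\<And>t. t \<in> {0..1} \<Longrightarrow> \<gamma>' t \<in> K (\<gamma> t)" "\<And>t. t \<in> {0..1} \<Longrightarrow> norm (\<gamma>' t) \<le> D"
    and zero: "\<And>v w. v \<in> L \<Longrightarrow> w \<in> L \<Longrightarrow> \<beta> (\<gamma> 0) v w = 0"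
    and "v \<in> L" "w \<in> L"
  shows "\<beta> (\<gamma> 1) v w = 0"
proof -
  have sf: "smooth_form_on V \<beta>" using assms(1) unfolding closed_form_on_def by blast
  obtain \<pi> :: "'a \<Rightarrow> 'a" where \<pi>: "bounded_linear \<pi>" "\<And>w. \<pi> w \<in> L" "\<And>w. w \<in> L \<Longrightarrow> \<pi> w = w"
    using subspace_projection_exists[OF assms(3)] by metis
  let ?I = "(Basis::'a set) \<times> (Basis::'a set)"
  define b where "b p x = \<beta> x (\<pi> (fst p)) (\<pi> (snd p))" for p x
  \<comment> \<open>The size of the restriction of \<beta> to \<open>L\<close>, measured by its
    coefficients; it has to vanish at the end of the curve.\<close>
  define N where "N x = (\<Sum>p\<in>?I. \<bar>b p x\<bar>)" for x
  have sb: "smooth_on V (b p)" for p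
    using sf unfolding smooth_form_on_def b_def by blast
  have bound: "\<bar>\<beta> x u v\<bar> \<le> N x * norm u * norm v" if "x \<in> V" "u \<in> L" "v \<in> L" for x u v
  proof -
    have lin: "linear \<pi>" using \<pi>(1) bounded_linear.linear by blast
    have "bilinear (\<lambda>u v. \<beta> x (\<pi> u) (\<pi> v))"
      using linear_compose[OF lin smooth_form_on_linear(1)[OF sf that(1)]]
        linear_compose[OF lin smooth_form_on_linear(2)[OF sf that(1)]] unfolding bilinear_def by (simp add: o_def)
    from bilinear_expand_Basis[OF this, of u v]
    have "\<beta> x u v = (\<Sum>p\<in>?I. (u \<bullet> fst p) * (v \<bullet> snd p) * b p x)"
      using \<pi>(3) that by (simp add: sum.cartesian_product case_prod_beta b_def)
    also have "\<bar>\<dots>\<bar> \<le> (\<Sum>p\<in>?I. (norm u * norm v) * \<bar>b p x\<bar>)"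
    proof (rule order_trans[OF sum_abs sum_mono])
      fix p :: "'a \<times> 'a" assume p: "p \<in> Basis \<times> Basis"
      have "\<bar>u \<bullet> fst p\<bar> \<le> norm u" "\<bar>v \<bullet> snd p\<bar> \<le> norm v" using p by (auto intro: Basis_le_norm)
      then show "\<bar>(u \<bullet> fst p) * (v \<bullet> snd p) * b p x\<bar> \<le> (norm u * norm v) * \<bar>b p x\<bar>"
        unfolding abs_mult by (intro mult_right_mono mult_mono) auto
    qed
    finally show ?thesis unfolding N_def by (simp add: sum_distrib_left[symmetric] algebra_simps)
  qed
  have N0: "N x \<ge> 0" for x unfolding N_def by (simp add: sum_nonneg)
  have contN: "isCont N x" if "x \<in> V" for x
    unfolding N_def using smooth_on_imp_continuous_on[OF sb] that assms(2)
    by (auto intro!: continuous_sum continuous_rabs simp: continuous_on_eq_continuous_at)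
  \<comment> \<open>At \<open>x\<close> the function \<open_quote>\<open>\<beta> y e w\<close> of
    \<open>y\<close> vanishes, and at a nearby \<open>y\<close> in \<open>L\<close> it equals
    \<open>\<beta> y (e - e') w\<close> with \<open>e'\<close> in \<open>K y\<close> close to
    \<open>e\<close>. Difference quotients along \<open>L\<close> are therefore bounded by the size
    of \<beta> itself, with no bound on its derivatives.\<close>
  have slope: "\<bar>frechet_derivative (\<lambda>y. \<beta> y e w) (at x) v\<bar> \<le> C * N x * norm v * norm e * norm w"
    if x: "x \<in> V \<inter> L" and e: "e \<in> K x" and vw: "v \<in> L" "w \<in> L" for x e v w
  proof -
    let ?F = "\<lambda>y. \<beta> y e w"
    have eL: "e \<in> L" using KL x e by blast
    have "smooth_on V ?F" using sf unfolding smooth_form_on_def by blast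
    then have D: "(?F has_derivative frechet_derivative ?F (at x)) (at x)"
      using smooth_on_has_derivative x by blast
    have "((\<lambda>s. x + s *\<^sub>R v) has_derivative (\<lambda>s. s *\<^sub>R v)) (at 0)"
      by (auto intro!: derivative_eq_intros)
    from has_derivative_compose[OF this, of ?F "frechet_derivative ?F (at x)"] D
    have "((\<lambda>s. ?F (x + s *\<^sub>R v)) has_derivative (\<lambda>s. frechet_derivative ?F (at x) (s *\<^sub>R v))) (at 0)"
      by simp
    then have "((\<lambda>s. ?F (x + s *\<^sub>R v)) has_real_derivative frechet_derivative ?F (at x) v) (at 0)"
      unfolding has_field_derivative_def
      by (rule has_derivative_eq_rhs)
        (simp add: fun_eq_iff linear_cmul[OF has_derivative_linear[OF D]])
    then have "((\<lambda>s. (?F (x + s *\<^sub>R v) - ?F x) / s) \<longlongrightarrow> frechet_derivative ?F (at x) v) (at 0)"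
      by (simp add: DERIV_def)
    then have lim: "((\<lambda>s. \<bar>(?F (x + s *\<^sub>R v) - ?F x) / s\<bar>) \<longlongrightarrow> \<bar>frechet_derivative ?F (at x) v\<bar>) (at 0)"
      by (rule tendsto_rabs)
    have linex: "((\<lambda>s. x + s *\<^sub>R v) \<longlongrightarrow> x) (at 0)"
      by (rule tendsto_eq_intros | simp)+
    then have "((\<lambda>s. N (x + s *\<^sub>R v)) \<longlongrightarrow> N x) (at 0)"
      using contN x isCont_tendsto_compose by blast
    then have lim2: "((\<lambda>s. C * N (x + s *\<^sub>R v) * norm v * norm e * norm w) \<longlongrightarrow> C * N x * norm v * norm e * norm w) (at 0)"
      by (intro tendsto_intros)
    have "\<forall>\<^sub>F s in at 0. x + s *\<^sub>R v \<in> V"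
      using linex x assms(2) topological_tendstoD by blast
    then have "\<forall>\<^sub>F s in at 0. \<bar>(?F (x + s *\<^sub>R v) - ?F x) / s\<bar> \<le> C * N (x + s *\<^sub>R v) * norm v * norm e * norm w"
      using eventually_neq_at_within[of 0 0 UNIV]
    proof eventually_elim
      case (elim s)
      define y where "y = x + s *\<^sub>R v"
      have y: "y \<in> V \<inter> L" using elim x vw assms(3) by (auto simp: y_def subspace_add subspace_scale)
      obtain e' where e': "e' \<in> K y" "norm (e - e') \<le> C * norm (x - y) * norm e"
        using lip x y e unfolding lipschitz_distribution_def by blast
      have e'L: "e' \<in> L" using e' KL y by blast
      have "?F x = 0" using ann x e vw by blast
      moreover have "\<beta> y e w = \<beta> y (e - e') w"
      proof -
        have "linear (\<lambda>u. \<beta> y u w)" using smooth_form_on_linear(2)[OF sf] y by blast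
        then show ?thesis using linear_diff[of "\<lambda>u. \<beta> y u w" e e'] ann[OF y e'(1) vw(2)] by simp
      qed
      moreover have "\<bar>\<beta> y (e - e') w\<bar> \<le> N y * norm (e - e') * norm w"
        using bound y eL e'L vw assms(3) by (simp add: subspace_diff)
      moreover have "N y * norm (e - e') * norm w \<le> N y * (C * (\<bar>s\<bar> * norm v) * norm e) * norm w"
        using e'(2) N0 by (intro mult_right_mono mult_left_mono) (auto simp: y_def)
      ultimately have "\<bar>?F y - ?F x\<bar> \<le> (C * N y * norm v * norm e * norm w) * \<bar>s\<bar>"
        by (simp add: algebra_simps)
      then show ?case using elim(2) unfolding y_def[symmetric] abs_divide
        by (simp add: divide_le_eq)
    qed
    then show ?thesis
      by (rule tendsto_le[OF at_neq_bot lim2 lim])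
  qed
  define M where "M = (\<Sum>i\<in>(Basis::'a set). norm (\<pi> i))"
  have \<pi>M: "norm (\<pi> i) \<le> M" if "i \<in> Basis" for i
    unfolding M_def using that by (intro member_le_sum) auto
  have M0: "M \<ge> 0" unfolding M_def by (simp add: sum_nonneg)
  define n where "n = real (card ?I)"
  define b' where "b' p t = frechet_derivative (b p) (at (\<gamma> t)) (\<gamma>' t)" for p t
  have D0: "D \<ge> 0" using order_trans[OF norm_ge_zero \<gamma>(4)[of 0]] by simp
  \<comment> \<open>Two slope terms, each with two projected basis vectors of norm at most
    \<open>M\<close> and one velocity of norm at most \<open>D\<close>.\<close>
  define E where "E = 2 * (C * M * D * M)"
  have b'_bound: "\<bar>b' p t\<bar> \<le> E * N (\<gamma> t)" if "p \<in> ?I" "t \<in> {0..1}" for p t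
  proof -
    let ?x = "\<gamma> t" and ?e = "\<gamma>' t" and ?i = "\<pi> (fst p)" and ?j = "\<pi> (snd p)"
    have x: "?x \<in> V \<inter> L" and e: "?e \<in> K ?x" and eD: "norm ?e \<le> D" using \<gamma> that by auto
    \<comment> \<open>Closedness trades the derivative of a coefficient along the curve for two
      derivatives of \<beta> with the kernel vector \<open>?e\<close> in one slot, which are exactly
      those that \<open>slope\<close> bounds.\<close>
    have "ext_deriv \<beta> ?x ?e ?i ?j = 0" using assms(1) x unfolding closed_form_on_def by blast
    then have "b' p t = frechet_derivative (\<lambda>y. \<beta> y ?e ?j) (at ?x) ?i - frechet_derivative (\<lambda>y. \<beta> y ?e ?i) (at ?x) ?j"
      unfolding ext_deriv_def b'_def b_def[abs_def] by simp
    moreover have "C * N ?x * norm ?i * norm ?e * norm ?j \<le> C * N ?x * M * D * M"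
      using that eD \<pi>M M0 D0 N0 assms(5) by (intro mult_mono mult_nonneg_nonneg) auto
    moreover have "C * N ?x * norm ?j * norm ?e * norm ?i \<le> C * N ?x * M * D * M"
      using that eD \<pi>M M0 D0 N0 assms(5) by (intro mult_mono mult_nonneg_nonneg) auto
    moreover have "\<bar>frechet_derivative (\<lambda>y. \<beta> y ?e ?j) (at ?x) ?i\<bar> \<le> C * N ?x * norm ?i * norm ?e * norm ?j"
      "\<bar>frechet_derivative (\<lambda>y. \<beta> y ?e ?i) (at ?x) ?j\<bar> \<le> C * N ?x * norm ?j * norm ?e * norm ?i"
      by (rule slope[OF x e \<pi>(2) \<pi>(2)])+
    ultimately have "\<bar>b' p t\<bar> \<le> 2 * (C * N ?x * M * D * M)" by linarith
    then show ?thesis by (simp add: E_def algebra_simps)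
  qed
  \<comment> \<open>Squares replace the absolute values of \<open>N\<close> for the sake of
    differentiability. The square of \<open>N\<close> is at most \<open>n\<close> times
    \<open>h\<close> by the Cauchy-Schwarz inequality, whence the constant
    \<open>2 * E * n\<close>.\<close>
  define h where "h t = (\<Sum>p\<in>?I. (b p (\<gamma> t))\<^sup>2)" for t
  define h' where "h' t = (\<Sum>p\<in>?I. 2 * (b p (\<gamma> t) * b' p t))" for t
  have "h 1 = 0"
  proof (rule gronwall_zero[where h = h and h' = h' and C = "2 * E * n"])
    fix t :: real assume t: "t \<in> {0..1}"
    have "((\<lambda>t. b p (\<gamma> t)) has_real_derivative b' p t) (at t)" for p
    proof -
      have Db: "(b p has_derivative frechet_derivative (b p) (at (\<gamma> t))) (at (\<gamma> t))"
        using smooth_on_has_derivative[OF sb] \<gamma>(1)[OF t] by blast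
      show ?thesis
        unfolding has_field_derivative_def
        using has_derivative_compose[OF \<gamma>(2)[OF t, unfolded has_vector_derivative_def] Db]
        by (rule has_derivative_eq_rhs)
          (simp add: fun_eq_iff linear_cmul[OF has_derivative_linear[OF Db]] b'_def)
    qed
    then have "((\<lambda>t. (b p (\<gamma> t))\<^sup>2) has_real_derivative 2 * (b p (\<gamma> t) * b' p t)) (at t)" for p
      using DERIV_power[of "\<lambda>t. b p (\<gamma> t)" "b' p t" t UNIV 2] by (simp add: mult.commute)
    then show "(h has_real_derivative h' t) (at t)"
      unfolding h_def[abs_def] h'_def by (intro DERIV_sum)
    have "\<bar>h' t\<bar> \<le> (\<Sum>p\<in>?I. 2 * (\<bar>b p (\<gamma> t)\<bar> * (E * N (\<gamma> t))))"
      unfolding h'_def using b'_bound[OF _ t]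
      by (intro order_trans[OF sum_abs sum_mono]) (auto simp: abs_mult intro!: mult_left_mono)
    also have "\<dots> = 2 * E * (N (\<gamma> t))\<^sup>2"
      by (simp add: N_def sum_distrib_left[symmetric] sum_distrib_right[symmetric] power2_eq_square)
    also have "\<dots> \<le> 2 * E * (h t * n)"
      using sum_squared_le_sum_of_squares[of "\<lambda>p. \<bar>b p (\<gamma> t)\<bar>" ?I] assms(5) M0 D0
      unfolding N_def h_def n_def by (intro mult_left_mono) (auto simp: E_def)
    finally show "\<bar>h' t\<bar> \<le> 2 * E * n * h t" by (simp add: algebra_simps)
  next
    show "h 0 = 0" unfolding h_def b_def using zero[OF \<pi>(2) \<pi>(2)] by simp
  qed (auto simp: h_def sum_nonneg)
  then have "b p (\<gamma> 1) = 0" if "p \<in> ?I" for p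
    using that unfolding h_def by (subst (asm) sum_nonneg_eq_0_iff) auto
  then have "N (\<gamma> 1) = 0" unfolding N_def by simp
  then show ?thesis using bound[of "\<gamma> 1" v w] \<gamma>(1)[of 1] assms by simp
qed

text \<open>\<open>G\<close> stands for coordinates transversal to an integral manifold,
  \<open>p\<close> for a point of that manifold whose distance from \<open>x\<close> is bounded by
  \<open>C1 * norm (G x)\<close>. At \<open>p\<close> the derivative of \<open>G\<close> annihilates
  \<open>K p\<close>. Passing from \<open>p\<close> to \<open>x\<close> costs one multiple of the
  distance for moving the vector and one for moving the derivative. The radius depends on
  \<open>G\<close> alone, so that the distribution may be restricted afterwards.\<close>

lemma transversal_growth_bound:
  fixes G :: "'a::euclidean_space \<Rightarrow> 'b::real_normed_vector"
  assumes "smooth_on V G" "open V" "x0 \<in> V"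
  obtains r where "r > 0" "ball x0 r \<subseteq> V"
    "\<And>X K C C1. lipschitz_distribution C X K \<Longrightarrow> C > 0 \<Longrightarrow> C1 > 0 \<Longrightarrow>
       \<exists>E. \<forall>x\<in>ball x0 r \<inter> X. \<forall>p\<in>ball x0 r \<inter> X. norm (x - p) \<le> C1 * norm (G x) \<longrightarrow>
         (\<forall>e\<in>K p. frechet_derivative G (at p) e = 0) \<longrightarrow>
         (\<forall>v\<in>K x. norm (frechet_derivative G (at x) v) \<le> E * norm (G x) * norm v)"
proof -
  obtain r1 C2 where r1: "r1 > 0" "C2 > 0" "ball x0 r1 \<subseteq> V"
    "\<And>x v. x \<in> ball x0 r1 \<Longrightarrow> norm (frechet_derivative G (at x) v) \<le> C2 * norm v"
    using smooth_on_locally_bounded_derivative[OF assms] by metis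
  obtain r2 C3 where r2: "r2 > 0" "C3 > 0" "ball x0 r2 \<subseteq> V"
    "\<And>x y v. x \<in> ball x0 r2 \<Longrightarrow> y \<in> ball x0 r2 \<Longrightarrow>
       norm (frechet_derivative G (at x) v - frechet_derivative G (at y) v) \<le> C3 * norm (x - y) * norm v"
    using smooth_on_derivative_lipschitz[OF assms] by metis
  define r where "r = min r1 r2"
  have main: "\<exists>E. \<forall>x\<in>ball x0 r \<inter> X. \<forall>p\<in>ball x0 r \<inter> X. norm (x - p) \<le> C1 * norm (G x) \<longrightarrow>
         (\<forall>e\<in>K p. frechet_derivative G (at p) e = 0) \<longrightarrow>
         (\<forall>v\<in>K x. norm (frechet_derivative G (at x) v) \<le> E * norm (G x) * norm v)"
    if lip: "lipschitz_distribution C X K" and C: "C > 0" "C1 > 0" for X K C C1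
  proof (intro exI ballI impI)
    fix x p v assume x: "x \<in> ball x0 r \<inter> X" and p: "p \<in> ball x0 r \<inter> X"
      and xp: "norm (x - p) \<le> C1 * norm (G x)"
      and Kp: "\<forall>e\<in>K p. frechet_derivative G (at p) e = 0" and v: "v \<in> K x"
    obtain v' where v': "v' \<in> K p" "norm (v - v') \<le> C * norm (x - p) * norm v"
      using lip x p v unfolding lipschitz_distribution_def by blast
    have pV: "p \<in> V" using p r1 by (auto simp: r_def)
    have "frechet_derivative G (at p) v = frechet_derivative G (at p) (v - v')"
      using linear_diff[OF linear_frechet_derivative_smooth(1)[OF assms(1) pV]] Kp v' by simp
    then have "norm (frechet_derivative G (at p) v) \<le> C2 * norm (v - v')"
      using r1(4)[of p] p by (simp add: r_def)
    also have "\<dots> \<le> C2 * (C * norm (x - p) * norm v)"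
      using v'(2) r1(2) by (intro mult_left_mono) auto
    finally have 1: "norm (frechet_derivative G (at p) v) \<le> C2 * (C * norm (x - p) * norm v)" .
    have 2: "norm (frechet_derivative G (at x) v - frechet_derivative G (at p) v) \<le> C3 * norm (x - p) * norm v"
      using r2(4) x p by (auto simp: r_def)
    have "norm (frechet_derivative G (at x) v) \<le>
      norm (frechet_derivative G (at p) v) + norm (frechet_derivative G (at x) v - frechet_derivative G (at p) v)"
      by (metis norm_triangle_sub)
    also have "\<dots> \<le> C2 * (C * norm (x - p) * norm v) + C3 * norm (x - p) * norm v"
      using 1 2 by linarith
    also have "\<dots> = (C2 * C + C3) * norm v * norm (x - p)" by (simp add: algebra_simps)
    also have "\<dots> \<le> (C2 * C + C3) * norm v * (C1 * norm (G x))"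
      using xp r1(2) r2(2) C by (intro mult_left_mono mult_nonneg_nonneg add_nonneg_nonneg) simp_all
    finally show "norm (frechet_derivative G (at x) v) \<le> ((C2 * C + C3) * C1) * norm (G x) * norm v"
      by (simp add: algebra_simps)
  qed
  have "r > 0" "ball x0 r \<subseteq> V" using r1 r2 by (auto simp: r_def)
  from that[OF this main] show ?thesis by simp
qed

text \<open>A smooth map that is idempotent on \<open>L\<close> is, near a fixed point, conjugate to its derivative by
  \<open>\<Psi>\<close>, which has derivative \<open>id\<close> there; its fibres are therefore tangent to the kernel
  of the derivative.\<close>

lemma idempotent_fibre_curve:
  fixes f :: "'a::euclidean_space \<Rightarrow> 'a"
  assumes sm: "smooth_on V f" and V: "open V" and x0: "x0 \<in> V" "x0 \<in> L" and L: "subspace L"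
    and fix0: "f x0 = x0" and fL: "\<And>x. x \<in> V \<inter> L \<Longrightarrow> f x \<in> L"
    and idem: "\<And>x. x \<in> V \<inter> L \<Longrightarrow> f x \<in> V \<Longrightarrow> f (f x) = f x"
    and u: "u \<in> L" "frechet_derivative f (at x0) u = 0"
  obtains \<epsilon> \<gamma> \<gamma>' where "\<epsilon> > 0" "\<gamma> 0 = x0"
    "\<And>t::real. \<bar>t\<bar> < \<epsilon> \<Longrightarrow> \<gamma> t \<in> V \<inter> L \<and> f (\<gamma> t) = x0 \<and> (\<gamma> has_vector_derivative \<gamma>' t) (at t)"
    "(\<gamma>' \<longlongrightarrow> u) (at 0)"
proof -
  obtain \<pi> :: "'a \<Rightarrow> 'a" where \<pi>: "bounded_linear \<pi>" "\<And>w. \<pi> w \<in> L" "\<And>w. w \<in> L \<Longrightarrow> \<pi> w = w"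
    using subspace_projection_exists[OF L] by metis
  have cont\<pi>: "continuous_on S \<pi>" for S using \<pi>(1) by (simp add: linear_continuous_on)
  \<comment> \<open>Composition with the projection yields a map that is idempotent on an open set
    and not only on \<open>L\<close>, as needed for derivatives and the inverse function
    theorem.\<close>
  define F where "F x = f (\<pi> x)" for x
  define V1 where "V1 = \<pi> -` V"
  have V1: "open V1" unfolding V1_def using open_vimage[OF V cont\<pi>] by simp
  have sF1: "smooth_on V1 F"
    unfolding F_def[abs_def] by (rule smooth_on_compose[OF V1 smooth_on_linear[OF \<pi>(1)] sm]) (auto simp: V1_def)
  define W where "W = V1 \<inter> F -` V"
  have W: "open W" unfolding W_def
    by (rule continuous_open_preimage[OF smooth_on_imp_continuous_on[OF sF1] V1 V])
  have sF: "smooth_on W F" using sF1 smooth_on_subset unfolding W_def by blast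
  have FL: "F x \<in> L" if "x \<in> W" for x
    using that fL \<pi>(2) unfolding W_def V1_def F_def by auto
  have FF: "F (F x) = F x" if "x \<in> W" for x
  proof -
    have "\<pi> (F x) = F x" using FL[OF that] \<pi>(3) by blast
    then show ?thesis using idem[of "\<pi> x"] that \<pi>(2) unfolding W_def V1_def F_def by auto
  qed
  have F0: "F x0 = x0" using x0 \<pi>(3) fix0 by (simp add: F_def)
  have x0W: "x0 \<in> W" unfolding W_def V1_def using F0 x0 \<pi>(3) by simp
  define P where "P = frechet_derivative F (at x0)"
  have DF: "(F has_derivative P) (at x0)" unfolding P_def by (rule smooth_on_has_derivative[OF sF x0W])
  have linP: "linear P" and blP: "bounded_linear P"
    unfolding P_def by (rule linear_frechet_derivative_smooth[OF sF x0W])+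
  have "((\<lambda>x. F (F x)) has_derivative (\<lambda>v. P (P v))) (at x0)"
    using has_derivative_compose[OF DF, of F P] DF F0 by simp
  then have "(F has_derivative (\<lambda>v. P (P v))) (at x0)"
    by (rule has_derivative_transform_within_open[OF _ W x0W]) (rule FF)
  then have PP: "P (P v) = P v" for v using has_derivative_unique[OF _ DF] by metis
  have "((\<lambda>x. \<pi> (F x)) has_derivative (\<lambda>v. \<pi> (P v))) (at x0)"
    by (rule bounded_linear.has_derivative[OF \<pi>(1) DF])
  then have "(F has_derivative (\<lambda>v. \<pi> (P v))) (at x0)"
    by (rule has_derivative_transform_within_open[OF _ W x0W]) (use FL \<pi>(3) in auto)
  then have "\<pi> (P v) = P v" for v using has_derivative_unique[OF _ DF] by metis
  then have PL: "P v \<in> L" for v using \<pi>(2) by metis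
  have Pu: "P u = 0"
  proof -
    have "(f has_derivative frechet_derivative f (at x0)) (at (\<pi> x0))"
      using smooth_on_has_derivative[OF sm x0(1)] x0(2) \<pi>(3) by simp
    from has_derivative_compose[OF bounded_linear_imp_has_derivative[OF \<pi>(1)] this]
    have "(F has_derivative (\<lambda>v. frechet_derivative f (at x0) (\<pi> v))) (at x0)"
      unfolding F_def[abs_def] .
    then have "P = (\<lambda>v. frechet_derivative f (at x0) (\<pi> v))" using has_derivative_unique[OF DF] by blast
    then show ?thesis using u \<pi>(3) by simp
  qed
  \<comment> \<open>\<open>\<Psi> x - x0\<close> is the sum of \<open>x - F x\<close> with its
    \<open>P\<close>-part removed and of \<open>P (F x - x0)\<close>. This choice gives
    \<open>\<Psi> (F x) = x0 + P (\<Psi> x - x0)\<close>, so that in the new coordinate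
    \<open>F\<close> becomes the linear projection \<open>P\<close>. The map \<open>Q\<close> is the
    reflection that fixes the range of \<open>P\<close>; it only serves to write \<Psi> as a sum of
    smooth terms.\<close>
  define Q where "Q v = P v - (v - P v)" for v
  define \<Psi> where "\<Psi> x = (x - P x) + Q (F x) - P x0 + x0" for x
  have \<Psi>_alt: "\<Psi> x = x0 + ((x - F x) - P (x - F x)) + P (F x - x0)" for x
    unfolding \<Psi>_def Q_def by (simp add: linear_diff[OF linP])
  have blQ: "bounded_linear Q" unfolding Q_def[abs_def]
    by (intro bounded_linear_sub bounded_linear_ident blP)
  have "smooth_on W (\<lambda>x. (x - P x) + Q (F x) + (x0 - P x0))"
    by (intro smooth_on_add W smooth_on_const smooth_on_linear bounded_linear_sub bounded_linear_ident blP
         smooth_on_compose_linear[OF blQ W sF])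
  then have s\<Psi>: "smooth_on W \<Psi>" unfolding \<Psi>_def[abs_def] by (simp add: algebra_simps)
  have D\<Psi>0: "frechet_derivative \<Psi> (at x0) v = v" for v
  proof -
    have "(\<Psi> has_derivative (\<lambda>v. (v - P v) + Q (P v))) (at x0)"
      unfolding \<Psi>_def[abs_def]
      by (auto intro!: derivative_eq_intros bounded_linear_imp_has_derivative[OF blP]
          bounded_linear.has_derivative[OF blQ DF])
    then have "frechet_derivative \<Psi> (at x0) = (\<lambda>v. (v - P v) + Q (P v))"
      using frechet_derivative_at by metis
    then show ?thesis by (simp add: Q_def PP)
  qed
  define D where "D x = Blinfun (frechet_derivative \<Psi> (at x))" for x
  have Dapp: "blinfun_apply (D x) = frechet_derivative \<Psi> (at x)" if "x \<in> W" for x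
    unfolding D_def using linear_frechet_derivative_smooth(2)[OF s\<Psi> that]
    by (simp add: bounded_linear_Blinfun_apply)
  have "continuous_on W (\<lambda>x. blinfun_apply (D x) i)" for i
    using smooth_on_imp_continuous_on[OF smooth_on_frechet_derivative[OF s\<Psi>, of i]] Dapp
    by (simp cong: continuous_on_cong)
  then have contD: "continuous_on W D" by (intro continuous_on_blinfun_componentwise)
  have D0: "D x0 = id_blinfun"
    by (rule blinfun_eqI) (simp add: Dapp[OF x0W] D\<Psi>0)
  have invD: "id_blinfun o\<^sub>L D x0 = id_blinfun"
    by (rule blinfun_eqI) (simp add: D0)
  have derD: "(\<Psi> has_derivative blinfun_apply (D x)) (at x)" if "x \<in> W" for x
    using smooth_on_has_derivative[OF s\<Psi> that] Dapp[OF that] by simp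
  obtain U' V' g g' where IFT: "open U'" "U' \<subseteq> W" "x0 \<in> U'" "open V'" "\<Psi> x0 \<in> V'" "homeomorphism U' V' \<Psi> g"
    "\<And>y. y \<in> V' \<Longrightarrow> (g has_derivative (g' y)) (at y)"
    "\<And>y. y \<in> V' \<Longrightarrow> g' y = inv (blinfun_apply (D (g y)))"
    "\<And>y. y \<in> V' \<Longrightarrow> bij (blinfun_apply (D (g y)))"
    using inverse_function_theorem[OF W derD contD x0W invD] by metis
  have \<Psi>0: "\<Psi> x0 = x0" unfolding \<Psi>_alt using F0 linear_0[OF linP] by simp
  \<comment> \<open>The line through \<open>x0\<close> in the direction \<open>u\<close> lies in a
    level set of the linear model, since \<open>P u = 0\<close>; its preimage under \<Psi> lies in a
    level set of \<open>F\<close>.\<close>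
  define \<gamma> where "\<gamma> t = g (x0 + t *\<^sub>R u)" for t :: real
  define \<gamma>' where "\<gamma>' t = g' (x0 + t *\<^sub>R u) u" for t :: real
  have \<gamma>0: "\<gamma> 0 = x0" unfolding \<gamma>_def using homeomorphism_apply1[OF IFT(6,3)] \<Psi>0 by simp
  have line: "((\<lambda>t. x0 + t *\<^sub>R u) \<longlongrightarrow> x0) (nhds 0)"
  proof -
    have "isCont (\<lambda>t::real. x0 + t *\<^sub>R u) 0" by simp
    then show ?thesis unfolding continuous_at_imp_continuous_at_within
      by (simp add: tendsto_nhds_iff isCont_def)
  qed
  have ev1: "\<forall>\<^sub>F t in nhds 0. x0 + t *\<^sub>R u \<in> V'"
    using topological_tendstoD[OF line IFT(4)] IFT(5) \<Psi>0 by simp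
  have "isCont g x0" using IFT(5,7) \<Psi>0 has_derivative_continuous by metis
  then have lim\<gamma>: "(\<gamma> \<longlongrightarrow> x0) (nhds 0)"
    unfolding \<gamma>_def using isCont_tendsto_compose[OF _ line, of g] \<gamma>0 unfolding \<gamma>_def by simp
  have "isCont F x0" using DF has_derivative_continuous by blast
  then have "((\<lambda>t. F (\<gamma> t)) \<longlongrightarrow> x0) (nhds 0)"
    using isCont_tendsto_compose[OF _ lim\<gamma>, of F] F0 by simp
  then have ev2: "\<forall>\<^sub>F t in nhds 0. F (\<gamma> t) \<in> U'"
    using topological_tendstoD[OF _ IFT(1)] IFT(3) by blast
  have ev3: "\<forall>\<^sub>F t in nhds 0. \<gamma> t \<in> V" using topological_tendstoD[OF lim\<gamma> V] x0 by blast
  have good: "\<gamma> t \<in> V \<inter> L \<and> f (\<gamma> t) = x0 \<and> (\<gamma> has_vector_derivative \<gamma>' t) (at t) \<and> D (\<gamma> t) (\<gamma>' t) = u"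
    if t: "x0 + t *\<^sub>R u \<in> V'" "F (\<gamma> t) \<in> U'" "\<gamma> t \<in> V" for t
  proof -
    have \<gamma>U: "\<gamma> t \<in> U'" unfolding \<gamma>_def using homeomorphism_image2[OF IFT(6)] t(1) by auto
    then have \<gamma>W: "\<gamma> t \<in> W" using IFT(2) by blast
    have eq: "\<Psi> (\<gamma> t) = x0 + t *\<^sub>R u" unfolding \<gamma>_def using homeomorphism_apply2[OF IFT(6) t(1)] .
    have "P (\<Psi> (\<gamma> t) - x0) = P (F (\<gamma> t) - x0)"
      unfolding \<Psi>_alt by (simp add: linear_diff[OF linP] linear_add[OF linP] PP)
    moreover have "P (\<Psi> (\<gamma> t) - x0) = 0" unfolding eq using Pu by (simp add: linear_cmul[OF linP])
    ultimately have 0: "P (F (\<gamma> t) - x0) = 0" by simp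
    \<comment> \<open>\<Psi> is injective on \<open>U'\<close>, which contains both
      \<open>F (\<gamma> t)\<close> and \<open>x0\<close>; this is why \<open>F (\<gamma> t)\<close>
      is required to be in \<open>U'\<close>.\<close>
    have "\<Psi> (F (\<gamma> t)) = x0" unfolding \<Psi>_alt FF[OF \<gamma>W] using 0 linear_0[OF linP] by simp
    then have F\<gamma>: "F (\<gamma> t) = x0"
      using homeomorphism_apply1[OF IFT(6) t(2)] homeomorphism_apply1[OF IFT(6) IFT(3)] \<Psi>0 by simp
    have "x0 + ((\<gamma> t - x0) - P (\<gamma> t - x0)) = x0 + t *\<^sub>R u"
      using eq linear_0[OF linP] unfolding \<Psi>_alt F\<gamma> by simp
    then have "\<gamma> t = x0 + t *\<^sub>R u + P (\<gamma> t - x0)" by (simp add: algebra_simps)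
    then have "\<gamma> t \<in> L"
      using x0(2) u(1) PL L by (metis subspace_add subspace_scale)
    moreover from this have "f (\<gamma> t) = x0" using F\<gamma> \<pi>(3) by (simp add: F_def)
    moreover have "(\<gamma> has_vector_derivative \<gamma>' t) (at t)"
    proof -
      have "((\<lambda>t. x0 + t *\<^sub>R u) has_derivative (\<lambda>s. s *\<^sub>R u)) (at t)" by (auto intro!: derivative_eq_intros)
      from has_derivative_compose[OF this IFT(7)[OF t(1)]]
      show ?thesis
        unfolding has_vector_derivative_def \<gamma>_def[abs_def] \<gamma>'_def
        by (rule has_derivative_eq_rhs) (simp add: fun_eq_iff linear_cmul[OF has_derivative_linear[OF IFT(7)[OF t(1)]]])
    qed
    moreover have "D (\<gamma> t) (\<gamma>' t) = u"
      unfolding \<gamma>_def \<gamma>'_def IFT(8)[OF t(1)] using IFT(9)[OF t(1)] by (simp add: bij_is_surj surj_f_inv_f)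
    ultimately show ?thesis using t(3) by blast
  qed
  have ev: "\<forall>\<^sub>F t in nhds 0. \<gamma> t \<in> V \<inter> L \<and> f (\<gamma> t) = x0 \<and> (\<gamma> has_vector_derivative \<gamma>' t) (at t) \<and> D (\<gamma> t) (\<gamma>' t) = u"
    using ev1 ev2 ev3 by eventually_elim (rule good)
  then obtain \<epsilon> where \<epsilon>: "\<epsilon> > 0" "\<And>t. \<bar>t\<bar> < \<epsilon> \<Longrightarrow> \<gamma> t \<in> V \<inter> L \<and> f (\<gamma> t) = x0 \<and> (\<gamma> has_vector_derivative \<gamma>' t) (at t)"
    unfolding eventually_nhds_metric by (auto simp: dist_real_def)
  \<comment> \<open>The limit of the velocities is read off from
    \<open>D (\<gamma> t) (\<gamma>' t) = u\<close>, because \<open>D (\<gamma> t)\<close> tends to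
    the identity. The bound 1/2 below keeps \<open>\<gamma>' t\<close> bounded by
    \<open>2 * norm u\<close>.\<close>
  have "isCont D x0" using contD W x0W continuous_on_eq_continuous_at by blast
  then have "((\<lambda>t. D (\<gamma> t)) \<longlongrightarrow> id_blinfun) (nhds 0)"
    using isCont_tendsto_compose[OF _ lim\<gamma>, of D] D0 by simp
  then have limD: "((\<lambda>t. D (\<gamma> t) - id_blinfun) \<longlongrightarrow> 0) (nhds 0)"
    by (simp add: LIM_zero)
  then have limn: "((\<lambda>t. norm (D (\<gamma> t) - id_blinfun)) \<longlongrightarrow> 0) (nhds 0)" by (rule tendsto_norm_zero)
  then have ev4: "\<forall>\<^sub>F t in nhds 0. norm (D (\<gamma> t) - id_blinfun) < 1/2"
    by (rule order_tendstoD) simp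
  have "((\<lambda>t. \<gamma>' t - u) \<longlongrightarrow> 0) (nhds 0)"
  proof (rule Lim_null_comparison)
    show "\<forall>\<^sub>F t in nhds 0. norm (\<gamma>' t - u) \<le> 2 * norm (D (\<gamma> t) - id_blinfun) * norm u"
      using ev ev4
    proof eventually_elim
      case (elim t)
      let ?\<eta> = "norm (D (\<gamma> t) - id_blinfun)"
      have "u - \<gamma>' t = (D (\<gamma> t) - id_blinfun) (\<gamma>' t)" using elim by (simp add: blinfun.diff_left)
      then have 1: "norm (u - \<gamma>' t) \<le> ?\<eta> * norm (\<gamma>' t)" using norm_blinfun by metis
      have "norm (\<gamma>' t) \<le> norm u + norm (u - \<gamma>' t)" by (metis norm_minus_commute norm_triangle_sub)
      moreover have "?\<eta> * norm (\<gamma>' t) \<le> 1/2 * norm (\<gamma>' t)" using elim by (intro mult_right_mono) auto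
      ultimately have "norm (\<gamma>' t) \<le> 2 * norm u" using 1 by linarith
      then have "?\<eta> * norm (\<gamma>' t) \<le> ?\<eta> * (2 * norm u)" by (intro mult_left_mono) auto
      then show ?case using 1 by (simp add: norm_minus_commute algebra_simps)
    qed
    show "((\<lambda>t. 2 * norm (D (\<gamma> t) - id_blinfun) * norm u) \<longlongrightarrow> 0) (nhds 0)"
      using tendsto_mult_left[OF tendsto_mult_right[OF limn, of "norm u"], of 2] by (simp add: mult.assoc)
  qed
  then have "(\<gamma>' \<longlongrightarrow> u) (nhds 0)" by (simp add: LIM_zero_iff)
  then have "(\<gamma>' \<longlongrightarrow> u) (at 0)" by (simp add: tendsto_nhds_iff)
  then show ?thesis using that \<epsilon> \<gamma>0 by blast
qed

section \<open>Charts and tangent vectors\<close>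

lemma chart_inv_left: "is_chart c \<Longrightarrow> z \<in> fst c \<Longrightarrow> chart_inv c (snd c z) = z"
  unfolding is_chart_def homeomorphism_def by (metis inv_into_f_f inj_on_inverseI)

lemma chart_inv_right: "x \<in> snd c ` fst c \<Longrightarrow> snd c (chart_inv c x) = x"
  by (rule f_inv_into_f)

lemma chart_inv_in: "x \<in> snd c ` fst c \<Longrightarrow> chart_inv c x \<in> fst c"
  by (rule inv_into_into)

lemma is_chart_open: "is_chart c \<Longrightarrow> open (fst c)" "is_chart c \<Longrightarrow> open (snd c ` fst c)"
  unfolding is_chart_def by blast+

lemma is_chart_continuous:
  assumes "is_chart c"
  shows "continuous_on (fst c) (snd c)" "continuous_on (snd c ` fst c) (chart_inv c)"
proof -
  obtain g where g: "homeomorphism (fst c) (snd c ` fst c) (snd c) g"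
    using assms unfolding is_chart_def by blast
  show "continuous_on (fst c) (snd c)" using g unfolding homeomorphism_def by blast
  have "g x = chart_inv c x" if "x \<in> snd c ` fst c" for x
    using that g chart_inv_left[OF assms] unfolding homeomorphism_def by (metis imageE)
  then show "continuous_on (snd c ` fst c) (chart_inv c)"
    using g unfolding homeomorphism_def by (metis (no_types, lifting) continuous_on_cong)
qed

lemma chart_image_eq:
  assumes "is_chart c" "U \<subseteq> fst c"
  shows "snd c ` U = snd c ` fst c \<inter> chart_inv c -` U"
  using assms chart_inv_left[OF assms(1)] chart_inv_right[of _ c] by (auto simp: image_iff)

lemma chart_image_open:
  assumes "is_chart c" "open U" "U \<subseteq> fst c"
  shows "open (snd c ` U)"
  unfolding chart_image_eq[OF assms(1,3)]
  by (rule continuous_open_preimage[OF is_chart_continuous(2)[OF assms(1)] is_chart_open(2)[OF assms(1)] assms(2)])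

lemma maximal_atlas_is_chart: "c \<in> maximal_atlas A \<Longrightarrow> is_chart c"
  unfolding maximal_atlas_def by blast

lemma atlas_subset_maximal: "smooth_atlas A \<Longrightarrow> A \<subseteq> maximal_atlas A"
  unfolding smooth_atlas_def maximal_atlas_def by blast

lemma chart_at:
  assumes "smooth_atlas A"
  shows "chart_at A z \<in> A" "z \<in> fst (chart_at A z)" "chart_at A z \<in> maximal_atlas A" "is_chart (chart_at A z)"
proof -
  have "\<exists>c. c \<in> A \<and> z \<in> fst c" using assms unfolding smooth_atlas_def by blast
  then have "chart_at A z \<in> A \<and> z \<in> fst (chart_at A z)" unfolding chart_at_def by (rule someI_ex)
  then show "chart_at A z \<in> A" "z \<in> fst (chart_at A z)" by auto
  then show "chart_at A z \<in> maximal_atlas A" using atlas_subset_maximal[OF assms] by blast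
  then show "is_chart (chart_at A z)" by (rule maximal_atlas_is_chart)
qed

text \<open>Charts of the maximal atlas are by definition compatible with charts of \<open>A\<close>
  only. Near each point the transition map is factored through a chart of \<open>A\<close> around
  it.\<close>

lemma maximal_atlas_transition:
  fixes A :: "('p::topological_space, 'e::euclidean_space) chart set"
  assumes A: "smooth_atlas A" and c: "c \<in> maximal_atlas A" and d: "d \<in> maximal_atlas A"
  shows "smooth_on (snd c ` (fst c \<inter> fst d)) (snd d \<circ> chart_inv c)"
proof (rule smooth_on_local)
  fix x assume "x \<in> snd c ` (fst c \<inter> fst d)"
  then obtain z where z: "z \<in> fst c" "z \<in> fst d" "x = snd c z" by blast
  let ?e = "chart_at A z"
  note e = chart_at[OF A, of z]
  let ?T = "snd c ` (fst c \<inter> fst d \<inter> fst ?e)"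
  have ic: "is_chart c" "is_chart d" using c d maximal_atlas_is_chart by blast+
  have T: "open ?T" "x \<in> ?T"
    using z e(2) by (auto intro!: chart_image_open open_Int ic e is_chart_open(1))
  have 1: "smooth_on ?T (snd ?e \<circ> chart_inv c)"
    by (rule smooth_on_subset[of "snd c ` (fst c \<inter> fst ?e)"])
      (use c e(1) in \<open>auto simp: maximal_atlas_def smooth_transition_def\<close>)
  have 2: "smooth_on (snd ?e ` (fst ?e \<inter> fst d)) (snd d \<circ> chart_inv ?e)"
    using d e(1) by (auto simp: maximal_atlas_def smooth_transition_def)
  have "smooth_on ?T (\<lambda>x. (snd d \<circ> chart_inv ?e) ((snd ?e \<circ> chart_inv c) x))"
    by (rule smooth_on_compose[OF T(1) 1 2]) (auto simp: chart_inv_left[OF ic(1)])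
  then have "smooth_on ?T (snd d \<circ> chart_inv c)"
    by (subst smooth_on_cong[OF T(1)]) (auto simp: chart_inv_left[OF ic(1)] chart_inv_left[OF e(4)])
  then show "\<exists>T. open T \<and> x \<in> T \<and> smooth_on T (snd d \<circ> chart_inv c)" using T by blast
qed

lemma smooth_map_open_domain_open:
  assumes "smooth_map_open A B U f" "open V"
  shows "open (U \<inter> f -` V)"
  using assms continuous_open_preimage unfolding smooth_map_open_def by blast

text \<open>Smoothness is defined with charts of the given atlases; slice charts come from the
  maximal atlas. Near each point the local expression is factored through atlas charts at the source
  and at the target.\<close>

lemma smooth_map_open_charts:
  fixes A :: "('p::topological_space, 'e::euclidean_space) chart set"
    and B :: "('q::topological_space, 'f::euclidean_space) chart set"
  assumes A: "smooth_atlas A" and B: "smooth_atlas B" and f: "smooth_map_open A B U f"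
    and c: "c \<in> maximal_atlas A" and d: "d \<in> maximal_atlas B"
  shows "smooth_on (snd c ` (fst c \<inter> U \<inter> f -` fst d)) (snd d \<circ> f \<circ> chart_inv c)"
proof (rule smooth_on_local)
  fix x assume "x \<in> snd c ` (fst c \<inter> U \<inter> f -` fst d)"
  then obtain z where z: "z \<in> fst c" "z \<in> U" "f z \<in> fst d" "x = snd c z" by blast
  let ?a = "chart_at A z" and ?b = "chart_at B (f z)"
  note a = chart_at[OF A, of z] and b = chart_at[OF B, of "f z"]
  have ic: "is_chart c" "is_chart d" using c d maximal_atlas_is_chart by blast+
  let ?S = "fst c \<inter> fst ?a \<inter> (U \<inter> f -` (fst d \<inter> fst ?b))"
  let ?T = "snd c ` ?S"
  have "open ?S"
    by (intro open_Int[OF _ smooth_map_open_domain_open[OF f]] open_Int is_chart_open(1) ic a(4) b(4))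
  then have T: "open ?T" "x \<in> ?T"
    using a(2) b(2) z by (auto intro!: chart_image_open[OF ic(1)])
  have 1: "smooth_on ?T (snd ?a \<circ> chart_inv c)"
    by (rule smooth_on_subset[OF maximal_atlas_transition[OF A c a(3)]]) auto
  have 2: "smooth_on (snd ?a ` (fst ?a \<inter> U \<inter> f -` fst ?b)) (snd ?b \<circ> f \<circ> chart_inv ?a)"
    using f a b unfolding smooth_map_open_def by blast
  have 3: "smooth_on (snd ?b ` (fst ?b \<inter> fst d)) (snd d \<circ> chart_inv ?b)"
    by (rule maximal_atlas_transition[OF B b(3) d])
  have 12: "smooth_on ?T (\<lambda>x. (snd ?b \<circ> f \<circ> chart_inv ?a) ((snd ?a \<circ> chart_inv c) x))"
    by (rule smooth_on_compose[OF T(1) 1 2]) (auto simp: chart_inv_left[OF ic(1)])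
  have "smooth_on ?T (\<lambda>x. (snd d \<circ> chart_inv ?b) ((snd ?b \<circ> f \<circ> chart_inv ?a) ((snd ?a \<circ> chart_inv c) x)))"
    by (rule smooth_on_compose[OF T(1) 12 3])
      (auto simp: chart_inv_left[OF ic(1)] chart_inv_left[OF a(4)])
  then have "smooth_on ?T (snd d \<circ> f \<circ> chart_inv c)"
    by (subst smooth_on_cong[OF T(1)])
      (auto simp: chart_inv_left[OF ic(1)] chart_inv_left[OF a(4)] chart_inv_left[OF b(4)])
  then show "\<exists>T. open T \<and> x \<in> T \<and> smooth_on T (snd d \<circ> f \<circ> chart_inv c)" using T by blast
qed

lemma smooth_map_open_compose:
  fixes A :: "('p::topological_space, 'e::euclidean_space) chart set"
    and B :: "('q::topological_space, 'f::euclidean_space) chart set"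
    and C :: "('r::topological_space, 'g::euclidean_space) chart set"
  assumes A: "smooth_atlas A" and B: "smooth_atlas B" and C: "smooth_atlas C"
    and f: "smooth_map_open A B U f" and g: "smooth_map_open B C V g"
  shows "smooth_map_open A C (U \<inter> f -` V) (g \<circ> f)"
  unfolding smooth_map_open_def
proof (intro conjI ballI)
  have V: "open V" using g unfolding smooth_map_open_def by blast
  show op: "open (U \<inter> f -` V)" by (rule smooth_map_open_domain_open[OF f V])
  show "continuous_on (U \<inter> f -` V) (g \<circ> f)"
    using f g unfolding smooth_map_open_def
    by (intro continuous_on_compose) (auto intro: continuous_on_subset)
  fix c d assume c: "c \<in> A" and d: "d \<in> C"
  have ic: "is_chart c" "is_chart d" using c d A C unfolding smooth_atlas_def by blast+
  show "smooth_on (snd c ` (fst c \<inter> (U \<inter> f -` V) \<inter> (g \<circ> f) -` fst d)) (snd d \<circ> (g \<circ> f) \<circ> chart_inv c)"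
    (is "smooth_on (snd c ` ?X) _")
  proof (rule smooth_on_local)
    fix x assume "x \<in> snd c ` ?X"
    then obtain z where z: "z \<in> ?X" "x = snd c z" by blast
    let ?b = "chart_at B (f z)"
    note b = chart_at[OF B, of "f z"]
    let ?S = "fst c \<inter> (U \<inter> f -` (fst ?b \<inter> (V \<inter> g -` fst d)))"
    let ?T = "snd c ` ?S"
    have "open ?S"
      by (rule open_Int[OF is_chart_open(1)[OF ic(1)] smooth_map_open_domain_open[OF f
            open_Int[OF is_chart_open(1)[OF b(4)] smooth_map_open_domain_open[OF g is_chart_open(1)[OF ic(2)]]]]])
    then have T: "open ?T" "x \<in> ?T"
      using b(2) z by (auto intro!: chart_image_open[OF ic(1)])
    have 1: "smooth_on ?T (snd ?b \<circ> f \<circ> chart_inv c)"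
      by (rule smooth_on_subset[of "snd c ` (fst c \<inter> U \<inter> f -` fst ?b)"])
        (use f c b(1) in \<open>auto simp: smooth_map_open_def\<close>)
    have 2: "smooth_on (snd ?b ` (fst ?b \<inter> V \<inter> g -` fst d)) (snd d \<circ> g \<circ> chart_inv ?b)"
      using g d b(1) unfolding smooth_map_open_def by blast
    have "smooth_on ?T (\<lambda>x. (snd d \<circ> g \<circ> chart_inv ?b) ((snd ?b \<circ> f \<circ> chart_inv c) x))"
      by (rule smooth_on_compose[OF T(1) 1 2]) (auto simp: chart_inv_left[OF ic(1)])
    then have "smooth_on ?T (snd d \<circ> (g \<circ> f) \<circ> chart_inv c)"
      by (subst smooth_on_cong[OF T(1)]) (auto simp: chart_inv_left[OF ic(1)] chart_inv_left[OF b(4)])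
    then show "\<exists>T. open T \<and> x \<in> T \<and> smooth_on T (snd d \<circ> (g \<circ> f) \<circ> chart_inv c)" using T by blast
  qed
qed

lemma smooth_mapE:
  assumes "smooth_map A B S f" "z \<in> S"
  obtains U g where "z \<in> U" "smooth_map_open A B U g" "\<And>x. x \<in> U \<Longrightarrow> x \<in> S \<Longrightarrow> g x = f x"
proof -
  have "\<exists>U g. z \<in> U \<and> smooth_map_open A B U g \<and> (\<forall>x\<in>U \<inter> S. g x = f x)"
    using assms(1)[unfolded smooth_map_def] assms(2) by (rule bspec)
  then obtain U g where U: "z \<in> U" "smooth_map_open A B U g" and g: "\<forall>x\<in>U \<inter> S. g x = f x"
    by (elim exE conjE)
  show ?thesis by (rule that[OF U]) (use g in simp)
qed

lemma smooth_map_compose: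
  fixes A :: "('p::topological_space, 'e::euclidean_space) chart set"
    and B :: "('q::topological_space, 'f::euclidean_space) chart set"
    and C :: "('r::topological_space, 'g::euclidean_space) chart set"
  assumes A: "smooth_atlas A" and B: "smooth_atlas B" and C: "smooth_atlas C"
    and f: "smooth_map A B S f" and g: "smooth_map B C T g" and ST: "f ` S \<subseteq> T"
  shows "smooth_map A C S (g \<circ> f)"
  unfolding smooth_map_def
proof
  fix z assume z: "z \<in> S"
  obtain U f1 where f1: "z \<in> U" "smooth_map_open A B U f1" "\<And>x. x \<in> U \<Longrightarrow> x \<in> S \<Longrightarrow> f1 x = f x"
    by (rule smooth_mapE[OF f z]) (rule that)
  have fz: "f z \<in> T" using ST z by blast
  obtain V g1 where g1: "f z \<in> V" "smooth_map_open B C V g1" "\<And>x. x \<in> V \<Longrightarrow> x \<in> T \<Longrightarrow> g1 x = g x"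
    by (rule smooth_mapE[OF g fz]) (rule that)
  show "\<exists>U h. z \<in> U \<and> smooth_map_open A C U h \<and> (\<forall>x\<in>U \<inter> S. h x = (g \<circ> f) x)"
  proof (intro exI conjI)
    show "smooth_map_open A C (U \<inter> f1 -` V) (g1 \<circ> f1)"
      by (rule smooth_map_open_compose[OF A B C f1(2) g1(2)])
    show "z \<in> U \<inter> f1 -` V" using f1 g1 z by simp
    show "\<forall>x\<in>U \<inter> f1 -` V \<inter> S. (g1 \<circ> f1) x = (g \<circ> f) x"
      using f1(3) g1(3) ST by auto
  qed
qed

lemma smooth_map_subset:
  assumes "smooth_map A B S f" "T \<subseteq> S"
  shows "smooth_map A B T f"
  unfolding smooth_map_def
proof
  fix z assume "z \<in> T"
  then have "\<exists>U g. z \<in> U \<and> smooth_map_open A B U g \<and> (\<forall>x\<in>U \<inter> S. g x = f x)"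
    using assms(1)[unfolded smooth_map_def, rule_format, of z] assms(2) by auto
  then show "\<exists>U g. z \<in> U \<and> smooth_map_open A B U g \<and> (\<forall>x\<in>U \<inter> T. g x = f x)"
    by (elim exE conjE, intro exI conjI) (use assms(2) in auto)
qed

lemma smooth_atlas_std: "smooth_atlas (std_atlas :: ('e::euclidean_space, 'e) chart set)"
  unfolding smooth_atlas_def std_atlas_def is_chart_def smooth_transition_def
  by (auto intro!: exI[of _ "\<lambda>x. x"] simp: homeomorphism_def smooth_on_id o_def)

lemma chart_at_std: "chart_at std_atlas z = (UNIV, \<lambda>x. x)"
  unfolding chart_at_def std_atlas_def by auto

section \<open>Velocities of curves and their coordinates\<close>

text \<open>Only the germ of the curve at 0 matters and only one derivative is asked for, so that
  images of curves under maps and changes on a distant part of the interval need no smoothness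
  argument.\<close>

definition has_velocity ::
  "('p::topological_space, 'e::euclidean_space) chart set \<Rightarrow> (real \<Rightarrow> 'p) \<Rightarrow> 'p \<Rightarrow> 'e \<Rightarrow> bool" where
  "has_velocity A \<gamma> z u \<longleftrightarrow> \<gamma> 0 = z \<and> isCont \<gamma> 0 \<and>
     ((\<lambda>t. snd (chart_at A z) (\<gamma> t)) has_vector_derivative u) (at 0)"

lemma has_velocity_unique: "has_velocity A \<gamma> z u \<Longrightarrow> has_velocity A \<gamma> z v \<Longrightarrow> u = v"
  unfolding has_velocity_def using vector_derivative_unique_at by blast

lemma isCont_eventually_open:
  assumes "isCont \<gamma> (0::real)" "open U" "\<gamma> 0 \<in> U"
  shows "\<forall>\<^sub>F t in nhds 0. \<gamma> t \<in> U"
  using assms topological_tendstoD[of \<gamma> "\<gamma> 0" "nhds 0" U] by (simp add: isCont_def tendsto_at_iff_tendsto_nhds)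

lemma has_vector_derivative_cong_eventually:
  assumes "(f has_vector_derivative u) (at (0::real))" "\<forall>\<^sub>F t in nhds 0. f t = g t"
  shows "(g has_vector_derivative u) (at 0)"
  using has_derivative_transform_eventually[OF assms(1)[unfolded has_vector_derivative_def], of g] assms(2)
  by (simp add: has_vector_derivative_def eventually_nhds_conv_at)

lemma has_velocity_cong:
  assumes "has_velocity A \<gamma> z u" "\<forall>\<^sub>F t in nhds 0. \<gamma> t = \<delta> t"
  shows "has_velocity A \<delta> z u"
proof -
  have "\<gamma> 0 = \<delta> 0" using assms(2) eventually_nhds_x_imp_x by fast
  moreover have "isCont \<delta> 0" using isCont_cong[OF assms(2)] assms(1) by (simp add: has_velocity_def)
  moreover have "((\<lambda>t. snd (chart_at A z) (\<delta> t)) has_vector_derivative u) (at 0)"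
    using assms(1) unfolding has_velocity_def
    by (elim conjE, rule_tac has_vector_derivative_cong_eventually[where f="\<lambda>t. snd (chart_at A z) (\<gamma> t)"])
      (auto intro: eventually_mono[OF assms(2)])
  ultimately show ?thesis using assms(1) unfolding has_velocity_def by simp
qed

lemma has_vector_derivative_smooth_compose:
  assumes "(h has_vector_derivative w) (at (t::real))" "smooth_on S f" "h t \<in> S"
  shows "((\<lambda>t. f (h t)) has_vector_derivative frechet_derivative f (at (h t)) w) (at t)"
proof -
  note D = smooth_on_has_derivative[OF assms(2,3)]
  show ?thesis
    using has_derivative_compose[OF assms(1)[unfolded has_vector_derivative_def] D]
    unfolding has_vector_derivative_def
    by (simp add: linear_cmul[OF has_derivative_linear[OF D]])
qed

text \<open>\<open>tcoord A c z\<close> converts tangent vectors at \<open>z\<close> to their coordinates in the chart \<open>c\<close>.\<close>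

definition tcoord ::
  "('p::topological_space, 'e::euclidean_space) chart set \<Rightarrow> ('p, 'e) chart \<Rightarrow> 'p \<Rightarrow> 'e \<Rightarrow> 'e" where
  "tcoord A c z = frechet_derivative (snd c \<circ> chart_inv (chart_at A z)) (at (snd (chart_at A z) z))"

definition tcoord_inv ::
  "('p::topological_space, 'e::euclidean_space) chart set \<Rightarrow> ('p, 'e) chart \<Rightarrow> 'p \<Rightarrow> 'e \<Rightarrow> 'e" where
  "tcoord_inv A c z = frechet_derivative (snd (chart_at A z) \<circ> chart_inv c) (at (snd c z))"

lemma transition_derivative_curve:
  fixes A :: "('p::topological_space, 'e::euclidean_space) chart set"
  assumes A: "smooth_atlas A" and c: "c \<in> maximal_atlas A" "\<gamma> 0 \<in> fst c" and d: "d \<in> maximal_atlas A" "\<gamma> 0 \<in> fst d"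
    and \<gamma>: "isCont \<gamma> 0" "((\<lambda>t. snd c (\<gamma> t)) has_vector_derivative w) (at 0)"
  shows "((\<lambda>t. snd d (\<gamma> t)) has_vector_derivative
    frechet_derivative (snd d \<circ> chart_inv c) (at (snd c (\<gamma> 0))) w) (at 0)"
proof -
  have ic: "is_chart c" using c maximal_atlas_is_chart by blast
  have "((\<lambda>t. (snd d \<circ> chart_inv c) (snd c (\<gamma> t))) has_vector_derivative
    frechet_derivative (snd d \<circ> chart_inv c) (at (snd c (\<gamma> 0))) w) (at 0)"
    by (rule has_vector_derivative_smooth_compose[OF \<gamma>(2) maximal_atlas_transition[OF A c(1) d(1)]])
      (use c d in blast)
  moreover have "\<forall>\<^sub>F t in nhds 0. \<gamma> t \<in> fst c"
    by (rule isCont_eventually_open[OF \<gamma>(1) is_chart_open(1)[OF ic] c(2)])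
  then have "\<forall>\<^sub>F t in nhds 0. (snd d \<circ> chart_inv c) (snd c (\<gamma> t)) = snd d (\<gamma> t)"
    by eventually_elim (simp add: chart_inv_left[OF ic])
  ultimately show ?thesis by (rule has_vector_derivative_cong_eventually)
qed

lemma has_velocity_tcoord:
  assumes "smooth_atlas A" "c \<in> maximal_atlas A" "z \<in> fst c" "has_velocity A \<gamma> z u"
  shows "((\<lambda>t. snd c (\<gamma> t)) has_vector_derivative tcoord A c z u) (at 0)"
  using transition_derivative_curve[OF assms(1) chart_at(3,2)[OF assms(1)] assms(2)] assms(3,4)
  unfolding has_velocity_def tcoord_def by metis

lemma has_velocity_tcoord_inv:
  assumes "smooth_atlas A" "c \<in> maximal_atlas A" "\<gamma> 0 \<in> fst c" "isCont \<gamma> 0"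
    and "((\<lambda>t. snd c (\<gamma> t)) has_vector_derivative w) (at 0)"
  shows "has_velocity A \<gamma> (\<gamma> 0) (tcoord_inv A c (\<gamma> 0) w)"
  using transition_derivative_curve[OF assms(1-3) chart_at(3,2)[OF assms(1)] assms(4,5)] assms(4)
  unfolding has_velocity_def tcoord_inv_def by blast

text \<open>Straight lines in a chart realise every coordinate velocity. They are the test curves
  with which identities between coordinate changes of tangent vectors are reduced to the uniqueness
  of velocities.\<close>

lemma chart_line:
  fixes c :: "('p::topological_space, 'e::euclidean_space) chart"
  assumes "is_chart c" "z \<in> fst c"
  obtains e where "e > 0" "\<And>t::real. \<bar>t\<bar> < e \<Longrightarrow> snd c z + t *\<^sub>R w \<in> snd c ` fst c"
    "isCont (\<lambda>t. chart_inv c (snd c z + t *\<^sub>R w)) 0"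
    "((\<lambda>t. snd c (chart_inv c (snd c z + t *\<^sub>R w))) has_vector_derivative w) (at 0)"
proof -
  have o: "open (snd c ` fst c)" by (rule is_chart_open(2)[OF assms(1)])
  have line: "isCont (\<lambda>t::real. snd c z + t *\<^sub>R w) 0" by simp
  have ev: "\<forall>\<^sub>F t in nhds 0. snd c z + t *\<^sub>R w \<in> snd c ` fst c"
    by (rule isCont_eventually_open[OF line o]) (use assms(2) in simp)
  then obtain e where e: "e > 0" "\<And>t::real. \<bar>t\<bar> < e \<Longrightarrow> snd c z + t *\<^sub>R w \<in> snd c ` fst c"
    unfolding eventually_nhds_metric by (auto simp: dist_real_def)
  have "isCont (chart_inv c) (snd c z)"
    using is_chart_continuous(2)[OF assms(1)] o assms(2) continuous_on_eq_continuous_at by blast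
  then have cont: "isCont (\<lambda>t. chart_inv c (snd c z + t *\<^sub>R w)) 0"
    using isCont_o2[OF line, of "chart_inv c"] by simp
  have "((\<lambda>t. snd c z + t *\<^sub>R w) has_vector_derivative w) (at 0)"
    by (auto intro!: derivative_eq_intros)
  then have "((\<lambda>t. snd c (chart_inv c (snd c z + t *\<^sub>R w))) has_vector_derivative w) (at 0)"
    by (rule has_vector_derivative_cong_eventually)
      (rule eventually_mono[OF ev], simp add: chart_inv_right)
  then show ?thesis using that e cont by blast
qed

lemma tcoord_inverse:
  assumes "smooth_atlas A" "c \<in> maximal_atlas A" "z \<in> fst c"
  shows "tcoord A c z (tcoord_inv A c z w) = w" "tcoord_inv A c z (tcoord A c z u) = u"
proof -
  have ic: "is_chart c" using assms maximal_atlas_is_chart by blast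
  obtain e where e: "isCont (\<lambda>t::real. chart_inv c (snd c z + t *\<^sub>R w)) 0"
    "((\<lambda>t. snd c (chart_inv c (snd c z + t *\<^sub>R w))) has_vector_derivative w) (at 0)"
    using chart_line[OF ic assms(3), of w] by metis
  have z: "chart_inv c (snd c z + 0 *\<^sub>R w) = z" using chart_inv_left[OF ic assms(3)] by simp
  have "has_velocity A (\<lambda>t. chart_inv c (snd c z + t *\<^sub>R w)) z (tcoord_inv A c z w)"
    using has_velocity_tcoord_inv[OF assms(1,2) _ e] z assms(3) by simp
  from has_velocity_tcoord[OF assms this]
  show "tcoord A c z (tcoord_inv A c z w) = w" using e(2) vector_derivative_unique_at by blast
  let ?c = "chart_at A z"
  note c = chart_at[OF assms(1), of z]
  obtain e where e: "isCont (\<lambda>t::real. chart_inv ?c (snd ?c z + t *\<^sub>R u)) 0"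
    "((\<lambda>t. snd ?c (chart_inv ?c (snd ?c z + t *\<^sub>R u))) has_vector_derivative u) (at 0)"
    using chart_line[OF c(4,2), of u] by metis
  have z: "chart_inv ?c (snd ?c z + 0 *\<^sub>R u) = z" using chart_inv_left[OF c(4,2)] by simp
  then have v: "has_velocity A (\<lambda>t. chart_inv ?c (snd ?c z + t *\<^sub>R u)) z u"
    using e unfolding has_velocity_def by simp
  have "has_velocity A (\<lambda>t. chart_inv ?c (snd ?c z + t *\<^sub>R u)) z (tcoord_inv A c z (tcoord A c z u))"
    using has_velocity_tcoord_inv[OF assms(1,2) _ e(1) has_velocity_tcoord[OF assms v]] z assms(3) by simp
  then show "tcoord_inv A c z (tcoord A c z u) = u" using v has_velocity_unique by blast
qed

lemma tcoord_linear:
  assumes "smooth_atlas A" "c \<in> maximal_atlas A" "z \<in> fst c"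
  shows "linear (tcoord A c z)" "linear (tcoord_inv A c z)"
  unfolding tcoord_def tcoord_inv_def
  using linear_frechet_derivative_smooth(1)[OF maximal_atlas_transition[OF assms(1,2) chart_at(3)[OF assms(1), of z]], of "snd c z"]
    linear_frechet_derivative_smooth(1)[OF maximal_atlas_transition[OF assms(1) chart_at(3)[OF assms(1), of z] assms(2)], of "snd (chart_at A z) z"]
    chart_at(2)[OF assms(1), of z] assms(3) by blast+

lemma tcoord_inj:
  assumes "smooth_atlas A" "c \<in> maximal_atlas A" "z \<in> fst c"
  shows "tcoord A c z u = tcoord A c z v \<longleftrightarrow> u = v"
  using tcoord_inverse[OF assms] by metis

section \<open>Differentials of smooth maps on subsets\<close>

text \<open>A local smooth extension has a full derivative, hence \<open>f\<close> has one within
  the chart image of \<open>S\<close>. The one chosen by \<open>frechet_derivative\<close> may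
  differ from that of the extension.\<close>

lemma tangent_map_has_derivative:
  fixes A :: "('p::topological_space, 'e::euclidean_space) chart set"
    and B :: "('q::topological_space, 'f::euclidean_space) chart set"
  assumes A: "smooth_atlas A" and B: "smooth_atlas B" and f: "smooth_map A B S f" and z: "z \<in> S"
  shows "((snd (chart_at B (f z)) \<circ> f \<circ> chart_inv (chart_at A z)) has_derivative tangent_map A B S f z)
    (at (snd (chart_at A z) z) within snd (chart_at A z) ` (fst (chart_at A z) \<inter> S))"
proof -
  obtain U g where U: "z \<in> U" and g: "smooth_map_open A B U g" and gf: "\<And>x. x \<in> U \<Longrightarrow> x \<in> S \<Longrightarrow> g x = f x"
    by (rule smooth_mapE[OF f z]) (rule that)
  let ?c = "chart_at A z" and ?d = "chart_at B (f z)"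
  note c = chart_at[OF A, of z] and d = chart_at[OF B, of "f z"]
  have gz: "g z = f z" using gf U z by blast
  have oU: "open U" and cg: "continuous_on U g" using g unfolding smooth_map_open_def by blast+
  let ?R = "fst ?c \<inter> U \<inter> g -` fst ?d"
  have oR: "open ?R"
    using open_Int[OF is_chart_open(1)[OF c(4)] smooth_map_open_domain_open[OF g is_chart_open(1)[OF d(4)]]]
    by (simp add: Int_assoc)
  have zR: "z \<in> ?R" using U c(2) d(2) gz by simp
  have oT: "open (snd ?c ` ?R)" by (rule chart_image_open[OF c(4) oR]) blast
  have sm: "smooth_on (snd ?c ` ?R) (snd ?d \<circ> g \<circ> chart_inv ?c)"
    by (rule smooth_map_open_charts[OF A B g c(3) d(3)])
  let ?x = "snd ?c z"
  let ?S0 = "snd ?c ` (fst ?c \<inter> S)"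
  have xT: "?x \<in> snd ?c ` ?R" using zR by blast
  have xS: "?x \<in> ?S0" using z c(2) by blast
  let ?D = "tangent_map A B S f z"
  have "((snd ?d \<circ> g \<circ> chart_inv ?c) has_derivative
      frechet_derivative (snd ?d \<circ> g \<circ> chart_inv ?c) (at ?x)) (at ?x within ?S0)"
    by (rule has_derivative_at_withinI[OF smooth_on_has_derivative[OF sm xT]])
  moreover have "\<forall>\<^sub>F y in at ?x within ?S0. (snd ?d \<circ> g \<circ> chart_inv ?c) y = (snd ?d \<circ> f \<circ> chart_inv ?c) y"
  proof -
    have "\<forall>\<^sub>F y in at ?x within ?S0. y \<in> snd ?c ` ?R \<and> y \<in> ?S0"
      using oT xT by (auto simp: eventually_at_topological)
    then show ?thesis
    proof eventually_elim
      case (elim y)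
      then obtain p q where "p \<in> ?R" "y = snd ?c p" "q \<in> fst ?c \<inter> S" "y = snd ?c q"
        by (elim conjE imageE)
      then have "chart_inv ?c y = p" "chart_inv ?c y = q"
        using chart_inv_left[OF c(4), of p] chart_inv_left[OF c(4), of q] by simp_all
      then have "chart_inv ?c y \<in> U" "chart_inv ?c y \<in> S"
        using \<open>p \<in> ?R\<close> \<open>q \<in> fst ?c \<inter> S\<close> by auto
      then show ?case using gf by simp
    qed
  qed
  ultimately have "((snd ?d \<circ> f \<circ> chart_inv ?c) has_derivative
      frechet_derivative (snd ?d \<circ> g \<circ> chart_inv ?c) (at ?x)) (at ?x within ?S0)"
    by (rule has_derivative_transform_eventually[OF _ _ _ xS]) (simp add: chart_inv_left[OF c(4,2)] gz)
  then have "(snd ?d \<circ> f \<circ> chart_inv ?c) differentiable (at ?x within ?S0)"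
    unfolding differentiable_def by blast
  then show "((snd ?d \<circ> f \<circ> chart_inv ?c) has_derivative ?D) (at ?x within ?S0)"
    unfolding tangent_map_def Let_def using frechet_derivative_works by blast
qed

text \<open>A derivative within \<open>S\<close> need not be unique, but composed with a curve that
  stays in \<open>S\<close> every choice gives the velocity of the image curve. The chain rule and
  the tangency of image vectors are derived from this instead of from the derivative itself.\<close>

lemma has_velocity_tangent_map:
  fixes A :: "('p::t2_space, 'e::euclidean_space) chart set"
    and B :: "('q::topological_space, 'f::euclidean_space) chart set"
  assumes A: "smooth_atlas A" and B: "smooth_atlas B" and f: "smooth_map A B S f" and z: "z \<in> S"
    and v: "has_velocity A \<gamma> z u" and \<gamma>S: "\<forall>\<^sub>F t in nhds 0. \<gamma> t \<in> S"
  shows "has_velocity B (\<lambda>t. f (\<gamma> t)) (f z) (tangent_map A B S f z u)"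
proof -
  obtain U g where U: "z \<in> U" and g: "smooth_map_open A B U g" and gf: "\<And>x. x \<in> U \<Longrightarrow> x \<in> S \<Longrightarrow> g x = f x"
    by (rule smooth_mapE[OF f z]) (rule that)
  let ?c = "chart_at A z" and ?d = "chart_at B (f z)"
  note c = chart_at[OF A, of z] and d = chart_at[OF B, of "f z"]
  have gz: "g z = f z" using gf U z by blast
  have oU: "open U" and cg: "continuous_on U g" using g unfolding smooth_map_open_def by blast+
  let ?R = "fst ?c \<inter> U \<inter> g -` fst ?d"
  have oR: "open ?R"
    using open_Int[OF is_chart_open(1)[OF c(4)] smooth_map_open_domain_open[OF g is_chart_open(1)[OF d(4)]]]
    by (simp add: Int_assoc)
  have zR: "z \<in> ?R" using U c(2) d(2) gz by simp
  let ?x = "snd ?c z"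
  let ?S0 = "snd ?c ` (fst ?c \<inter> S)"
  let ?D = "tangent_map A B S f z"
  note D = tangent_map_has_derivative[OF A B f z]
  have \<gamma>: "\<gamma> 0 = z" "isCont \<gamma> 0" "((\<lambda>t. snd ?c (\<gamma> t)) has_vector_derivative u) (at 0)"
    using v unfolding has_velocity_def by blast+
  have "\<forall>\<^sub>F t in nhds 0. \<gamma> t \<in> ?R" by (rule isCont_eventually_open[OF \<gamma>(2) oR]) (use \<gamma>(1) zR in simp)
  then have ev: "\<forall>\<^sub>F t in nhds 0. \<gamma> t \<in> ?R \<and> \<gamma> t \<in> S" using \<gamma>S by (rule eventually_conj)
  then obtain I where I: "open I" "0 \<in> I" "\<And>t. t \<in> I \<Longrightarrow> \<gamma> t \<in> ?R" "\<And>t. t \<in> I \<Longrightarrow> \<gamma> t \<in> S"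
    unfolding eventually_nhds by blast
  have sub: "(\<lambda>t. snd ?c (\<gamma> t)) ` I \<subseteq> ?S0" using I by blast
  have 1: "((\<lambda>t. snd ?c (\<gamma> t)) has_derivative (\<lambda>s. s *\<^sub>R u)) (at 0 within I)"
    using \<gamma>(3) unfolding has_vector_derivative_def by (rule has_derivative_at_withinI)
  have 2: "((snd ?d \<circ> f \<circ> chart_inv ?c) has_derivative ?D) (at (snd ?c (\<gamma> 0)) within (\<lambda>t. snd ?c (\<gamma> t)) ` I)"
    unfolding \<gamma>(1) by (rule has_derivative_subset[OF D sub])
  have "((\<lambda>t. (snd ?d \<circ> f \<circ> chart_inv ?c) (snd ?c (\<gamma> t))) has_derivative (\<lambda>s. ?D (s *\<^sub>R u))) (at 0 within I)"
    by (rule has_derivative_in_compose[OF 1 2])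
  then have "((\<lambda>t. (snd ?d \<circ> f \<circ> chart_inv ?c) (snd ?c (\<gamma> t))) has_vector_derivative ?D u) (at 0)"
    unfolding at_within_open[OF I(2,1)] has_vector_derivative_def
    by (simp add: linear_cmul[OF has_derivative_linear[OF D]])
  then have "((\<lambda>t. snd ?d (f (\<gamma> t))) has_vector_derivative ?D u) (at 0)"
    by (rule has_vector_derivative_cong_eventually)
      (rule eventually_mono[OF ev], simp add: chart_inv_left[OF c(4)])
  moreover have "isCont (\<lambda>t. f (\<gamma> t)) 0"
  proof -
    have "isCont g (\<gamma> 0)" using cg oU U \<gamma>(1) continuous_on_eq_continuous_at by blast
    then have "isCont (\<lambda>t. g (\<gamma> t)) 0" using \<gamma>(2) isCont_o2 by blast
    moreover have "\<forall>\<^sub>F t in nhds 0. g (\<gamma> t) = f (\<gamma> t)"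
      using ev by eventually_elim (use gf in blast)
    ultimately show ?thesis using isCont_cong[of "\<lambda>t. g (\<gamma> t)" "\<lambda>t. f (\<gamma> t)" 0] by simp
  qed
  ultimately show ?thesis using \<gamma>(1) unfolding has_velocity_def by simp
qed

lemma tangent_map_smooth_on_open:
  fixes A :: "('p::topological_space, 'e::euclidean_space) chart set"
    and B :: "('q::topological_space, 'f::euclidean_space) chart set"
  assumes A: "smooth_atlas A" and B: "smooth_atlas B" and g: "smooth_map_open A B U g" and z: "z \<in> U"
    and v: "has_velocity A \<gamma> z u" and w: "has_velocity B (\<lambda>t. g (\<gamma> t)) (g z) w"
    and c: "c \<in> maximal_atlas A" "z \<in> fst c" and d: "d \<in> maximal_atlas B" "g z \<in> fst d"
  shows "tcoord B d (g z) w = frechet_derivative (snd d \<circ> g \<circ> chart_inv c) (at (snd c z)) (tcoord A c z u)"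
proof -
  have ic: "is_chart c" using c maximal_atlas_is_chart by blast
  let ?R = "fst c \<inter> U \<inter> g -` fst d"
  have sm: "smooth_on (snd c ` ?R) (snd d \<circ> g \<circ> chart_inv c)"
    by (rule smooth_map_open_charts[OF A B g c(1) d(1)])
  have \<gamma>: "\<gamma> 0 = z" "isCont \<gamma> 0" using v unfolding has_velocity_def by blast+
  have "((\<lambda>t. (snd d \<circ> g \<circ> chart_inv c) (snd c (\<gamma> t))) has_vector_derivative
     frechet_derivative (snd d \<circ> g \<circ> chart_inv c) (at (snd c z)) (tcoord A c z u)) (at 0)"
    using has_vector_derivative_smooth_compose[OF has_velocity_tcoord[OF A c v] sm] \<gamma>(1) z c(2) d(2) by auto
  moreover have "\<forall>\<^sub>F t in nhds 0. \<gamma> t \<in> fst c"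
    by (rule isCont_eventually_open[OF \<gamma>(2) is_chart_open(1)[OF ic]]) (use \<gamma>(1) c in simp)
  then have "\<forall>\<^sub>F t in nhds 0. (snd d \<circ> g \<circ> chart_inv c) (snd c (\<gamma> t)) = snd d (g (\<gamma> t))"
    by eventually_elim (simp add: chart_inv_left[OF ic])
  ultimately have "((\<lambda>t. snd d (g (\<gamma> t))) has_vector_derivative
     frechet_derivative (snd d \<circ> g \<circ> chart_inv c) (at (snd c z)) (tcoord A c z u)) (at 0)"
    by (rule has_vector_derivative_cong_eventually)
  then show ?thesis using has_velocity_tcoord[OF B d w] vector_derivative_unique_at by blast
qed

section \<open>Tangent spaces of submanifolds in slice charts\<close>

lemma has_velocity_std: "has_velocity std_atlas (\<lambda>t. t) (0::real) 1"
  unfolding has_velocity_def by (simp add: chart_at_std has_vector_derivative_id[unfolded id_def])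

lemma tangent_space_iff:
  fixes A :: "('p::topological_space, 'e::euclidean_space) chart set"
  assumes A: "smooth_atlas A"
  shows "u \<in> tangent_space A N z \<longleftrightarrow> (\<exists>\<gamma> e. e > 0 \<and> smooth_map std_atlas A {-e<..<e} \<gamma> \<and>
     \<gamma> ` {-e<..<e} \<subseteq> N \<and> has_velocity A \<gamma> z u)"
proof -
  have *: "has_velocity A \<gamma> (\<gamma> 0) (tangent_map std_atlas A {-e<..<e} \<gamma> (0::real) 1)"
    if "e > 0" "smooth_map std_atlas A {-e<..<e} \<gamma>" for e \<gamma>
  proof (rule has_velocity_tangent_map[OF smooth_atlas_std A that(2) _ has_velocity_std])
    show "\<forall>\<^sub>F t in nhds (0::real). t \<in> {-e<..<e}"
      using that(1) by (intro eventually_nhds_in_open) auto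
  qed (use that in simp)
  show ?thesis
  proof
    assume "u \<in> tangent_space A N z"
    then obtain \<gamma> e where "u = tangent_map std_atlas A {-e<..<e} \<gamma> (0::real) 1"
        "e > 0" "smooth_map std_atlas A {-e<..<e} \<gamma>" "\<gamma> ` {-e<..<e} \<subseteq> N" "\<gamma> 0 = z"
      unfolding tangent_space_def by blast
    then show "\<exists>\<gamma> e. e > 0 \<and> smooth_map std_atlas A {-e<..<e} \<gamma> \<and>
       \<gamma> ` {-e<..<e} \<subseteq> N \<and> has_velocity A \<gamma> z u" using * by metis
  next
    assume "\<exists>\<gamma> e. e > 0 \<and> smooth_map std_atlas A {-e<..<e} \<gamma> \<and>
       \<gamma> ` {-e<..<e} \<subseteq> N \<and> has_velocity A \<gamma> z u"
    then obtain \<gamma> e where \<gamma>: "e > 0" "smooth_map std_atlas A {-e<..<e} \<gamma>"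
       "\<gamma> ` {-e<..<e} \<subseteq> N" "has_velocity A \<gamma> z u" by blast
    have "\<gamma> 0 = z" using \<gamma>(4) unfolding has_velocity_def by blast
    moreover from this have "u = tangent_map std_atlas A {-e<..<e} \<gamma> (0::real) 1"
      using *[OF \<gamma>(1,2)] \<gamma>(4) has_velocity_unique by blast
    ultimately show "u \<in> tangent_space A N z" using \<gamma> unfolding tangent_space_def by blast
  qed
qed

lemma tangent_spaceE:
  assumes "smooth_atlas A" "u \<in> tangent_space A N z"
  obtains \<gamma> where "has_velocity A \<gamma> z u" "\<forall>\<^sub>F t in nhds 0. \<gamma> t \<in> N"
proof -
  obtain \<gamma> e where \<gamma>: "e > 0" "\<gamma> ` {-e<..<e} \<subseteq> N" "has_velocity A \<gamma> z u"
    using assms tangent_space_iff by metis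
  have "\<forall>\<^sub>F t in nhds (0::real). t \<in> {-e<..<e}"
    using \<gamma>(1) by (intro eventually_nhds_in_open) auto
  then have "\<forall>\<^sub>F t in nhds 0. \<gamma> t \<in> N" by eventually_elim (use \<gamma>(2) in blast)
  then show ?thesis using that \<gamma>(3) by blast
qed

lemma smooth_map_open_chart_curve:
  fixes A :: "('p::topological_space, 'e::euclidean_space) chart set"
  assumes A: "smooth_atlas A" and c: "c \<in> maximal_atlas A" and I: "open (I :: real set)"
    and h: "smooth_on I h" "h ` I \<subseteq> snd c ` fst c"
  shows "smooth_map_open std_atlas A I (\<lambda>t. chart_inv c (h t))"
  unfolding smooth_map_open_def
proof (intro conjI ballI)
  have ic: "is_chart c" using c maximal_atlas_is_chart by blast
  show "open I" by (rule I)
  show cont: "continuous_on I (\<lambda>t. chart_inv c (h t))"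
    by (rule continuous_on_compose2[OF is_chart_continuous(2)[OF ic] smooth_on_imp_continuous_on[OF h(1)] h(2)])
  fix a :: "(real, real) chart" and d assume a: "a \<in> std_atlas" and d: "d \<in> A"
  have a: "a = (UNIV, \<lambda>x. x)" using a unfolding std_atlas_def by simp
  have dm: "d \<in> maximal_atlas A" and id: "is_chart d" using d atlas_subset_maximal[OF A] maximal_atlas_is_chart by blast+
  let ?R = "I \<inter> (\<lambda>t. chart_inv c (h t)) -` fst d"
  have oR: "open ?R" by (rule continuous_open_preimage[OF cont I is_chart_open(1)[OF id]])
  have hR: "smooth_on ?R h" by (rule smooth_on_subset[OF h(1)]) simp
  have "smooth_on ?R (\<lambda>t. (snd d \<circ> chart_inv c) (h t))"
  proof (rule smooth_on_compose[OF oR hR maximal_atlas_transition[OF A c dm]])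
    show "h ` ?R \<subseteq> snd c ` (fst c \<inter> fst d)"
    proof
      fix y assume "y \<in> h ` ?R"
      then obtain t where t: "t \<in> I" "chart_inv c (h t) \<in> fst d" "y = h t" by blast
      then have ht: "h t \<in> snd c ` fst c" using h(2) by blast
      have "snd c (chart_inv c (h t)) = h t" "chart_inv c (h t) \<in> fst c"
        by (rule chart_inv_right[OF ht], rule chart_inv_in[OF ht])
      then show "y \<in> snd c ` (fst c \<inter> fst d)" using t by (metis IntI imageI)
    qed
  qed
  then show "smooth_on (snd a ` (fst a \<inter> I \<inter> (\<lambda>t. chart_inv c (h t)) -` fst d))
      (snd d \<circ> (\<lambda>t. chart_inv c (h t)) \<circ> chart_inv a)"
    unfolding a by (simp add: o_def)
qed

text \<open>Subspaces are closed, and the difference quotients at the times with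
  \<open>h t \<in> L\<close> lie in \<open>L\<close>. It suffices that such times accumulate at
  \<open>t0\<close>; this is all that is known about the times at which a curve meets a
  plaque.\<close>

lemma has_vector_derivative_in_subspace:
  fixes h :: "real \<Rightarrow> 'a::euclidean_space"
  assumes "(h has_vector_derivative w) (at t0)" "subspace L" "h t0 \<in> L" "\<exists>\<^sub>F t in at t0. h t \<in> L"
  shows "w \<in> L"
proof (rule ccontr)
  assume "w \<notin> L"
  then have "w \<in> - L" by simp
  moreover have "open (- L)" using closed_subspace[OF assms(2)] by (simp add: open_Compl)
  moreover have "((\<lambda>t. (h t - h t0) /\<^sub>R (t - t0)) \<longlongrightarrow> w) (at t0)"
  proof -
    have "((\<lambda>t. (h t - h t0 - (t - t0) *\<^sub>R w) /\<^sub>R \<bar>t - t0\<bar>) \<longlongrightarrow> 0) (at t0)"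
      using assms(1) unfolding has_vector_derivative_def has_derivative_def by (simp add: netlimit_at)
    then have "((\<lambda>t. norm ((h t - h t0 - (t - t0) *\<^sub>R w) /\<^sub>R \<bar>t - t0\<bar>)) \<longlongrightarrow> 0) (at t0)"
      by (rule tendsto_norm_zero)
    moreover have "\<forall>\<^sub>F t in at t0. norm ((h t - h t0) /\<^sub>R (t - t0) - w) \<le> norm ((h t - h t0 - (t - t0) *\<^sub>R w) /\<^sub>R \<bar>t - t0\<bar>)"
      unfolding eventually_at_filter
    proof (intro always_eventually allI impI)
      fix t assume "t \<noteq> t0"
      then have "(h t - h t0) /\<^sub>R (t - t0) - w = (h t - h t0 - (t - t0) *\<^sub>R w) /\<^sub>R (t - t0)"
        by (simp add: scaleR_diff_right)
      then show "norm ((h t - h t0) /\<^sub>R (t - t0) - w) \<le> norm ((h t - h t0 - (t - t0) *\<^sub>R w) /\<^sub>R \<bar>t - t0\<bar>)"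
        by simp
    qed
    ultimately have "((\<lambda>t. (h t - h t0) /\<^sub>R (t - t0) - w) \<longlongrightarrow> 0) (at t0)"
      by (rule Lim_null_comparison[rotated])
    then show ?thesis by (simp add: LIM_zero_iff)
  qed
  ultimately have "\<forall>\<^sub>F t in at t0. (h t - h t0) /\<^sub>R (t - t0) \<in> - L"
    using topological_tendstoD by blast
  from frequently_ex[OF frequently_eventually_conj[OF assms(4) this]]
  obtain t where "h t \<in> L" "(h t - h t0) /\<^sub>R (t - t0) \<notin> L" by auto
  then show False using assms(2,3) by (simp add: subspace_diff subspace_scale)
qed

definition slice_chart ::
  "('p::topological_space, 'e::euclidean_space) chart set \<Rightarrow> 'p set \<Rightarrow> ('p, 'e) chart \<Rightarrow> 'e set \<Rightarrow> 'p \<Rightarrow> bool" where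
  "slice_chart A N c L z \<longleftrightarrow> c \<in> maximal_atlas A \<and> subspace L \<and> z \<in> fst c \<and> z \<in> N \<and>
     snd c ` (fst c \<inter> N) = snd c ` fst c \<inter> L"

lemma slice_chart_iff:
  assumes "slice_chart A N c L z" "x \<in> fst c"
  shows "x \<in> N \<longleftrightarrow> snd c x \<in> L"
proof -
  have ic: "is_chart c" using assms maximal_atlas_is_chart unfolding slice_chart_def by blast
  have inj: "x = y" if "y \<in> fst c" "snd c x = snd c y" for y
    using that assms(2) chart_inv_left[OF ic] by metis
  show ?thesis using assms inj unfolding slice_chart_def by auto
qed

lemma slice_chart_at: "slice_chart A N c L z \<Longrightarrow> x \<in> fst c \<Longrightarrow> x \<in> N \<Longrightarrow> slice_chart A N c L x"
  unfolding slice_chart_def by blast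

text \<open>A curve in \<open>N\<close> has coordinates in the subspace \<open>L\<close>, and so has
  its velocity; conversely the straight line in \<open>L\<close> with a given velocity is the
  coordinate image of a smooth curve in \<open>N\<close>.\<close>

lemma tangent_space_slice:
  fixes A :: "('p::topological_space, 'e::euclidean_space) chart set"
  assumes A: "smooth_atlas A" and s: "slice_chart A N c L z"
  shows "u \<in> tangent_space A N z \<longleftrightarrow> tcoord A c z u \<in> L"
proof
  have c: "c \<in> maximal_atlas A" "subspace L" "z \<in> fst c" "z \<in> N" using s unfolding slice_chart_def by blast+
  have ic: "is_chart c" using c maximal_atlas_is_chart by blast
  {
    assume "u \<in> tangent_space A N z"
    then obtain \<gamma> where \<gamma>: "has_velocity A \<gamma> z u" "\<forall>\<^sub>F t in nhds 0. \<gamma> t \<in> N"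
      by (rule tangent_spaceE[OF A])
    have \<gamma>0: "\<gamma> 0 = z" "isCont \<gamma> 0" using \<gamma>(1) unfolding has_velocity_def by blast+
    have "\<forall>\<^sub>F t in nhds 0. \<gamma> t \<in> fst c"
      by (rule isCont_eventually_open[OF \<gamma>0(2) is_chart_open(1)[OF ic]]) (use \<gamma>0(1) c in simp)
    with \<gamma>(2) have "\<forall>\<^sub>F t in nhds 0. snd c (\<gamma> t) \<in> L"
      by eventually_elim (use slice_chart_iff[OF s] in blast)
    then have ev: "\<forall>\<^sub>F t in at 0. snd c (\<gamma> t) \<in> L" by (simp add: eventually_nhds_conv_at)
    show "tcoord A c z u \<in> L"
      by (rule has_vector_derivative_in_subspace[OF has_velocity_tcoord[OF A c(1,3) \<gamma>(1)] c(2)])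
        (use slice_chart_iff[OF s c(3)] c(4) \<gamma>0(1) eventually_frequently[OF at_neq_bot ev] in auto)
  }
  assume L: "tcoord A c z u \<in> L"
  let ?w = "tcoord A c z u"
  obtain e where e: "e > 0" "\<And>t::real. \<bar>t\<bar> < e \<Longrightarrow> snd c z + t *\<^sub>R ?w \<in> snd c ` fst c"
    "isCont (\<lambda>t. chart_inv c (snd c z + t *\<^sub>R ?w)) 0"
    "((\<lambda>t. snd c (chart_inv c (snd c z + t *\<^sub>R ?w))) has_vector_derivative ?w) (at 0)"
    using chart_line[OF ic c(3), of ?w] by metis
  let ?\<gamma> = "\<lambda>t. chart_inv c (snd c z + t *\<^sub>R ?w)"
  have "smooth_on {-e<..<e} (\<lambda>t. snd c z + t *\<^sub>R ?w)"
    by (intro smooth_on_add smooth_on_const smooth_on_linear bounded_linear_scaleR_left) auto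
  then have "smooth_map_open std_atlas A {-e<..<e} ?\<gamma>"
    using e(2) by (intro smooth_map_open_chart_curve[OF A c(1)]) auto
  then have "smooth_map std_atlas A {-e<..<e} ?\<gamma>" unfolding smooth_map_def by blast
  moreover have "?\<gamma> ` {-e<..<e} \<subseteq> N"
  proof
    fix y assume "y \<in> ?\<gamma> ` {-e<..<e}"
    then obtain t where t': "y = ?\<gamma> t" "t \<in> {-e<..<e}" by (rule imageE)
    then have t: "\<bar>t\<bar> < e" "y = ?\<gamma> t" by (simp_all add: abs_less_iff)
    have "y \<in> fst c" "snd c y = snd c z + t *\<^sub>R ?w"
      unfolding t(2) by (rule chart_inv_in[OF e(2)[OF t(1)]], rule chart_inv_right[OF e(2)[OF t(1)]])
    then show "y \<in> N"
      using slice_chart_iff[OF s] c L by (simp add: subspace_add subspace_scale)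
  qed
  moreover have "has_velocity A ?\<gamma> z u"
    using has_velocity_tcoord_inv[OF A c(1) _ e(3,4)] chart_inv_left[OF ic c(3)] c(3) tcoord_inverse(2)[OF A c(1,3)]
    by simp
  ultimately show "u \<in> tangent_space A N z"
    using e(1) tangent_space_iff[OF A] by blast
qed

section \<open>Presymplectic submanifolds in slice charts\<close>

lemma tangent_map_linear:
  fixes A :: "('p::topological_space, 'e::euclidean_space) chart set"
    and B :: "('q::topological_space, 'f::euclidean_space) chart set"
  assumes A: "smooth_atlas A" and B: "smooth_atlas B" and f: "smooth_map A B S f" and z: "z \<in> S"
  shows "linear (tangent_map A B S f z)"
  using tangent_map_has_derivative[OF assms] has_derivative_linear by blast

lemma tcoord_transition:
  fixes A :: "('p::topological_space, 'e::euclidean_space) chart set"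
  assumes A: "smooth_atlas A" and c: "c \<in> maximal_atlas A" "z \<in> fst c"
    and d: "d \<in> maximal_atlas A" "z \<in> fst d"
  shows "frechet_derivative (snd d \<circ> chart_inv c) (at (snd c z)) w = tcoord A d z (tcoord_inv A c z w)"
proof -
  have ic: "is_chart c" using c maximal_atlas_is_chart by blast
  let ?\<gamma> = "\<lambda>t. chart_inv c (snd c z + t *\<^sub>R w)"
  obtain e where e: "isCont ?\<gamma> 0" "((\<lambda>t. snd c (?\<gamma> t)) has_vector_derivative w) (at 0)"
    using chart_line[OF ic c(2), of w] by metis
  have \<gamma>0: "?\<gamma> 0 = z" using chart_inv_left[OF ic c(2)] by simp
  have "has_velocity A ?\<gamma> z (tcoord_inv A c z w)"
    using has_velocity_tcoord_inv[OF A c(1) _ e] \<gamma>0 c(2) by simp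
  from has_velocity_tcoord[OF A d this]
  have "((\<lambda>t. snd d (?\<gamma> t)) has_vector_derivative tcoord A d z (tcoord_inv A c z w)) (at 0)" .
  moreover have "((\<lambda>t. snd d (?\<gamma> t)) has_vector_derivative frechet_derivative (snd d \<circ> chart_inv c) (at (snd c z)) w) (at 0)"
    using transition_derivative_curve[OF A c(1) _ d(1) _ e] \<gamma>0 c(2) d(2) by simp
  ultimately show ?thesis using vector_derivative_unique_at by blast
qed

lemma closed_form_on_cong:
  assumes "open S" "\<And>x u v. x \<in> S \<Longrightarrow> \<alpha> x u v = \<beta> x u v" "closed_form_on S \<beta>"
  shows "closed_form_on S \<alpha>"
proof -
  have eq: "\<alpha> x = \<beta> x" if "x \<in> S" for x using assms(2)[OF that] by (simp add: fun_eq_iff)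
  have "frechet_derivative (\<lambda>y. \<alpha> y u v) (at x) = frechet_derivative (\<lambda>y. \<beta> y u v) (at x)" if "x \<in> S" for x u v
    by (rule frechet_derivative_cong_open[OF assms(1) that]) (rule assms(2))
  moreover have "smooth_on S (\<lambda>y. \<alpha> y u v) \<longleftrightarrow> smooth_on S (\<lambda>y. \<beta> y u v)" for u v
    by (rule smooth_on_cong[OF assms(1)]) (rule assms(2))
  ultimately show ?thesis
    using assms(3) eq unfolding closed_form_on_def smooth_form_on_def ext_deriv_def by simp
qed

lemma closed_form_on_local:
  assumes "\<And>x. x \<in> S \<Longrightarrow> \<exists>T. open T \<and> x \<in> T \<and> closed_form_on T \<alpha>"
  shows "closed_form_on S \<alpha>"
proof -
  have "\<exists>T. open T \<and> x \<in> T \<and> smooth_on T (\<lambda>x. \<alpha> x u v)" if "x \<in> S" for x u v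
    using assms[OF that] unfolding closed_form_on_def smooth_form_on_def by metis
  then have "smooth_on S (\<lambda>x. \<alpha> x u v)" for u v by (intro smooth_on_local)
  moreover have "bilinear (\<alpha> x) \<and> (\<forall>u. \<alpha> x u u = 0) \<and> (\<forall>u v w. ext_deriv \<alpha> x u v w = 0)" if "x \<in> S" for x
    using assms[OF that] unfolding closed_form_on_def smooth_form_on_def by metis
  ultimately show ?thesis unfolding closed_form_on_def smooth_form_on_def by simp
qed

lemma closed_form_on_subset: "closed_form_on T \<alpha> \<Longrightarrow> S \<subseteq> T \<Longrightarrow> closed_form_on S \<alpha>"
  unfolding closed_form_on_def smooth_form_on_def using smooth_on_subset by (meson subsetD)

text \<open>The coordinate expression of a form in any chart of the maximal atlas. In charts of
  \<open>A\<close> it agrees with \<open>form_in_chart\<close>, through which smoothness and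
  closedness are postulated.\<close>

definition chart_form ::
  "('p::topological_space, 'e::euclidean_space) chart set \<Rightarrow> ('p \<Rightarrow> 'e \<Rightarrow> 'e \<Rightarrow> real) \<Rightarrow> ('p, 'e) chart \<Rightarrow>
     'e \<Rightarrow> 'e \<Rightarrow> 'e \<Rightarrow> real" where
  "chart_form A \<omega> c x u v =
     \<omega> (chart_inv c x) (tcoord_inv A c (chart_inv c x) u) (tcoord_inv A c (chart_inv c x) v)"

lemma chart_form_tcoord:
  assumes "smooth_atlas A" "c \<in> maximal_atlas A" "z \<in> fst c"
  shows "chart_form A \<omega> c (snd c z) (tcoord A c z u) (tcoord A c z v) = \<omega> z u v"
  unfolding chart_form_def chart_inv_left[OF maximal_atlas_is_chart[OF assms(2)] assms(3)]
  by (simp add: tcoord_inverse(2)[OF assms])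

lemma form_in_chart_eq_chart_form:
  assumes "smooth_atlas A" "d \<in> A" "x \<in> snd d ` fst d"
  shows "form_in_chart A d \<omega> x u v = chart_form A \<omega> d x u v"
proof -
  have d: "d \<in> maximal_atlas A" "is_chart d"
    using assms(2) atlas_subset_maximal[OF assms(1)] maximal_atlas_is_chart by blast+
  have "tangent_map std_atlas A (snd d ` fst d) (chart_inv d) x = tcoord_inv A d (chart_inv d x)"
    unfolding tangent_map_def tcoord_inv_def Let_def chart_at_std
    using at_within_open[OF assms(3) is_chart_open(2)[OF d(2)]] chart_inv_right[OF assms(3)]
    by (simp add: o_def)
  then show ?thesis unfolding form_in_chart_def pullback_form_def chart_form_def by simp
qed

text \<open>Closedness is postulated in charts of \<open>A\<close> only. Near each point the
  expression in \<open>c\<close> is the pull-back, along a transition map, of the expression in a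
  chart of \<open>A\<close>, and pull-back preserves closedness.\<close>

lemma closed_chart_form:
  fixes A :: "('p::topological_space, 'e::euclidean_space) chart set"
  assumes A: "smooth_atlas A" and om: "smooth_two_form A \<omega>" "closed_two_form A \<omega>" and c: "c \<in> maximal_atlas A"
  shows "closed_form_on (snd c ` fst c) (chart_form A \<omega> c)"
proof (rule closed_form_on_local)
  fix x assume "x \<in> snd c ` fst c"
  then obtain z where z: "z \<in> fst c" "x = snd c z" by blast
  have ic: "is_chart c" using c maximal_atlas_is_chart by blast
  let ?d = "chart_at A z"
  note d = chart_at[OF A, of z]
  have lin: "linear (tcoord_inv A ?d p)" if "p \<in> fst ?d" for p
    by (rule tcoord_linear(2)[OF A d(3) that])
  have "closed_form_on (snd ?d ` fst ?d) (form_in_chart A ?d \<omega>)"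
    unfolding closed_form_on_def smooth_form_on_def ext_deriv_def
  proof (intro conjI ballI allI)
    fix y assume y: "y \<in> snd ?d ` fst ?d"
    let ?p = "chart_inv ?d y"
    have l: "linear (tcoord_inv A ?d ?p)" by (rule lin[OF chart_inv_in[OF y]])
    have b: "bilinear (\<omega> ?p)" "\<And>u. \<omega> ?p u u = 0" using om(1) unfolding smooth_two_form_def by blast+
    have eq: "form_in_chart A ?d \<omega> y = chart_form A \<omega> ?d y"
      using form_in_chart_eq_chart_form[OF A d(1) y] by (simp add: fun_eq_iff)
    show "bilinear (form_in_chart A ?d \<omega> y)"
      unfolding eq chart_form_def[abs_def] bilinear_def
      using linear_compose[OF l, of "\<omega> ?p w" for w] linear_compose[OF l, of "\<lambda>u. \<omega> ?p u w" for w] b(1)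
      unfolding bilinear_def by (simp add: o_def)
    show "form_in_chart A ?d \<omega> y u u = 0" for u unfolding eq chart_form_def by (rule b(2))
    show "frechet_derivative (\<lambda>y. form_in_chart A ?d \<omega> y v w) (at y) u
      - frechet_derivative (\<lambda>y. form_in_chart A ?d \<omega> y u w) (at y) v
      + frechet_derivative (\<lambda>y. form_in_chart A ?d \<omega> y u v) (at y) w = 0" for u v w
      using om(2) d(1) y unfolding closed_two_form_def by blast
  next
    show "smooth_on (snd ?d ` fst ?d) (\<lambda>x. form_in_chart A ?d \<omega> x u v)" for u v
      using om(1) d(1) unfolding smooth_two_form_def by blast
  qed
  then have cl: "closed_form_on (snd ?d ` fst ?d) (chart_form A \<omega> ?d)"
    by (rule closed_form_on_cong[OF is_chart_open(2)[OF d(4)], rotated])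
      (simp add: form_in_chart_eq_chart_form[OF A d(1)])
  let ?T = "snd c ` (fst c \<inter> fst ?d)"
  have oT: "open ?T" by (rule chart_image_open[OF ic open_Int[OF is_chart_open(1)[OF ic] is_chart_open(1)[OF d(4)]]]) simp
  have "closed_form_on ?T (pull (snd ?d \<circ> chart_inv c) (chart_form A \<omega> ?d))"
  proof (rule pull_closed[OF cl is_chart_open(2)[OF d(4)] oT maximal_atlas_transition[OF A c d(3)]])
    show "(snd ?d \<circ> chart_inv c) ` ?T \<subseteq> snd ?d ` fst ?d"
      using chart_inv_left[OF ic] by auto
  qed
  then have "closed_form_on ?T (chart_form A \<omega> c)"
  proof (rule closed_form_on_cong[OF oT, rotated])
    fix y u v assume "y \<in> ?T"
    then obtain p where p: "p \<in> fst c" "p \<in> fst ?d" "y = snd c p" by blast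
    show "chart_form A \<omega> c y u v = pull (snd ?d \<circ> chart_inv c) (chart_form A \<omega> ?d) y u v"
      unfolding pull_def p(3) tcoord_transition[OF A c p(1) d(3) p(2)]
      by (simp add: chart_inv_left[OF ic p(1)] chart_form_tcoord[OF A d(3) p(2)])
        (simp add: chart_form_def chart_inv_left[OF ic p(1)])
  qed
  then show "\<exists>T. open T \<and> x \<in> T \<and> closed_form_on T (chart_form A \<omega> c)"
    using oT z d(2) by blast
qed

section \<open>The kernel of \<nu> in slice charts\<close>

locale presymplectic_submanifold =
  fixes A :: "('p::{t2_space,second_countable_topology}, 'e::euclidean_space) chart set"
    and \<omega> \<nu> :: "'p \<Rightarrow> 'e \<Rightarrow> 'e \<Rightarrow> real" and M :: "'p set" and m k :: nat
  assumes symplectic: "symplectic_manifold A \<omega>" and submanifold: "submanifold A m M"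
    and \<nu>_def: "\<nu> = pullback_form A A M (\<lambda>x. x) \<omega>"
    and rank: "\<And>z. z \<in> M \<Longrightarrow> dim (form_kernel A M \<nu> z) = k"
begin

abbreviation "K \<equiv> form_kernel A M \<nu>"
abbreviation "\<Omega> \<equiv> chart_form A \<omega>"

lemma atlas: "smooth_atlas A" and forms: "smooth_two_form A \<omega>" "closed_two_form A \<omega>"
  using symplectic unfolding symplectic_manifold_def by blast+

lemma bilinear_\<omega>: "bilinear (\<omega> z)"
  using forms(1) unfolding smooth_two_form_def by blast

lemma submanifold_slice:
  assumes "submanifold A j N" "z \<in> N"
  obtains c L where "slice_chart A N c L z" "dim L = j"
  using assms unfolding submanifold_def slice_chart_def by metis

lemma smooth_map_id: "smooth_map A A S (\<lambda>x. x)"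
proof -
  have "smooth_map_open A A UNIV (\<lambda>x. x)"
    unfolding smooth_map_open_def
  proof (intro conjI ballI)
    fix c d assume "c \<in> A" "d \<in> A"
    then show "smooth_on (snd c ` (fst c \<inter> UNIV \<inter> (\<lambda>x. x) -` fst d)) (snd d \<circ> (\<lambda>x. x) \<circ> chart_inv c)"
      using maximal_atlas_transition[OF atlas, of c d] subsetD[OF atlas_subset_maximal[OF atlas]] by (simp add: o_def)
  qed auto
  then show ?thesis unfolding smooth_map_def by blast
qed

text \<open>The differential of the inclusion is taken within \<open>M\<close>, so it is known to be
  the identity only on vectors tangent to \<open>M\<close>, where velocities of curves in
  \<open>M\<close> determine it.\<close>

lemma \<nu>_eq_\<omega>:
  assumes "z \<in> M" "u \<in> tangent_space A M z" "v \<in> tangent_space A M z"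
  shows "\<nu> z u v = \<omega> z u v"
proof -
  have "tangent_map A A M (\<lambda>x. x) z u = u" if u: "u \<in> tangent_space A M z" for u
  proof -
    obtain \<gamma> where \<gamma>: "has_velocity A \<gamma> z u" "\<forall>\<^sub>F t in nhds 0. \<gamma> t \<in> M"
      using tangent_spaceE[OF atlas u] by metis
    then show ?thesis
      using has_velocity_tangent_map[OF atlas atlas smooth_map_id assms(1) \<gamma>] has_velocity_unique by metis
  qed
  then show ?thesis using assms unfolding \<nu>_def pullback_form_def by simp
qed

lemma closed_\<Omega>: "c \<in> maximal_atlas A \<Longrightarrow> closed_form_on (snd c ` fst c) (\<Omega> c)"
  by (rule closed_chart_form[OF atlas forms])

text \<open>Both the vectors and the test vectors of the kernel range over the tangent space of
  \<open>M\<close>, which the chart carries onto \<open>L\<close>.\<close>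

lemma kernel_in_slice_chart:
  assumes s: "slice_chart A M c L z"
  shows "u \<in> K z \<longleftrightarrow> tcoord A c z u \<in> fkernel L (\<Omega> c) (snd c z)"
proof -
  have c: "c \<in> maximal_atlas A" "z \<in> fst c" "z \<in> M" using s unfolding slice_chart_def by blast+
  note T = tangent_space_slice[OF atlas s]
  note \<Omega> = chart_form_tcoord[OF atlas c(1,2), of \<omega>]
  show ?thesis
  proof
    assume u: "u \<in> K z"
    then have uT: "u \<in> tangent_space A M z" unfolding form_kernel_def by blast
    have "\<Omega> c (snd c z) (tcoord A c z u) w = 0" if "w \<in> L" for w
    proof -
      let ?v = "tcoord_inv A c z w"
      have "?v \<in> tangent_space A M z" using T that tcoord_inverse(1)[OF atlas c(1,2)] by simp
      then have "\<omega> z u ?v = 0" using u \<nu>_eq_\<omega>[OF c(3) uT] unfolding form_kernel_def by auto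
      then show ?thesis using \<Omega>[of u ?v] tcoord_inverse(1)[OF atlas c(1,2)] by simp
    qed
    then show "tcoord A c z u \<in> fkernel L (\<Omega> c) (snd c z)" using uT T unfolding fkernel_def by blast
  next
    assume u: "tcoord A c z u \<in> fkernel L (\<Omega> c) (snd c z)"
    then have uT: "u \<in> tangent_space A M z" using T unfolding fkernel_def by blast
    have "\<nu> z u v = 0" if "v \<in> tangent_space A M z" for v
      using u \<nu>_eq_\<omega>[OF c(3) uT that] \<Omega>[of u v] T that unfolding fkernel_def by auto
    then show "u \<in> K z" using uT unfolding form_kernel_def by blast
  qed
qed

lemma dim_fkernel_slice:
  assumes s: "slice_chart A M c L z"
  shows "dim (fkernel L (\<Omega> c) (snd c z)) = k"
proof -
  have c: "c \<in> maximal_atlas A" "z \<in> fst c" "z \<in> M" using s unfolding slice_chart_def by blast+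
  have "fkernel L (\<Omega> c) (snd c z) = tcoord A c z ` K z"
  proof
    show "tcoord A c z ` K z \<subseteq> fkernel L (\<Omega> c) (snd c z)" using kernel_in_slice_chart[OF s] by blast
    show "fkernel L (\<Omega> c) (snd c z) \<subseteq> tcoord A c z ` K z"
    proof
      fix w assume "w \<in> fkernel L (\<Omega> c) (snd c z)"
      then have "tcoord_inv A c z w \<in> K z"
        using kernel_in_slice_chart[OF s] tcoord_inverse(1)[OF atlas c(1,2)] by simp
      then show "w \<in> tcoord A c z ` K z" using tcoord_inverse(1)[OF atlas c(1,2), of w] by (metis imageI)
    qed
  qed
  moreover have "dim (tcoord A c z ` K z) = dim (K z)"
    by (rule dim_image_eq[OF tcoord_linear(1)[OF atlas c(1,2)]])
      (auto intro!: inj_onI simp: tcoord_inj[OF atlas c(1,2)])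
  ultimately show ?thesis using rank[OF c(3)] by simp
qed

lemma kernel_lipschitz_in_slice:
  assumes s: "slice_chart A M c L z"
  obtains r C where "r > 0" "C > 0" "ball (snd c z) r \<subseteq> snd c ` fst c"
    "lipschitz_distribution C (ball (snd c z) r \<inter> L) (fkernel L (\<Omega> c))"
proof -
  have c: "c \<in> maximal_atlas A" "z \<in> fst c" "z \<in> M" "subspace L" using s unfolding slice_chart_def by blast+
  have sf: "smooth_form_on (snd c ` fst c) (\<Omega> c)" using closed_\<Omega>[OF c(1)] unfolding closed_form_on_def by blast
  have ic: "is_chart c" using c maximal_atlas_is_chart by blast
  have x0: "snd c z \<in> snd c ` fst c" "snd c z \<in> L" using c slice_chart_iff[OF s c(2)] by auto
  have dim: "dim (fkernel L (\<Omega> c) x) = k" if x: "x \<in> snd c ` fst c" "x \<in> L" for x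
  proof -
    obtain p where p: "p \<in> fst c" "x = snd c p" using x by blast
    then have "p \<in> M" using slice_chart_iff[OF s] x(2) by blast
    then show ?thesis using dim_fkernel_slice[OF slice_chart_at[OF s p(1)]] p(2) by simp
  qed
  show ?thesis
    using fkernel_lipschitz[OF sf is_chart_open(2)[OF ic] c(4) x0 dim] that by metis
qed

end

section \<open>Integral manifolds of the kernel\<close>

lemma restrict_chart_maximal:
  fixes A :: "('p::topological_space, 'e::euclidean_space) chart set"
  assumes A: "smooth_atlas A" and c: "c \<in> maximal_atlas A" and S: "open S"
  shows "(fst c \<inter> S, snd c) \<in> maximal_atlas A"
proof -
  let ?c = "(fst c \<inter> S, snd c)"
  have ic: "is_chart c" using c maximal_atlas_is_chart by blast
  have oS: "open (fst c \<inter> S)" using is_chart_open(1)[OF ic] S by blast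
  have inv: "chart_inv ?c (snd c p) = p" if "p \<in> fst c \<inter> S" for p
  proof -
    have "inj_on (snd c) (fst c \<inter> S)"
      using chart_inv_left[OF ic] by (metis IntD1 inj_onI)
    then show ?thesis using that by (simp add: inv_into_f_f)
  qed
  have "homeomorphism (fst c \<inter> S) (snd c ` (fst c \<inter> S)) (snd c) (chart_inv c)"
    unfolding homeomorphism_def
    using chart_inv_left[OF ic] is_chart_continuous[OF ic]
    by (auto intro: continuous_on_subset simp: image_iff)
  then have ic': "is_chart ?c" unfolding is_chart_def
    using oS chart_image_open[OF ic oS] by auto
  have "smooth_transition ?c d \<and> smooth_transition d ?c" if d: "d \<in> A" for d
  proof
    have dm: "d \<in> maximal_atlas A" and id: "is_chart d"
      using d atlas_subset_maximal[OF A] maximal_atlas_is_chart by blast+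
    let ?X = "fst c \<inter> S \<inter> fst d"
    have oX: "open ?X" using oS is_chart_open(1)[OF id] by blast
    have oX1: "open (snd c ` ?X)" by (rule chart_image_open[OF ic oX]) blast
    have "smooth_on (snd c ` ?X) (snd d \<circ> chart_inv c)"
      by (rule smooth_on_subset[OF maximal_atlas_transition[OF A c dm]]) blast
    then show "smooth_transition ?c d"
      unfolding smooth_transition_def fst_conv snd_conv
      by (subst smooth_on_cong[OF oX1, of _ "snd d \<circ> chart_inv c"])
        (use inv chart_inv_left[OF ic] in auto)
    show "smooth_transition d ?c"
      unfolding smooth_transition_def fst_conv snd_conv
      by (rule smooth_on_subset[OF maximal_atlas_transition[OF A dm c]]) blast
  qed
  then show ?thesis using ic' unfolding maximal_atlas_def by blast
qed

lemma slice_chart_restrict: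
  assumes A: "smooth_atlas A" and s: "slice_chart A N c L z" and S: "open S" "z \<in> S"
  shows "slice_chart A (N \<inter> S) (fst c \<inter> S, snd c) L z"
proof -
  have c: "c \<in> maximal_atlas A" "subspace L" "z \<in> fst c" "z \<in> N" using s unfolding slice_chart_def by blast+
  have "snd c ` (fst c \<inter> S \<inter> (N \<inter> S)) = snd c ` (fst c \<inter> S) \<inter> L"
    using slice_chart_iff[OF s] by auto
  then show ?thesis using c S restrict_chart_maximal[OF A c(1) S(1)] unfolding slice_chart_def by simp
qed

lemma submanifold_iff_slice:
  "submanifold A j N \<longleftrightarrow> (\<forall>z\<in>N. \<exists>c L. slice_chart A N c L z \<and> dim L = j)"
  unfolding submanifold_def slice_chart_def by (metis (no_types, lifting))

context presymplectic_submanifold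
begin

abbreviation "integral_mfd \<equiv> integral_manifold A M K"

lemma integral_slice:
  assumes "integral_mfd N" "z \<in> N"
  obtains d L where "slice_chart A N d L z"
  using assms submanifold_iff_slice unfolding integral_manifold_def by metis

lemma integral_subset: "integral_mfd N \<Longrightarrow> N \<subseteq> M"
  unfolding integral_manifold_def by blast

lemma integral_kernel: "integral_mfd N \<Longrightarrow> z \<in> N \<Longrightarrow> tangent_space A N z = K z"
  unfolding integral_manifold_def by blast

lemma integral_Int_open:
  assumes N: "integral_mfd N" and S: "open S"
  shows "integral_mfd (N \<inter> S)"
  unfolding integral_manifold_def
proof (intro conjI ballI)
  show "N \<inter> S \<subseteq> M" using integral_subset[OF N] by blast
  obtain j where j: "submanifold A j N" using N unfolding integral_manifold_def by blast
  have "submanifold A j (N \<inter> S)"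
    unfolding submanifold_iff_slice
  proof
    fix z assume z: "z \<in> N \<inter> S"
    then obtain c L where "slice_chart A N c L z" "dim L = j"
      using j unfolding submanifold_iff_slice by blast
    then show "\<exists>c L. slice_chart A (N \<inter> S) c L z \<and> dim L = j"
      using slice_chart_restrict[OF atlas _ S] z by blast
  qed
  then show "\<exists>j. submanifold A j (N \<inter> S)" by blast
  fix z assume z: "z \<in> N \<inter> S"
  then obtain c L where s: "slice_chart A N c L z" using integral_slice[OF N] by blast
  have s': "slice_chart A (N \<inter> S) (fst c \<inter> S, snd c) L z"
    using slice_chart_restrict[OF atlas s S] z by blast
  \<comment> \<open>\<open>tcoord\<close> depends on a chart only through its coordinate map; the
    restricted chart keeps this map and the subspace \<open>L\<close>.\<close>
  have "tangent_space A (N \<inter> S) z = tangent_space A N z"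
    using tangent_space_slice[OF atlas s] tangent_space_slice[OF atlas s'] unfolding tcoord_def by auto
  then show "tangent_space A (N \<inter> S) z = K z" using integral_kernel[OF N] z by blast
qed

section \<open>Plaques and local uniqueness of integral manifolds\<close>

text \<open>Curves of bounded speed tangent to the kernel, in coordinates; both applications of
  Gronwall's inequality on leaves run along them.\<close>

definition kernel_curve :: "('p, 'e) chart \<Rightarrow> 'e set \<Rightarrow> 'e set \<Rightarrow> real \<Rightarrow> 'e \<Rightarrow> 'e \<Rightarrow> bool" where
  "kernel_curve c L X D x y \<longleftrightarrow> (\<exists>\<gamma> \<gamma>'. \<gamma> 0 = x \<and> \<gamma> 1 = y \<and>
       (\<forall>t\<in>{0..1}. \<gamma> t \<in> X \<inter> L \<and> (\<gamma> has_vector_derivative \<gamma>' t) (at t) \<and>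
          \<gamma>' t \<in> fkernel L (\<Omega> c) (\<gamma> t) \<and> norm (\<gamma>' t) \<le> D))"

text \<open>In slice coordinates a small piece of \<open>N\<close> is the intersection of a ball and
  a subspace, hence convex. Its segments, carried to the chart \<open>c\<close> of \<open>M\<close>
  by the transition map \<sigma>, are tangent to the kernel because the tangent spaces of
  \<open>N\<close> are the kernels.\<close>

lemma plaque_curves:
  assumes N: "integral_mfd N" "z0 \<in> N" and s: "slice_chart A M c L z0"
    and r: "r > 0" "ball (snd c z0) r \<subseteq> snd c ` fst c" and S: "open S" "z0 \<in> S"
  obtains U D where "open U" "z0 \<in> U" "U \<subseteq> S" "U \<subseteq> fst c" "connected (N \<inter> U)"
    "\<And>w w'. w \<in> N \<inter> U \<Longrightarrow> w' \<in> N \<inter> U \<Longrightarrow> kernel_curve c L (ball (snd c z0) r) D (snd c w) (snd c w')"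
proof -
  have c: "c \<in> maximal_atlas A" "subspace L" "z0 \<in> fst c" "z0 \<in> M" using s unfolding slice_chart_def by blast+
  have ic: "is_chart c" using c maximal_atlas_is_chart by blast
  obtain d L1 where sd: "slice_chart A N d L1 z0" using integral_slice[OF N] by blast
  have d: "d \<in> maximal_atlas A" "subspace L1" "z0 \<in> fst d" using sd unfolding slice_chart_def by blast+
  have id: "is_chart d" using d maximal_atlas_is_chart by blast
  define \<sigma> where "\<sigma> = snd c \<circ> chart_inv d"
  define Y where "Y = snd d ` (fst d \<inter> fst c)"
  have s\<sigma>: "smooth_on Y \<sigma>" unfolding Y_def \<sigma>_def by (rule maximal_atlas_transition[OF atlas d(1) c(1)])
  have oY: "open Y" unfolding Y_def
    by (rule chart_image_open[OF id open_Int[OF is_chart_open(1)[OF id] is_chart_open(1)[OF ic]]]) blast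
  define y0 where "y0 = snd d z0"
  define Y1 where "Y1 = snd d ` (fst d \<inter> fst c \<inter> S)"
  have oY1: "open Y1" unfolding Y1_def
    by (rule chart_image_open[OF id open_Int[OF open_Int[OF is_chart_open(1)[OF id] is_chart_open(1)[OF ic]] S(1)]]) blast
  \<comment> \<open>Points whose image in the chart \<open>c\<close> stays in the prescribed ball
    and which come from \<open>S\<close>.\<close>
  define R where "R = Y \<inter> \<sigma> -` ball (snd c z0) r \<inter> Y1"
  have oR: "open R" unfolding R_def
    using continuous_open_preimage[OF smooth_on_imp_continuous_on[OF s\<sigma>] oY open_ball] oY1 by blast
  have \<sigma>d: "\<sigma> (snd d p) = snd c p" if "p \<in> fst d" for p unfolding \<sigma>_def using chart_inv_left[OF id that] by simp
  have y0R: "y0 \<in> R" using c d S r(1) \<sigma>d unfolding R_def Y_def Y1_def y0_def by auto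
  have sR: "smooth_on R \<sigma>" by (rule smooth_on_subset[OF s\<sigma>]) (simp add: R_def Int_assoc)
  obtain \<rho> C where \<rho>: "\<rho> > 0" "C > 0" "ball y0 \<rho> \<subseteq> R"
    "\<And>x v. x \<in> ball y0 \<rho> \<Longrightarrow> norm (frechet_derivative \<sigma> (at x) v) \<le> C * norm v"
    using smooth_on_locally_bounded_derivative[OF sR oR y0R] by metis
  define U where "U = fst d \<inter> snd d -` ball y0 \<rho>"
  have oU: "open U" unfolding U_def
    by (rule continuous_open_preimage[OF is_chart_continuous(1)[OF id] is_chart_open(1)[OF id] open_ball])
  have z0U: "z0 \<in> U" unfolding U_def y0_def using d \<rho> by simp
  have injd: "p = q" if "p \<in> fst d" "q \<in> fst d" "snd d p = snd d q" for p q
    using that chart_inv_left[OF id] by metis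
  have UcS: "p \<in> fst c \<and> p \<in> S" if "p \<in> U" for p
  proof -
    have "snd d p \<in> Y1" using that \<rho>(3) unfolding U_def R_def by blast
    then obtain q where "q \<in> fst d \<inter> fst c \<inter> S" "snd d p = snd d q" unfolding Y1_def by blast
    then show ?thesis using injd that unfolding U_def by (metis IntD1 IntD2)
  qed
  have chart_ball: "chart_inv d y \<in> U \<and> snd d (chart_inv d y) = y" if "y \<in> ball y0 \<rho>" for y
  proof -
    have "y \<in> snd d ` fst d" using that \<rho>(3) unfolding R_def Y_def by blast
    then show ?thesis using chart_inv_in[of y d] chart_inv_right[of y d] that unfolding U_def by simp
  qed
  have NU: "N \<inter> U = chart_inv d ` (ball y0 \<rho> \<inter> L1)"
  proof
    show "N \<inter> U \<subseteq> chart_inv d ` (ball y0 \<rho> \<inter> L1)"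
    proof
      fix p assume p: "p \<in> N \<inter> U"
      then have "snd d p \<in> ball y0 \<rho> \<inter> L1" "p = chart_inv d (snd d p)"
        using slice_chart_iff[OF sd, of p] chart_inv_left[OF id, of p] unfolding U_def by auto
      then show "p \<in> chart_inv d ` (ball y0 \<rho> \<inter> L1)" by blast
    qed
    show "chart_inv d ` (ball y0 \<rho> \<inter> L1) \<subseteq> N \<inter> U"
    proof
      fix p assume "p \<in> chart_inv d ` (ball y0 \<rho> \<inter> L1)"
      then obtain y where y: "y \<in> ball y0 \<rho>" "y \<in> L1" "p = chart_inv d y" by blast
      then have "p \<in> U" "snd d p = y" using chart_ball by blast+
      then show "p \<in> N \<inter> U" using slice_chart_iff[OF sd, of p] y(2) unfolding U_def by blast
    qed
  qed
  have "connected (ball y0 \<rho> \<inter> L1)"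
    by (rule convex_connected[OF convex_Int[OF convex_ball subspace_imp_convex[OF d(2)]]])
  moreover have "continuous_on (ball y0 \<rho> \<inter> L1) (chart_inv d)"
    by (rule continuous_on_subset[OF is_chart_continuous(2)[OF id]]) (use \<rho>(3) in \<open>auto simp: R_def Y_def\<close>)
  ultimately have conn: "connected (N \<inter> U)" unfolding NU by (rule connected_continuous_image[rotated])
  \<comment> \<open>\<open>C\<close> bounds the derivative of \<sigma> and \<open>2 * \<rho>\<close>
    the length of a segment in the ball of radius \<rho>.\<close>
  have curves: "kernel_curve c L (ball (snd c z0) r) (C * (2 * \<rho>)) (snd c w) (snd c w')"
    if w: "w \<in> N \<inter> U" and w': "w' \<in> N \<inter> U" for w w'
  proof -
    define b where "b = snd d w' - snd d w"
    define l where "l t = snd d w + t *\<^sub>R b" for t :: real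
    have dw: "snd d w \<in> ball y0 \<rho> \<inter> L1" "snd d w' \<in> ball y0 \<rho> \<inter> L1" "w \<in> fst d" "w' \<in> fst d"
      using w w' slice_chart_iff[OF sd] unfolding U_def by auto
    have bL: "b \<in> L1" unfolding b_def using dw subspace_diff[OF d(2)] by blast
    have nb: "norm b \<le> 2 * \<rho>"
    proof -
      have "norm b \<le> dist y0 (snd d w') + dist y0 (snd d w)"
        unfolding b_def by (metis dist_norm dist_triangle2 dist_commute)
      then show ?thesis using dw by simp
    qed
    have lin: "l t \<in> ball y0 \<rho> \<inter> L1" if "t \<in> {0..1}" for t
    proof -
      have "l t = (1 - t) *\<^sub>R snd d w + t *\<^sub>R snd d w'" unfolding l_def b_def by (simp add: algebra_simps)
      moreover have "convex (ball y0 \<rho> \<inter> L1)" by (rule convex_Int[OF convex_ball subspace_imp_convex[OF d(2)]])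
      ultimately show ?thesis using dw that by (simp add: convex_alt)
    qed
    have *: "\<sigma> (l t) \<in> ball (snd c z0) r \<inter> L \<and> ((\<lambda>t. \<sigma> (l t)) has_vector_derivative frechet_derivative \<sigma> (at (l t)) b) (at t) \<and>
          frechet_derivative \<sigma> (at (l t)) b \<in> fkernel L (\<Omega> c) (\<sigma> (l t)) \<and> norm (frechet_derivative \<sigma> (at (l t)) b) \<le> C * (2 * \<rho>)"
      if t: "t \<in> {0..1}" for t
    proof (intro conjI)
      let ?p = "chart_inv d (l t)"
      have lt: "l t \<in> ball y0 \<rho>" "l t \<in> L1" using lin[OF t] by auto
      then have p: "?p \<in> N" "?p \<in> U" "snd d ?p = l t" using NU chart_ball by blast+
      have pd: "?p \<in> fst d" using p(2) unfolding U_def by blast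
      have pc: "?p \<in> fst c" using UcS p(2) by blast
      have pM: "?p \<in> M" using p(1) integral_subset[OF N(1)] by blast
      have \<sigma>p: "\<sigma> (l t) = snd c ?p" by (simp add: \<sigma>_def)
      have "\<sigma> (l t) \<in> L" unfolding \<sigma>p using slice_chart_iff[OF s pc] pM by blast
      moreover have "\<sigma> (l t) \<in> ball (snd c z0) r" using lt(1) \<rho>(3) unfolding R_def by blast
      ultimately show "\<sigma> (l t) \<in> ball (snd c z0) r \<inter> L" by blast
      have "(l has_vector_derivative b) (at t)" unfolding l_def by (auto intro!: derivative_eq_intros)
      then show "((\<lambda>t. \<sigma> (l t)) has_vector_derivative frechet_derivative \<sigma> (at (l t)) b) (at t)"
        by (rule has_vector_derivative_smooth_compose[OF _ sR]) (use lt \<rho>(3) in blast)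
      have D: "frechet_derivative \<sigma> (at (l t)) b = tcoord A c ?p (tcoord_inv A d ?p b)"
        using tcoord_transition[OF atlas d(1) pd c(1) pc, of b] p(3) unfolding \<sigma>_def by simp
      have "tcoord_inv A d ?p b \<in> tangent_space A N ?p"
        using tangent_space_slice[OF atlas slice_chart_at[OF sd pd p(1)]] tcoord_inverse(1)[OF atlas d(1) pd] bL by simp
      then have "tcoord_inv A d ?p b \<in> K ?p" using integral_kernel[OF N(1) p(1)] by simp
      then show "frechet_derivative \<sigma> (at (l t)) b \<in> fkernel L (\<Omega> c) (\<sigma> (l t))"
        unfolding D \<sigma>p using kernel_in_slice_chart[OF slice_chart_at[OF s pc pM]] by blast
      have "norm (frechet_derivative \<sigma> (at (l t)) b) \<le> C * norm b" by (rule \<rho>(4)[OF lt(1)])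
      also have "\<dots> \<le> C * (2 * \<rho>)" using nb \<rho>(2) by simp
      finally show "norm (frechet_derivative \<sigma> (at (l t)) b) \<le> C * (2 * \<rho>)" .
    qed
    have "l 0 = snd d w" "l 1 = snd d w'" unfolding l_def b_def by simp_all
    then have "\<sigma> (l 0) = snd c w" "\<sigma> (l 1) = snd c w'" using \<sigma>d dw by simp_all
    then show ?thesis unfolding kernel_curve_def
      by (intro exI[of _ "\<lambda>t. \<sigma> (l t)"] exI[of _ "\<lambda>t. frechet_derivative \<sigma> (at (l t)) b"] conjI ballI[OF *])
  qed
  have US: "U \<subseteq> S" "U \<subseteq> fst c" using UcS by blast+
  show ?thesis by (rule that[OF oU z0U US conn curves])
qed

text \<open>Uniqueness of integral manifolds: along a curve in \<open>N1\<close>, the coordinates \<open>G\<close> transversal to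
  \<open>N2\<close> satisfy a linear differential inequality.\<close>

lemma integral_Int_relatively_open:
  assumes N1: "integral_mfd N1" "z0 \<in> N1" and N2: "integral_mfd N2" "z0 \<in> N2"
  obtains U where "open U" "z0 \<in> U" "N1 \<inter> U \<subseteq> N2"
proof -
  have z0M: "z0 \<in> M" using N1 integral_subset by blast
  obtain c L where s: "slice_chart A M c L z0" using submanifold_slice[OF submanifold z0M] by metis
  have c: "c \<in> maximal_atlas A" "subspace L" "z0 \<in> fst c" using s unfolding slice_chart_def by blast+
  have ic: "is_chart c" using c maximal_atlas_is_chart by blast
  obtain d L2 where sd: "slice_chart A N2 d L2 z0" using integral_slice[OF N2] by blast
  have d: "d \<in> maximal_atlas A" "subspace L2" "z0 \<in> fst d" using sd unfolding slice_chart_def by blast+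
  have id: "is_chart d" using d maximal_atlas_is_chart by blast
  obtain \<pi> :: "'e \<Rightarrow> 'e" where \<pi>: "bounded_linear \<pi>" "\<And>w. \<pi> w \<in> L2" "\<And>w. w \<in> L2 \<Longrightarrow> \<pi> w = w"
    using subspace_projection_exists[OF d(2)] by metis
  have cd: "open (fst c \<inter> fst d)" using is_chart_open(1)[OF ic] is_chart_open(1)[OF id] by blast
  define \<tau> where "\<tau> = snd d \<circ> chart_inv c"
  define \<sigma> where "\<sigma> = snd c \<circ> chart_inv d"
  define X where "X = snd c ` (fst c \<inter> fst d)"
  define Y where "Y = snd d ` (fst d \<inter> fst c)"
  have s\<tau>: "smooth_on X \<tau>" unfolding X_def \<tau>_def by (rule maximal_atlas_transition[OF atlas c(1) d(1)])
  have s\<sigma>: "smooth_on Y \<sigma>" unfolding Y_def \<sigma>_def by (rule maximal_atlas_transition[OF atlas d(1) c(1)])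
  have oX: "open X" unfolding X_def by (rule chart_image_open[OF ic cd]) blast
  have oY: "open Y" unfolding Y_def by (rule chart_image_open[OF id]) (use cd in \<open>auto simp: Int_commute\<close>)
  have \<tau>c: "\<tau> (snd c p) = snd d p" if "p \<in> fst c" for p unfolding \<tau>_def using chart_inv_left[OF ic that] by simp
  have \<sigma>d: "\<sigma> (snd d p) = snd c p" if "p \<in> fst d" for p unfolding \<sigma>_def using chart_inv_left[OF id that] by simp
  define x0 where "x0 = snd c z0"
  define y0 where "y0 = snd d z0"
  have y0: "y0 \<in> Y" "y0 \<in> L2" "\<pi> y0 = y0" using c d N2 slice_chart_iff[OF sd d(3)] \<pi>(3) unfolding Y_def y0_def by auto
  obtain \<rho> C1 where \<rho>: "\<rho> > 0" "C1 > 0" "ball y0 \<rho> \<subseteq> Y"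
    "\<And>x y. x \<in> ball y0 \<rho> \<Longrightarrow> y \<in> ball y0 \<rho> \<Longrightarrow> norm (\<sigma> x - \<sigma> y) \<le> C1 * norm (x - y)"
    using smooth_on_locally_bounded_derivative[OF s\<sigma> oY y0(1)] by metis
  \<comment> \<open>The part of the \<open>d\<close>-coordinates off \<open>L2\<close>; on the
    common chart domain it vanishes exactly on \<open>N2\<close>.\<close>
  define G where "G x = \<tau> x - \<pi> (\<tau> x)" for x
  have bl: "bounded_linear (\<lambda>y. y - \<pi> y)" by (intro bounded_linear_sub bounded_linear_ident \<pi>(1))
  have sG: "smooth_on X G" unfolding G_def[abs_def]
    by (rule smooth_on_compose_linear[OF bl oX s\<tau>])
  have x0X: "x0 \<in> X" unfolding x0_def X_def using c d by blast
  obtain r0 where r0: "r0 > 0" "ball x0 r0 \<subseteq> X"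
    and growth: "\<And>Z \<K> C C1. lipschitz_distribution C Z \<K> \<Longrightarrow> C > 0 \<Longrightarrow> C1 > 0 \<Longrightarrow>
       \<exists>E. \<forall>x\<in>ball x0 r0 \<inter> Z. \<forall>p\<in>ball x0 r0 \<inter> Z. norm (x - p) \<le> C1 * norm (G x) \<longrightarrow>
         (\<forall>e\<in>\<K> p. frechet_derivative G (at p) e = 0) \<longrightarrow>
         (\<forall>v\<in>\<K> x. norm (frechet_derivative G (at x) v) \<le> E * norm (G x) * norm v)"
    using transversal_growth_bound[OF sG oX x0X] by metis
  obtain r1 C where r1: "r1 > 0" "C > 0" "ball x0 r1 \<subseteq> snd c ` fst c"
    "lipschitz_distribution C (ball x0 r1 \<inter> L) (fkernel L (\<Omega> c))"
    using kernel_lipschitz_in_slice[OF s] unfolding x0_def by metis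
  obtain E where E: "\<And>x p v. x \<in> ball x0 r0 \<inter> (ball x0 r1 \<inter> L) \<Longrightarrow> p \<in> ball x0 r0 \<inter> (ball x0 r1 \<inter> L) \<Longrightarrow>
      norm (x - p) \<le> C1 * norm (G x) \<Longrightarrow> (\<forall>e\<in>fkernel L (\<Omega> c) p. frechet_derivative G (at p) e = 0) \<Longrightarrow>
      v \<in> fkernel L (\<Omega> c) x \<Longrightarrow> norm (frechet_derivative G (at x) v) \<le> E * norm (G x) * norm v"
    using growth[OF r1(4,2) \<rho>(2)] by blast
  \<comment> \<open>On \<open>R\<close> the point \<open>\<sigma> (\<pi> (\<tau> x))\<close>,
    obtained by projecting the \<open>d\<close>-coordinates of \<open>x\<close> onto the slice
    \<open>L2\<close>, is defined and stays in the balls where all estimates hold.\<close>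
  define R where "R = X \<inter> \<tau> -` (ball y0 \<rho> \<inter> \<pi> -` (ball y0 \<rho> \<inter> (Y \<inter> \<sigma> -` ball x0 (min r0 r1))))"
  have \<tau>x0: "\<tau> x0 = y0" and \<sigma>y0: "\<sigma> y0 = x0" unfolding x0_def y0_def using \<tau>c \<sigma>d c d by blast+
  have o1: "open (Y \<inter> \<sigma> -` ball x0 (min r0 r1))"
    by (rule continuous_open_preimage[OF smooth_on_imp_continuous_on[OF s\<sigma>] oY open_ball])
  have cont\<pi>: "continuous_on UNIV \<pi>" using \<pi>(1) by (simp add: linear_continuous_on)
  have o2: "open (ball y0 \<rho> \<inter> \<pi> -` (ball y0 \<rho> \<inter> (Y \<inter> \<sigma> -` ball x0 (min r0 r1))))"
    using o1 open_vimage[OF open_Int[OF open_ball o1] cont\<pi>] by blast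
  have oR: "open R" unfolding R_def
    by (rule continuous_open_preimage[OF smooth_on_imp_continuous_on[OF s\<tau>] oX o2])
  have x0R: "x0 \<in> R" unfolding R_def using x0X \<tau>x0 y0 \<sigma>y0 \<rho>(1) r0(1) r1(1) by simp
  obtain r2 where r2: "r2 > 0" "ball x0 r2 \<subseteq> R" using oR x0R open_contains_ball by blast
  define r where "r = min r2 (min r0 r1)"
  have r: "r > 0" "ball (snd c z0) r \<subseteq> snd c ` fst c" using r2 r0 r1 unfolding r_def x0_def by auto
  \<comment> \<open>The projected point lies on \<open>N2\<close>, where the kernel is tangent to
    \<open>N2\<close>, so the derivative of \<open>G\<close> annihilates it there. Its distance from
    \<open>x\<close> is at most \<open>C1 * norm (G x)\<close>, since \<open>\<tau> x\<close> and
    its projection differ by \<open>G x\<close> and \<sigma> is Lipschitz.\<close>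
  have bound: "norm (frechet_derivative G (at x) v) \<le> E * norm (G x) * norm v"
    if x: "x \<in> ball x0 r \<inter> L" and v: "v \<in> fkernel L (\<Omega> c) x" for x v
  proof (rule E[where p = "\<sigma> (\<pi> (\<tau> x))"])
    let ?y = "\<pi> (\<tau> x)"
    let ?q = "chart_inv d ?y"
    have xR: "x \<in> R" using x r2 by (auto simp: r_def)
    then have xX: "x \<in> X" and y: "\<tau> x \<in> ball y0 \<rho>" "?y \<in> ball y0 \<rho>" "?y \<in> Y" "\<sigma> ?y \<in> ball x0 (min r0 r1)"
      unfolding R_def by auto
    obtain p where p: "p \<in> fst c" "p \<in> fst d" "x = snd c p" using xX unfolding X_def by blast
    have "\<sigma> (\<tau> x) = x" unfolding p(3) \<tau>c[OF p(1)] \<sigma>d[OF p(2)] ..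
    then show "norm (x - \<sigma> ?y) \<le> C1 * norm (G x)" using \<rho>(4)[OF y(1,2)] unfolding G_def by simp
    obtain q where q: "q \<in> fst d" "q \<in> fst c" "?y = snd d q" using y(3) unfolding Y_def by blast
    have qN: "q \<in> N2" using slice_chart_iff[OF sd q(1)] q(3) \<pi>(2) by metis
    then have qM: "q \<in> M" using integral_subset[OF N2(1)] by blast
    have \<sigma>q: "\<sigma> ?y = snd c q" unfolding q(3) by (rule \<sigma>d[OF q(1)])
    have "\<sigma> ?y \<in> L" unfolding \<sigma>q using slice_chart_iff[OF s q(2)] qM by blast
    then show "\<sigma> ?y \<in> ball x0 r0 \<inter> (ball x0 r1 \<inter> L)" using y(4) by simp
    show "x \<in> ball x0 r0 \<inter> (ball x0 r1 \<inter> L)" using x by (simp add: r_def)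
    show "\<forall>e\<in>fkernel L (\<Omega> c) (\<sigma> ?y). frechet_derivative G (at (\<sigma> ?y)) e = 0"
    proof
      fix e assume e: "e \<in> fkernel L (\<Omega> c) (\<sigma> ?y)"
      let ?u = "tcoord_inv A c q e"
      have "?u \<in> K q" using e kernel_in_slice_chart[OF slice_chart_at[OF s q(2) qM]]
        tcoord_inverse(1)[OF atlas c(1) q(2)] unfolding \<sigma>q by simp
      then have "tcoord A d q ?u \<in> L2"
        using integral_kernel[OF N2(1) qN] tangent_space_slice[OF atlas slice_chart_at[OF sd q(1) qN]] by simp
      then have L2: "frechet_derivative \<tau> (at (snd c q)) e \<in> L2"
        using tcoord_transition[OF atlas c(1) q(2) d(1) q(1), of e] unfolding \<tau>_def by simp
      have "snd c q \<in> X" unfolding X_def using q by blast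
      from bounded_linear.has_derivative[OF bl smooth_on_has_derivative[OF s\<tau> this]]
      have "frechet_derivative G (at (snd c q)) =
         (\<lambda>w. frechet_derivative \<tau> (at (snd c q)) w - \<pi> (frechet_derivative \<tau> (at (snd c q)) w))"
        unfolding G_def[abs_def] using frechet_derivative_at by metis
      then show "frechet_derivative G (at (\<sigma> ?y)) e = 0" unfolding \<sigma>q using L2 \<pi>(3) by simp
    qed
    show "v \<in> fkernel L (\<Omega> c) x" by (rule v)
  qed
  obtain U D where U: "open U" "z0 \<in> U" "U \<subseteq> fst d" "U \<subseteq> fst c"
    and curves: "\<And>w w'. w \<in> N1 \<inter> U \<Longrightarrow> w' \<in> N1 \<inter> U \<Longrightarrow> kernel_curve c L (ball (snd c z0) r) D (snd c w) (snd c w')"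
    by (rule plaque_curves[OF N1 s r is_chart_open(1)[OF id] d(3)]) (rule that)
  have "w \<in> N2" if w: "w \<in> N1 \<inter> U" for w
  proof -
    have "z0 \<in> N1 \<inter> U" using N1 U by blast
    from curves[OF this w, unfolded kernel_curve_def] obtain \<gamma> \<gamma>' where
      "\<gamma> 0 = snd c z0 \<and> \<gamma> 1 = snd c w \<and>
       (\<forall>t\<in>{0..1}. \<gamma> t \<in> ball (snd c z0) r \<inter> L \<and> (\<gamma> has_vector_derivative \<gamma>' t) (at t) \<and>
          \<gamma>' t \<in> fkernel L (\<Omega> c) (\<gamma> t) \<and> norm (\<gamma>' t) \<le> D)" by (elim exE)
    then have \<gamma>: "\<gamma> 0 = snd c z0" "\<gamma> 1 = snd c w"
       "\<And>t. t \<in> {0..1::real} \<Longrightarrow> \<gamma> t \<in> ball x0 r \<inter> L" "\<And>t. t \<in> {0..1} \<Longrightarrow> (\<gamma> has_vector_derivative \<gamma>' t) (at t)"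
       "\<And>t. t \<in> {0..1} \<Longrightarrow> \<gamma>' t \<in> fkernel L (\<Omega> c) (\<gamma> t)" "\<And>t. t \<in> {0..1} \<Longrightarrow> norm (\<gamma>' t) \<le> D"
      unfolding x0_def by simp_all
    have "G (\<gamma> 1) = 0"
    proof (rule gronwall_zero_vector[where g = "\<lambda>t. G (\<gamma> t)" and g' = "\<lambda>t. frechet_derivative G (at (\<gamma> t)) (\<gamma>' t)" and C = "\<bar>E\<bar> * D"])
      fix t :: real assume t: "t \<in> {0..1}"
      have "\<gamma> t \<in> X" using \<gamma>(3)[OF t] r0(2) by (auto simp: r_def)
      then show "((\<lambda>t. G (\<gamma> t)) has_vector_derivative frechet_derivative G (at (\<gamma> t)) (\<gamma>' t)) (at t)"
        by (rule has_vector_derivative_smooth_compose[OF \<gamma>(4)[OF t] sG])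
      have "norm (frechet_derivative G (at (\<gamma> t)) (\<gamma>' t)) \<le> E * norm (G (\<gamma> t)) * norm (\<gamma>' t)"
        by (rule bound[OF \<gamma>(3)[OF t] \<gamma>(5)[OF t]])
      also have "\<dots> \<le> \<bar>E\<bar> * norm (G (\<gamma> t)) * norm (\<gamma>' t)"
        by (intro mult_right_mono) auto
      also have "\<dots> \<le> \<bar>E\<bar> * norm (G (\<gamma> t)) * D" using \<gamma>(6)[OF t] by (intro mult_left_mono) auto
      finally show "norm (frechet_derivative G (at (\<gamma> t)) (\<gamma>' t)) \<le> \<bar>E\<bar> * D * norm (G (\<gamma> t))"
        by (simp add: algebra_simps)
    next
      show "G (\<gamma> 0) = 0" unfolding \<gamma>(1) G_def using \<tau>x0 y0 unfolding x0_def by simp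
    qed simp
    then have "\<tau> (\<gamma> 1) \<in> L2" unfolding G_def using \<pi>(2) by (metis eq_iff_diff_eq_0)
    then have "snd d w \<in> L2" unfolding \<gamma>(2) using \<tau>c w U by auto
    then show ?thesis using slice_chart_iff[OF sd] w U by blast
  qed
  then have "N1 \<inter> U \<subseteq> N2" by blast
  then show ?thesis by (rule that[OF U(1,2)])
qed

end

section \<open>The leaf topology\<close>

text \<open>If no point of \<open>S\<close> were an accumulation point, each would be isolated in
  \<open>S\<close> by a set of a countable basis, and distinct points by distinct sets.\<close>

lemma uncountable_imp_islimpt:
  fixes S :: "'a::second_countable_topology set"
  assumes "uncountable S"
  obtains t where "t \<in> S" "t islimpt S"
proof (rule ccontr)
  assume none: "\<not> thesis"
  have no: "\<not> t islimpt S" if "t \<in> S" for t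
    using none \<open>\<And>t. \<lbrakk>t \<in> S; t islimpt S\<rbrakk> \<Longrightarrow> thesis\<close>[OF that] by blast
  obtain B :: "'a set set" where B: "countable B" "topological_basis B"
    using ex_countable_basis by blast
  have "\<exists>U\<in>B. U \<inter> S = {t}" if t: "t \<in> S" for t
  proof -
    obtain V where V: "t \<in> V" "open V" "\<forall>y\<in>S. y \<in> V \<longrightarrow> y = t"
      using no[OF t] unfolding islimpt_def by blast
    obtain U where "U \<in> B" "t \<in> U" "U \<subseteq> V" by (rule topological_basisE[OF B(2) V(2,1)]) (rule that)
    then show ?thesis using V t by blast
  qed
  then have "\<exists>f. \<forall>t\<in>S. f t \<in> B \<and> f t \<inter> S = {t}" by (intro bchoice ballI) (auto simp: Bex_def)
  then obtain f where f: "\<And>t. t \<in> S \<Longrightarrow> f t \<in> B \<and> f t \<inter> S = {t}" by auto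
  have "inj_on f S"
  proof (rule inj_onI)
    fix s t assume st: "s \<in> S" "t \<in> S" "f s = f t"
    have "{s} = f s \<inter> S" using f[OF st(1)] by (elim conjE) (rule sym)
    also have "\<dots> = {t}" unfolding st(3) using f[OF st(2)] by (elim conjE)
    finally show "s = t" by simp
  qed
  moreover have "f ` S \<subseteq> B" using f by blast
  ultimately have "countable S" by (intro countable_image_inj_on[OF countable_subset[OF _ B(1)]])
  then show False using assms by blast
qed

context presymplectic_submanifold
begin

section \<open>The leaf topology compared with the topology of the manifold\<close>

abbreviation "leaf_top \<equiv> leaf_topology A M K"

lemma openin_integral: "integral_mfd N \<Longrightarrow> openin leaf_top N"
  unfolding leaf_topology_def by (rule topology_generated_by_Basis) simp

lemma topspace_leaf_top: "topspace leaf_top = \<Union>{N. integral_mfd N}"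
  unfolding leaf_topology_def by (rule topology_generated_by_topspace)

text \<open>On an integral manifold the leaf topology is no finer than the subspace topology. By
  induction over the generation of leaf-open sets; for a generating set this is the local uniqueness
  of integral manifolds.\<close>

lemma leaf_open_relatively_open:
  assumes "openin leaf_top X" "integral_mfd N" "z \<in> X" "z \<in> N"
  shows "\<exists>U. open U \<and> z \<in> U \<and> N \<inter> U \<subseteq> X"
proof -
  have "generate_topology_on {N. integral_mfd N} X"
    using assms(1) unfolding leaf_topology_def by (rule openin_topology_generated_by)
  then show ?thesis using assms(3)
  proof (induction X rule: generate_topology_on.induct)
    case Empty
    then show ?case by simp
  next
    case (Int a b)
    then obtain U V where "open U" "z \<in> U" "N \<inter> U \<subseteq> a" "open V" "z \<in> V" "N \<inter> V \<subseteq> b" by blast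
    then show ?case by (intro exI[of _ "U \<inter> V"]) auto
  next
    case (UN \<X>)
    then obtain X where X: "X \<in> \<X>" "z \<in> X" by blast
    from UN.IH[OF this] obtain U where "open U" "z \<in> U" "N \<inter> U \<subseteq> X" by (elim exE conjE)
    then show ?case using X(1) by (intro exI[of _ U]) auto
  next
    case (Basis N')
    then have N': "integral_mfd N'" "z \<in> N'" by simp_all
    obtain U where "open U" "z \<in> U" "N \<inter> U \<subseteq> N'"
      by (rule integral_Int_relatively_open[OF assms(2,4) N']) (rule that)
    then show ?case by (intro exI[of _ U] conjI)
  qed
qed

text \<open>By the previous comparison the identity is continuous from \<open>N\<close> with the
  subspace topology to the leaf topology, and continuous images of connected sets are
  connected.\<close>

lemma connectedin_integral:
  assumes "integral_mfd N" "S \<subseteq> N" "connected S"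
  shows "connectedin leaf_top S"
proof -
  have "continuous_map (top_of_set N) leaf_top (\<lambda>x. x)"
    unfolding continuous_map_def
  proof (intro conjI allI impI)
    show "(\<lambda>x. x) \<in> topspace (top_of_set N) \<rightarrow> topspace leaf_top"
      using openin_subset[OF openin_integral[OF assms(1)]] by auto
    fix X assume X: "openin leaf_top X"
    have "openin (top_of_set N) (N \<inter> X)"
    proof (subst openin_subopen, rule ballI)
      fix z assume z: "z \<in> N \<inter> X"
      then obtain U where U: "open U" "z \<in> U" "N \<inter> U \<subseteq> X"
        using leaf_open_relatively_open[OF X assms(1), of z] by blast
      show "\<exists>T. openin (top_of_set N) T \<and> z \<in> T \<and> T \<subseteq> N \<inter> X"
        by (rule exI[of _ "N \<inter> U"]) (use z U in \<open>auto simp: openin_open_Int\<close>)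
    qed
    then show "openin (top_of_set N) {x \<in> topspace (top_of_set N). x \<in> X}"
      by (simp add: Int_def)
  qed
  moreover have "connectedin (top_of_set N) S"
    using assms by (simp add: connectedin_subtopology)
  ultimately have "connectedin leaf_top ((\<lambda>x. x) ` S)" by (rule connectedin_continuous_map_image)
  then show ?thesis by simp
qed

lemma openin_leaf_Int_open:
  assumes "open S"
  shows "openin leaf_top (topspace leaf_top \<inter> S)"
proof -
  have "topspace leaf_top \<inter> S = \<Union>{N \<inter> S |N. integral_mfd N}" unfolding topspace_leaf_top by blast
  moreover have "openin leaf_top (\<Union>{N \<inter> S |N. integral_mfd N})"
    by (rule openin_Union) (use openin_integral integral_Int_open[OF _ assms] in blast)
  ultimately show ?thesis by simp
qed

lemma plaque_nbhd:
  assumes "z \<in> topspace leaf_top" "open S" "z \<in> S"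
  obtains Q where "integral_mfd Q" "connected Q" "z \<in> Q" "Q \<subseteq> S"
proof -
  obtain N where N: "integral_mfd N" "z \<in> N" using assms(1) unfolding topspace_leaf_top by blast
  then have zM: "z \<in> M" using integral_subset by blast
  obtain c L where s: "slice_chart A M c L z" using submanifold_slice[OF submanifold zM] by metis
  have c: "is_chart c" "z \<in> fst c" using s maximal_atlas_is_chart unfolding slice_chart_def by blast+
  obtain r where r: "r > 0" "ball (snd c z) r \<subseteq> snd c ` fst c"
    using is_chart_open(2)[OF c(1)] c(2) open_contains_ball by (metis imageI)
  obtain U where "open U" "z \<in> U" "U \<subseteq> S" "connected (N \<inter> U)"
    by (rule plaque_curves[OF N s r assms(2,3)]) (rule that)
  then show ?thesis using that[of "N \<inter> U"] integral_Int_open N by blast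
qed

text \<open>Connected plaques make the leaf topology locally connected, and components of open sets
  of a locally connected space are open.\<close>

lemma component_open:
  assumes "open V"
  shows "openin leaf_top (connected_component_of_set (subtopology leaf_top V) x)"
proof (subst openin_subopen, intro ballI)
  let ?C = "connected_component_of_set (subtopology leaf_top V)"
  fix w assume w: "w \<in> ?C x"
  then have wV: "w \<in> topspace leaf_top" "w \<in> V"
    using connected_component_of_subset_topspace[of "subtopology leaf_top V" x] by auto
  obtain Q where Q: "integral_mfd Q" "connected Q" "w \<in> Q" "Q \<subseteq> V"
    using plaque_nbhd[OF wV(1) assms wV(2)] by metis
  have "connectedin (subtopology leaf_top V) Q"
    using connectedin_integral[OF Q(1) order_refl Q(2)] Q(4) by (simp add: connectedin_subtopology)
  then have "Q \<subseteq> ?C w" using Q(3) connected_component_of_maximal by metis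
  moreover have "?C w = ?C x" using w connected_component_of_equiv[of "subtopology leaf_top V" x w] by auto
  ultimately show "\<exists>T. openin leaf_top T \<and> w \<in> T \<and> T \<subseteq> ?C x"
    using openin_integral[OF Q(1)] Q(3) by blast
qed

text \<open>A small sphere around \<open>z\<close> in the leaf is compact, hence closed in the manifold; the component
  of a neighbourhood that avoids it cannot leave the plaque it bounds.\<close>

lemma small_component_in_integral:
  assumes "z \<in> topspace leaf_top"
  obtains S where "open S" "z \<in> S"
    "\<And>V. z \<in> V \<Longrightarrow> V \<subseteq> S \<Longrightarrow> \<exists>N. integral_mfd N \<and> connected_component_of_set (subtopology leaf_top V) z \<subseteq> N"
proof -
  obtain N where N: "integral_mfd N" "z \<in> N" using assms unfolding topspace_leaf_top by blast
  obtain d L where s: "slice_chart A N d L z" using integral_slice[OF N] by blast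
  have d: "d \<in> maximal_atlas A" "subspace L" "z \<in> fst d" using s unfolding slice_chart_def by blast+
  have id: "is_chart d" using d maximal_atlas_is_chart by blast
  define y0 where "y0 = snd d z"
  have "y0 \<in> snd d ` fst d" unfolding y0_def using d by blast
  then obtain \<rho> where \<rho>: "\<rho> > 0" "cball y0 \<rho> \<subseteq> snd d ` fst d"
    using is_chart_open(2)[OF id] open_contains_cball by blast
  define Nc where "Nc = chart_inv d ` (cball y0 \<rho> \<inter> L)"
  define Sp where "Sp = chart_inv d ` (sphere y0 \<rho> \<inter> L)"
  have cont: "continuous_on (cball y0 \<rho>) (chart_inv d)"
    by (rule continuous_on_subset[OF is_chart_continuous(2)[OF id] \<rho>(2)])
  have cL: "closed L" by (rule closed_subspace[OF d(2)])
  have "compact Nc" unfolding Nc_def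
    by (rule compact_continuous_image[OF continuous_on_subset[OF cont]]) (auto intro: compact_Int_closed cL)
  then have clNc: "closed Nc" by (rule compact_imp_closed)
  have "compact Sp" unfolding Sp_def
    by (rule compact_continuous_image[OF continuous_on_subset[OF cont]]) (auto intro: compact_Int_closed cL)
  then have clSp: "closed Sp" by (rule compact_imp_closed)
  have coord: "chart_inv d y \<in> fst d \<and> snd d (chart_inv d y) = y" if "y \<in> cball y0 \<rho>" for y
  proof -
    have "y \<in> snd d ` fst d" using that \<rho>(2) by blast
    then show ?thesis using chart_inv_in[of y d] chart_inv_right[of y d] by simp
  qed
  have zSp: "z \<notin> Sp"
  proof
    assume "z \<in> Sp"
    then obtain y where y: "y \<in> sphere y0 \<rho>" "z = chart_inv d y" unfolding Sp_def by blast
    then have "y = y0" using coord[of y] unfolding y0_def by (simp add: sphere_def)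
    then show False using y(1) \<rho>(1) by simp
  qed
  define B where "B = fst d \<inter> snd d -` ball y0 \<rho>"
  have oB: "open B" unfolding B_def
    by (rule continuous_open_preimage[OF is_chart_continuous(1)[OF id] is_chart_open(1)[OF id] open_ball])
  have NB: "N \<inter> B \<subseteq> Nc"
  proof
    fix p assume p: "p \<in> N \<inter> B"
    then have "snd d p \<in> cball y0 \<rho> \<inter> L" "p = chart_inv d (snd d p)"
      using slice_chart_iff[OF s, of p] chart_inv_left[OF id, of p] unfolding B_def by auto
    then show "p \<in> Nc" unfolding Nc_def by blast
  qed
  have Nc: "p \<in> N \<inter> B \<or> p \<in> Sp" if "p \<in> Nc" for p
  proof -
    obtain y where y: "y \<in> cball y0 \<rho>" "y \<in> L" "p = chart_inv d y" using \<open>p \<in> Nc\<close> unfolding Nc_def by blast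
    have p: "p \<in> fst d" "snd d p = y" using coord[OF y(1)] y(3) by auto
    then have "p \<in> N" using slice_chart_iff[OF s p(1)] y(2) by blast
    then show ?thesis using y p unfolding Sp_def B_def by (cases "dist y0 y = \<rho>") auto
  qed
  have "\<exists>N. integral_mfd N \<and> connected_component_of_set (subtopology leaf_top V) z \<subseteq> N"
    if V: "z \<in> V" "V \<subseteq> - Sp" for V
  proof -
    let ?C = "connected_component_of_set (subtopology leaf_top V) z"
    have C: "connectedin leaf_top ?C" "?C \<subseteq> V" "?C \<subseteq> topspace leaf_top"
      using connectedin_connected_component_of[of "subtopology leaf_top V" z]
        connected_component_of_subset_topspace[of "subtopology leaf_top V" z]
      by (auto simp: connectedin_subtopology)
    have "z \<in> topspace (subtopology leaf_top V)" using assms V(1) by simp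
    then have zC: "z \<in> ?C" by (simp add: connected_component_of_refl)
    have o1: "openin leaf_top (N \<inter> B)" by (rule openin_integral[OF integral_Int_open[OF N(1) oB]])
    have o2: "openin leaf_top (topspace leaf_top \<inter> - Nc)"
      by (rule openin_leaf_Int_open) (use clNc in \<open>simp add: open_Compl\<close>)
    \<comment> \<open>Away from the bounding sphere, the open plaque and the complement of the
      closed plaque cover everything; both are leaf-open and they are disjoint, so the connected set
      \<open>?C\<close> lies in the one that contains \<open>z\<close>.\<close>
    have "?C \<subseteq> N \<inter> B \<union> (topspace leaf_top \<inter> - Nc)"
      using C(2,3) V(2) Nc by blast
    moreover have "N \<inter> B \<inter> (topspace leaf_top \<inter> - Nc) \<inter> ?C = {}" using NB by blast
    moreover have "N \<inter> B \<inter> ?C \<noteq> {}" using zC N d \<rho>(1) unfolding B_def y0_def by auto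
    ultimately have "topspace leaf_top \<inter> - Nc \<inter> ?C = {}"
      using connectedinD[OF C(1) o1 o2] by blast
    then have "?C \<subseteq> N" using C(2,3) V(2) Nc by blast
    then show ?thesis using N(1) by blast
  qed
  moreover have "open (- Sp)" using clSp by (simp add: open_Compl)
  ultimately show ?thesis using that[of "- Sp"] zSp by blast
qed

text \<open>The argument of the Poincare-Volterra theorem.\<close>

lemma connectedin_countable_cover:
  assumes F: "connectedin leaf_top F" "y \<in> F"
  obtains \<N> where "countable \<N>" "\<And>N. N \<in> \<N> \<Longrightarrow> integral_mfd N" "F \<subseteq> \<Union>\<N>"
proof -
  obtain \<B> :: "'p set set" where \<B>: "countable \<B>" "topological_basis \<B>"
    using ex_countable_basis by blast
  let ?C = "\<lambda>V. connected_component_of_set (subtopology leaf_top V)"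
  \<comment> \<open>Leaf components of basic open sets of the manifold, as far as they fit into a
    single integral manifold. They cover the leaf topology although they are indexed by uncountably
    many points.\<close>
  define \<U> where "\<U> = {?C V x |V x. V \<in> \<B> \<and> x \<in> V \<and> x \<in> topspace leaf_top \<and> (\<exists>N. integral_mfd N \<and> ?C V x \<subseteq> N)}"
  have \<U>_open: "openin leaf_top U" if "U \<in> \<U>" for U
    using that \<B>(2) component_open topological_basis_open unfolding \<U>_def by blast
  have \<U>_sub: "U \<subseteq> topspace leaf_top" if "U \<in> \<U>" for U using openin_subset \<U>_open[OF that] by blast
  have cover: "\<exists>U\<in>\<U>. x \<in> U" if x: "x \<in> topspace leaf_top" for x
  proof -
    obtain S where S: "open S" "x \<in> S"
      "\<And>V. x \<in> V \<Longrightarrow> V \<subseteq> S \<Longrightarrow> \<exists>N. integral_mfd N \<and> ?C V x \<subseteq> N"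
      using small_component_in_integral[OF x] by metis
    obtain V where V: "V \<in> \<B>" "x \<in> V" "V \<subseteq> S" by (rule topological_basisE[OF \<B>(2) S(1,2)]) (rule that)
    have "?C V x \<in> \<U>"
      unfolding \<U>_def
      by (rule CollectI, rule exI[of _ V], rule exI[of _ x]) (use V(1,2) x S(3)[OF V(2,3)] in simp)
    moreover have "x \<in> ?C V x" using x V by (simp add: connected_component_of_refl)
    ultimately show ?thesis by blast
  qed
  have count: "countable {U\<in>\<U>. U \<inter> U0 \<noteq> {}}" if U0: "U0 \<in> \<U>" for U0
  proof -
    obtain N0 where N0: "integral_mfd N0" "U0 \<subseteq> N0" using U0 unfolding \<U>_def by blast
    \<comment> \<open>A member \<open>U\<close> that meets \<open>U0\<close> contains
      \<open>N0 \<inter> B\<close> for some basic \<open>B\<close>. It is the component, in its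
      basic set \<open>V\<close>, of a point chosen in \<open>N0 \<inter> B\<close>, so the pair
      \<open>(V, B)\<close> determines it.\<close>
    have "{U\<in>\<U>. U \<inter> U0 \<noteq> {}} \<subseteq> (\<lambda>(V, B). ?C V (SOME x. x \<in> N0 \<inter> B)) ` (\<B> \<times> \<B>)"
    proof
      fix U assume "U \<in> {U\<in>\<U>. U \<inter> U0 \<noteq> {}}"
      then obtain p where U: "U \<in> \<U>" and p: "p \<in> U" "p \<in> U0" by blast
      obtain V x where V: "V \<in> \<B>" "U = ?C V x" using U unfolding \<U>_def by blast
      have pN: "p \<in> N0" using p N0 by blast
      obtain S where S: "open S" "p \<in> S" "N0 \<inter> S \<subseteq> U"
        using leaf_open_relatively_open[OF \<U>_open[OF U] N0(1) p(1) pN] by blast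
      obtain B where B: "B \<in> \<B>" "p \<in> B" "B \<subseteq> S" by (rule topological_basisE[OF \<B>(2) S(1,2)]) (rule that)
      define q where "q = (SOME x. x \<in> N0 \<inter> B)"
      have "q \<in> N0 \<inter> B" unfolding q_def by (rule someI[of _ p]) (use pN B in blast)
      then have "q \<in> ?C V x" using S B V by blast
      then have "?C V q = U" using V(2) connected_component_of_equiv[of "subtopology leaf_top V" x q] by auto
      then show "U \<in> (\<lambda>(V, B). ?C V (SOME x. x \<in> N0 \<inter> B)) ` (\<B> \<times> \<B>)"
        using V(1) B(1) unfolding q_def by (intro image_eqI[of _ _ "(V, B)"]) auto
    qed
    moreover have "countable (\<B> \<times> \<B>)" using \<B>(1) by blast
    ultimately show ?thesis by (meson countable_image countable_subset)
  qed
  have "y \<in> topspace leaf_top" using F connectedin_subset_topspace by blast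
  then obtain U1 where U1: "U1 \<in> \<U>" "y \<in> U1" using cover by blast
  \<comment> \<open>\<open>R n\<close> collects the members of \<open>\<U>\<close> reached from
    \<open>U1\<close> by \<open>n\<close> successive overlaps; countability passes from each stage
    to the next.\<close>
  define R where "R = rec_nat {U1} (\<lambda>n X. \<Union>U0\<in>X. {U\<in>\<U>. U \<inter> U0 \<noteq> {}})"
  have R0: "R 0 = {U1}" and RS: "R (Suc n) = (\<Union>U0\<in>R n. {U\<in>\<U>. U \<inter> U0 \<noteq> {}})" for n
    unfolding R_def by simp_all
  have R\<U>: "R n \<subseteq> \<U>" for n by (induction n) (use R0 RS U1 in auto)
  have Rc: "countable (R n)" for n
  proof (induction n)
    case (Suc n)
    show ?case unfolding RS by (rule countable_UN[OF Suc count]) (use R\<U>[of n] in blast)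
  qed (simp add: R0)
  define G where "G = \<Union>(\<Union>n. R n)"
  \<comment> \<open>A member of \<open>\<U>\<close> that meets \<open>G\<close> meets some
    \<open>R n\<close> and so belongs to the next stage. The remaining members are disjoint from
    \<open>G\<close>, and connectedness of \<open>F\<close> excludes them.\<close>
  define H where "H = \<Union>{U\<in>\<U>. U \<inter> G = {}}"
  have oG: "openin leaf_top G" unfolding G_def using R\<U> \<U>_open by (intro openin_Union) blast
  have oH: "openin leaf_top H" unfolding H_def using \<U>_open by (intro openin_Union) blast
  have "topspace leaf_top \<subseteq> G \<union> H"
  proof
    fix x assume "x \<in> topspace leaf_top"
    then obtain U where U: "U \<in> \<U>" "x \<in> U" using cover by blast
    show "x \<in> G \<union> H"
    proof (cases "U \<inter> G = {}")
      case True
      then show ?thesis using U unfolding H_def by blast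
    next
      case False
      then obtain n U0 where "U0 \<in> R n" "U \<inter> U0 \<noteq> {}" unfolding G_def by blast
      then have "U \<in> R (Suc n)" unfolding RS using U by blast
      then show ?thesis using U unfolding G_def by blast
    qed
  qed
  then have "F \<subseteq> G \<union> H" using F connectedin_subset_topspace by blast
  moreover have "G \<inter> H \<inter> F = {}" unfolding H_def by blast
  moreover have "G \<inter> F \<noteq> {}" using U1 F(2) R0 unfolding G_def by blast
  ultimately have "H \<inter> F = {}" using connectedinD[OF F(1) oG oH] by blast
  then have FG: "F \<subseteq> G" using \<open>F \<subseteq> G \<union> H\<close> by blast
  have "\<exists>N. integral_mfd N \<and> U \<subseteq> N" if "U \<in> (\<Union>n. R n)" for U
    using that R\<U> unfolding \<U>_def by blast
  then have "\<exists>f. \<forall>U\<in>(\<Union>n. R n). integral_mfd (f U) \<and> U \<subseteq> f U" by (intro bchoice ballI)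
  then obtain f where f: "\<And>U. U \<in> (\<Union>n. R n) \<Longrightarrow> integral_mfd (f U) \<and> U \<subseteq> f U" by auto
  show ?thesis
  proof (rule that[of "f ` (\<Union>n. R n)"])
    show "countable (f ` (\<Union>n. R n))" by (intro countable_image countable_UN Rc) simp
    show "integral_mfd N" if "N \<in> f ` (\<Union>n. R n)" for N
      by (rule imageE[OF that]) (use f in simp)
    show "F \<subseteq> \<Union>(f ` (\<Union>n. R n))"
    proof
      fix x assume "x \<in> F"
      then obtain U where U: "U \<in> (\<Union>n. R n)" "x \<in> U" using FG unfolding G_def by blast
      then have "x \<in> f U" using f[OF U(1)] by auto
      then show "x \<in> \<Union>(f ` (\<Union>n. R n))" using U(1) by auto
    qed
  qed
qed

section \<open>Local fibres as components in the leaf topology\<close>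

lemma local_fibre_subset: "local_fibre A M \<nu> W z \<subseteq> W" "local_fibre A M \<nu> W z \<subseteq> topspace leaf_top"
  using connected_component_of_subset_topspace[of "subtopology leaf_top (fibre A M \<nu> z \<inter> W)" z]
  unfolding local_fibre_def by auto

lemma local_fibre_connectedin: "connectedin leaf_top (local_fibre A M \<nu> W z)"
  using connectedin_connected_component_of[of "subtopology leaf_top (fibre A M \<nu> z \<inter> W)" z]
  unfolding local_fibre_def by (simp add: connectedin_subtopology)

text \<open>A component taken at a point outside the space is empty, so a single member
  \<open>z'\<close> already puts \<open>z\<close> into its own local fibre. Both points then have
  the same leaf, hence the same subspace and the same component.\<close>

lemma local_fibre_eq:
  assumes "z' \<in> local_fibre A M \<nu> W z"
  shows "local_fibre A M \<nu> W z' = local_fibre A M \<nu> W z" "z' \<in> local_fibre A M \<nu> W z'" "z \<in> local_fibre A M \<nu> W z"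
proof -
  let ?X = "subtopology leaf_top (fibre A M \<nu> z \<inter> W)"
  have "z' \<in> fibre A M \<nu> z"
    using assms connected_component_of_subset_topspace[of ?X z] unfolding local_fibre_def by auto
  then have f: "fibre A M \<nu> z' = fibre A M \<nu> z"
    unfolding fibre_def leaf_def using connected_component_of_equiv[of leaf_top z z'] by auto
  have cc: "connected_component_of ?X z z'" using assms unfolding local_fibre_def by simp
  then have e: "connected_component_of ?X z = connected_component_of ?X z'"
    and t: "z \<in> topspace ?X" "z' \<in> topspace ?X"
    using connected_component_of_equiv[of ?X z z'] by auto
  have r: "connected_component_of ?X z z" "connected_component_of ?X z' z'"
    using t by (simp_all only: connected_component_of_refl)
  show "local_fibre A M \<nu> W z' = local_fibre A M \<nu> W z" unfolding local_fibre_def f e ..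
  show "z' \<in> local_fibre A M \<nu> W z'" unfolding local_fibre_def f mem_Collect_eq by (rule r(2))
  show "z \<in> local_fibre A M \<nu> W z" unfolding local_fibre_def mem_Collect_eq by (rule r(1))
qed

lemma connectedin_subset_local_fibre:
  assumes "connectedin leaf_top Q" "Q \<subseteq> W" "z' \<in> Q" "z' \<in> local_fibre A M \<nu> W z"
  shows "Q \<subseteq> local_fibre A M \<nu> W z"
proof -
  have "Q \<subseteq> fibre A M \<nu> z'"
    unfolding fibre_def leaf_def using connected_component_of_maximal[OF assms(1,3)] .
  then have "connectedin (subtopology leaf_top (fibre A M \<nu> z' \<inter> W)) Q"
    using assms(1,2) by (simp add: connectedin_subtopology)
  then have "Q \<subseteq> local_fibre A M \<nu> W z'"
    unfolding local_fibre_def using connected_component_of_maximal assms(3) by metis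
  then show ?thesis using local_fibre_eq(1)[OF assms(4)] by simp
qed

end

section \<open>Retractions along the fibres\<close>

context presymplectic_submanifold
begin

section \<open>Tangent vectors and differentials on open subsets of \<open>M\<close>\<close>

lemma tangent_curve:
  assumes W: "openin (top_of_set M) W" and z: "z \<in> W" and u: "u \<in> tangent_space A M z"
  obtains \<gamma> e where "e > 0" "smooth_map std_atlas A {-e<..<e} \<gamma>" "\<gamma> ` {-e<..<e} \<subseteq> W" "has_velocity A \<gamma> z u"
proof -
  obtain S where S: "open S" "W = M \<inter> S" using W unfolding openin_open by blast
  obtain \<gamma> e where \<gamma>: "e > 0" "smooth_map std_atlas A {-e<..<e} \<gamma>" "\<gamma> ` {-e<..<e} \<subseteq> M" "has_velocity A \<gamma> z u"
    using u tangent_space_iff[OF atlas] by metis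
  have \<gamma>0: "\<gamma> 0 = z" "isCont \<gamma> 0" using \<gamma>(4) unfolding has_velocity_def by blast+
  have "\<forall>\<^sub>F t in nhds 0. \<gamma> t \<in> S"
    by (rule isCont_eventually_open[OF \<gamma>0(2) S(1)]) (use \<gamma>0(1) z S in blast)
  then obtain \<delta> where \<delta>: "\<delta> > 0" "\<And>t. \<bar>t\<bar> < \<delta> \<Longrightarrow> \<gamma> t \<in> S"
    unfolding eventually_nhds_metric by (auto simp: dist_real_def)
  define e' where "e' = min e \<delta>"
  have sub: "{-e'<..<e'} \<subseteq> {-e<..<e}" unfolding e'_def by auto
  have "\<gamma> t \<in> W" if "t \<in> {-e'<..<e'}" for t
  proof -
    have "\<bar>t\<bar> < \<delta>" using that unfolding e'_def by auto
    then show ?thesis using \<delta>(2) \<gamma>(3) subsetD[OF sub that] S(2) by blast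
  qed
  then have "\<gamma> ` {-e'<..<e'} \<subseteq> W" by (rule image_subsetI)
  moreover have "e' > 0" using \<gamma>(1) \<delta>(1) by (simp add: e'_def)
  ultimately show ?thesis using that[of e' \<gamma>] smooth_map_subset[OF \<gamma>(2) sub] \<gamma>(4) by blast
qed

lemma eventually_in_interval:
  fixes \<gamma> :: "real \<Rightarrow> 'a"
  assumes "e > 0" "\<gamma> ` {-e<..<e} \<subseteq> W"
  shows "\<forall>\<^sub>F t in nhds 0. \<gamma> t \<in> W"
proof -
  have "\<forall>\<^sub>F t in nhds (0::real). t \<in> {-e<..<e}"
    using assms(1) by (intro eventually_nhds_in_open) auto
  then show ?thesis by eventually_elim (use assms(2) in blast)
qed

lemma tangent_map_tangent:
  assumes W: "openin (top_of_set M) W" and z: "z \<in> W" and u: "u \<in> tangent_space A M z"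
    and g: "smooth_map A A W g" "g ` W \<subseteq> N"
  shows "tangent_map A A W g z u \<in> tangent_space A N (g z)"
proof -
  obtain \<gamma> e where \<gamma>: "e > 0" "smooth_map std_atlas A {-e<..<e} \<gamma>" "\<gamma> ` {-e<..<e} \<subseteq> W" "has_velocity A \<gamma> z u"
    by (rule tangent_curve[OF W z u]) (rule that)
  have "smooth_map std_atlas A {-e<..<e} (g \<circ> \<gamma>)"
    by (rule smooth_map_compose[OF smooth_atlas_std atlas atlas \<gamma>(2) g(1) \<gamma>(3)])
  moreover have "(g \<circ> \<gamma>) ` {-e<..<e} \<subseteq> N" using \<gamma>(3) g(2) by auto
  moreover have "has_velocity A (g \<circ> \<gamma>) (g z) (tangent_map A A W g z u)"
    using has_velocity_tangent_map[OF atlas atlas g(1) z \<gamma>(4) eventually_in_interval[OF \<gamma>(1,3)]] by (simp add: o_def)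
  ultimately show ?thesis using \<gamma>(1) tangent_space_iff[OF atlas] by blast
qed

lemma tangent_map_compose:
  assumes W: "openin (top_of_set M) W" and z: "z \<in> W" and u: "u \<in> tangent_space A M z"
    and g: "smooth_map A A W g" "g ` W \<subseteq> S" and h: "smooth_map A A S h"
  shows "tangent_map A A W (h \<circ> g) z u = tangent_map A A S h (g z) (tangent_map A A W g z u)"
proof -
  obtain \<gamma> e where \<gamma>: "e > 0" "smooth_map std_atlas A {-e<..<e} \<gamma>" "\<gamma> ` {-e<..<e} \<subseteq> W" "has_velocity A \<gamma> z u"
    by (rule tangent_curve[OF W z u]) (rule that)
  note ev = eventually_in_interval[OF \<gamma>(1,3)]
  have gz: "g z \<in> S" using g(2) z by blast
  have "\<forall>\<^sub>F t in nhds 0. g (\<gamma> t) \<in> S" using ev by eventually_elim (use g(2) in blast)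
  from has_velocity_tangent_map[OF atlas atlas h gz has_velocity_tangent_map[OF atlas atlas g(1) z \<gamma>(4) ev] this]
  have "has_velocity A (\<lambda>t. h (g (\<gamma> t))) (h (g z)) (tangent_map A A S h (g z) (tangent_map A A W g z u))" .
  moreover have "smooth_map A A W (h \<circ> g)" by (rule smooth_map_compose[OF atlas atlas atlas g(1) h g(2)])
  from has_velocity_tangent_map[OF atlas atlas this z \<gamma>(4) ev]
  have "has_velocity A (\<lambda>t. h (g (\<gamma> t))) (h (g z)) (tangent_map A A W (h \<circ> g) z u)" by simp
  ultimately show ?thesis using has_velocity_unique by blast
qed

lemma tangent_space_diff:
  assumes z: "z \<in> M" and "u \<in> tangent_space A M z" "v \<in> tangent_space A M z"
  shows "u - v \<in> tangent_space A M z"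
proof -
  obtain c L where s: "slice_chart A M c L z" using submanifold_slice[OF submanifold z] by metis
  have c: "c \<in> maximal_atlas A" "subspace L" "z \<in> fst c" using s unfolding slice_chart_def by blast+
  show ?thesis
    using assms(2,3) linear_diff[OF tcoord_linear(1)[OF atlas c(1,3)]] subspace_diff[OF c(2)]
    unfolding tangent_space_slice[OF atlas s] by simp
qed

lemma kernel_\<omega>:
  assumes "z \<in> M" "u \<in> K z" "v \<in> tangent_space A M z"
  shows "\<omega> z u v = 0" "\<omega> z v u = 0"
proof -
  have u: "u \<in> tangent_space A M z" "\<nu> z u v = 0" using assms(2,3) unfolding form_kernel_def by blast+
  show "\<omega> z u v = 0" using u(2) \<nu>_eq_\<omega>[OF assms(1) u(1) assms(3)] by simp
  moreover have "\<omega> z v u = - \<omega> z u v"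
    by (rule alternating_skew[OF bilinear_\<omega>]) (use forms(1) in \<open>simp add: smooth_two_form_def\<close>)
  ultimately show "\<omega> z v u = 0" by simp
qed

end

section \<open>Retractions and the kernel of their differential\<close>

text \<open>The level sets of \<open>f\<close> in \<open>W\<close> are exactly the local fibres: if
  \<open>f z = f z'\<close>, this point lies in the local fibres of both \<open>z\<close> and
  \<open>z'\<close>, which therefore coincide.\<close>

locale fibre_retraction = presymplectic_submanifold +
  fixes W and f :: "'a \<Rightarrow> 'a"
  assumes W: "openin (top_of_set M) W" and f_smooth: "smooth_map A A W f"
    and f_in: "\<And>z. z \<in> W \<Longrightarrow> f z \<in> local_fibre A M \<nu> W z"
    and f_const: "\<And>z z'. z \<in> W \<Longrightarrow> z' \<in> local_fibre A M \<nu> W z \<Longrightarrow> f z' = f z"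
begin

abbreviation "F \<equiv> local_fibre A M \<nu> W"
abbreviation "df \<equiv> tangent_map A A W f"

lemma W_M: "W \<subseteq> M" using openin_subset[OF W] by simp

lemma f_W: "z \<in> W \<Longrightarrow> f z \<in> W" using f_in local_fibre_subset(1) by blast

lemma f_idem: "z \<in> W \<Longrightarrow> f (f z) = f z" using f_const f_in by blast

lemma self_in_fibre: "z \<in> W \<Longrightarrow> z \<in> F z" using local_fibre_eq(3)[OF f_in] .

lemma W_topspace: "z \<in> W \<Longrightarrow> z \<in> topspace leaf_top" using self_in_fibre local_fibre_subset(2) by blast

lemma df_tangent: "z \<in> W \<Longrightarrow> u \<in> tangent_space A M z \<Longrightarrow> df z u \<in> tangent_space A M (f z)"
  using tangent_map_tangent[OF W _ _ f_smooth] f_W W_M by blast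

lemma df_linear: "z \<in> W \<Longrightarrow> linear (df z)"
  by (rule tangent_map_linear[OF atlas atlas f_smooth])

text \<open>A kernel vector is the velocity of a curve in a plaque; a small plaque is connected and
  hence contained in the local fibre, where \<open>f\<close> is constant.\<close>

lemma df_kernel:
  assumes z: "z \<in> W" and u: "u \<in> K z"
  shows "df z u = 0"
proof -
  obtain S where S: "open S" "W = M \<inter> S" using W unfolding openin_open by blast
  have zS: "z \<in> S" using z S by blast
  obtain Q where Q: "integral_mfd Q" "connected Q" "z \<in> Q" "Q \<subseteq> S"
    by (rule plaque_nbhd[OF W_topspace[OF z] S(1) zS]) (rule that)
  have QW: "Q \<subseteq> W" using integral_subset[OF Q(1)] Q(4) S(2) by blast
  have QF: "Q \<subseteq> F z"
    by (rule connectedin_subset_local_fibre[OF connectedin_integral[OF Q(1) order_refl Q(2)] QW Q(3) self_in_fibre[OF z]])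
  have uQ: "u \<in> tangent_space A Q z" using u integral_kernel[OF Q(1,3)] by simp
  obtain \<gamma> where \<gamma>: "has_velocity A \<gamma> z u" "\<forall>\<^sub>F t in nhds 0. \<gamma> t \<in> Q"
    by (rule tangent_spaceE[OF atlas uQ]) (rule that)
  have "\<forall>\<^sub>F t in nhds 0. \<gamma> t \<in> W" using \<gamma>(2) by eventually_elim (use QW in blast)
  from has_velocity_tangent_map[OF atlas atlas f_smooth z \<gamma>(1) this]
  have "has_velocity A (\<lambda>t. f (\<gamma> t)) (f z) (df z u)" .
  moreover have "\<forall>\<^sub>F t in nhds 0. f (\<gamma> t) = f z"
    using \<gamma>(2) by eventually_elim (use QF f_const[OF z] in blast)
  ultimately have "has_velocity A (\<lambda>t. f z) (f z) (df z u)" by (rule has_velocity_cong)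
  moreover have "has_velocity A (\<lambda>t. f z) (f z) 0" unfolding has_velocity_def by simp
  ultimately show ?thesis by (rule has_velocity_unique)
qed

text \<open>A smooth coordinate extension \<open>h\<close> of \<open>f\<close> to an open set of the
  model space. Its values off the image of \<open>M\<close> are arbitrary, but on tangent vectors
  its derivative is \<open>df\<close>, since both are determined by the velocity of the image of one
  curve in \<open>W\<close>.\<close>

lemma local_representative:
  assumes z: "z \<in> W" and s: "slice_chart A M c L z" and d: "d \<in> maximal_atlas A" "f z \<in> fst d"
  obtains V h where "open V" "V \<subseteq> snd c ` fst c" "snd c z \<in> V" "smooth_on V h" "h ` V \<subseteq> snd d ` fst d"
    "\<And>p. p \<in> fst c \<Longrightarrow> p \<in> M \<Longrightarrow> snd c p \<in> V \<Longrightarrow> p \<in> W \<and> f p \<in> fst d \<and> h (snd c p) = snd d (f p)"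
    "\<And>p u. p \<in> fst c \<Longrightarrow> p \<in> M \<Longrightarrow> snd c p \<in> V \<Longrightarrow> u \<in> tangent_space A M p \<Longrightarrow>
       frechet_derivative h (at (snd c p)) (tcoord A c p u) = tcoord A d (f p) (df p u)"
proof -
  have c: "c \<in> maximal_atlas A" "z \<in> fst c" using s unfolding slice_chart_def by blast+
  have ic: "is_chart c" and id: "is_chart d" using c d maximal_atlas_is_chart by blast+
  obtain S where S: "open S" "W = M \<inter> S" using W unfolding openin_open by blast
  obtain U g where U: "z \<in> U" and g: "smooth_map_open A A U g" and gf: "\<And>x. x \<in> U \<Longrightarrow> x \<in> W \<Longrightarrow> g x = f x"
    by (rule smooth_mapE[OF f_smooth z]) (rule that)
  let ?R = "fst c \<inter> U \<inter> g -` fst d"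
  have oR: "open (S \<inter> ?R)"
    using open_Int[OF S(1) open_Int[OF is_chart_open(1)[OF ic] smooth_map_open_domain_open[OF g is_chart_open(1)[OF id]]]]
    by (simp add: Int_assoc)
  define V where "V = snd c ` (S \<inter> ?R)"
  define h where "h = snd d \<circ> g \<circ> chart_inv c"
  have oV: "open V" unfolding V_def by (rule chart_image_open[OF ic oR]) blast
  have sh: "smooth_on V h" unfolding h_def V_def
    by (rule smooth_on_subset[OF smooth_map_open_charts[OF atlas atlas g c(1) d(1)]]) blast
  have inV: "p \<in> S \<inter> ?R" if p: "p \<in> fst c" "snd c p \<in> V" for p
  proof -
    obtain q where q: "q \<in> S \<inter> ?R" "snd c p = snd c q" using p(2) unfolding V_def by blast
    then have "p = q" using chart_inv_left[OF ic] p(1) by (metis IntD1 IntD2)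
    then show ?thesis using q(1) by simp
  qed
  have main: "p \<in> W \<and> f p \<in> fst d \<and> h (snd c p) = snd d (f p)" if p: "p \<in> fst c" "p \<in> M" "snd c p \<in> V" for p
  proof -
    have pR: "p \<in> S \<inter> ?R" by (rule inV[OF p(1,3)])
    then have pW: "p \<in> W" using p(2) S(2) by blast
    have "g p = f p" using gf pR pW by blast
    then show ?thesis using pR pW unfolding h_def by (simp add: chart_inv_left[OF ic p(1)])
  qed
  have deriv: "frechet_derivative h (at (snd c p)) (tcoord A c p u) = tcoord A d (f p) (df p u)"
    if p: "p \<in> fst c" "p \<in> M" "snd c p \<in> V" and u: "u \<in> tangent_space A M p" for p u
  proof -
    have pR: "p \<in> U" "g p \<in> fst d" using inV[OF p(1,3)] by blast+
    have pW: "p \<in> W" using main[OF p] by blast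
    have gp: "g p = f p" using gf pR pW by blast
    obtain \<gamma> e where \<gamma>: "e > 0" "smooth_map std_atlas A {-e<..<e} \<gamma>" "\<gamma> ` {-e<..<e} \<subseteq> W" "has_velocity A \<gamma> p u"
      by (rule tangent_curve[OF W pW u]) (rule that)
    note ev = eventually_in_interval[OF \<gamma>(1,3)]
    have v: "has_velocity A (\<lambda>t. f (\<gamma> t)) (f p) (df p u)"
      by (rule has_velocity_tangent_map[OF atlas atlas f_smooth pW \<gamma>(4) ev])
    have "open U" using g unfolding smooth_map_open_def by blast
    then have "\<forall>\<^sub>F t in nhds 0. \<gamma> t \<in> U"
      using isCont_eventually_open[of \<gamma> U] \<gamma>(4) pR(1) unfolding has_velocity_def by blast
    with ev have "\<forall>\<^sub>F t in nhds 0. f (\<gamma> t) = g (\<gamma> t)" by eventually_elim (use gf in metis)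
    from has_velocity_cong[OF v this] have w: "has_velocity A (\<lambda>t. g (\<gamma> t)) (g p) (df p u)" unfolding gp .
    show ?thesis
      using tangent_map_smooth_on_open[OF atlas atlas g pR(1) \<gamma>(4) w c(1) p(1) d(1) pR(2)]
      unfolding h_def gp by simp
  qed
  have "snd c z \<in> V" unfolding V_def using c(2) z S U d(2) gf[OF U z] by auto
  moreover have "V \<subseteq> snd c ` fst c" unfolding V_def by blast
  moreover have "h ` V \<subseteq> snd d ` fst d" unfolding V_def h_def by (auto simp: chart_inv_left[OF ic])
  ultimately show ?thesis using that[OF oV _ _ sh _ main deriv] by blast
qed

text \<open>If \<open>df u = 0\<close>, then \<open>u\<close> is a velocity of a curve in the fibre of \<open>f\<close>, which lies in a single
  leaf.  The leaf is a countable union of plaques, so the curve meets one of them at uncountably many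
  times; at an accumulation point of these times it is tangent to the plaque.\<close>

lemma ker_df_subset_kernel:
  assumes y: "y \<in> W" "f y = y" and u: "u \<in> tangent_space A M y" "df y u = 0"
  shows "u \<in> K y"
proof -
  have yM: "y \<in> M" using y W_M by blast
  obtain c L where s: "slice_chart A M c L y" using submanifold_slice[OF submanifold yM] by metis
  have c: "c \<in> maximal_atlas A" "subspace L" "y \<in> fst c" using s unfolding slice_chart_def by blast+
  have ic: "is_chart c" using c maximal_atlas_is_chart by blast
  have fy: "f y \<in> fst c" using c(3) y(2) by simp
  obtain V h where V: "open V" "V \<subseteq> snd c ` fst c" "snd c y \<in> V" "smooth_on V h"
    and h: "\<And>p. p \<in> fst c \<Longrightarrow> p \<in> M \<Longrightarrow> snd c p \<in> V \<Longrightarrow> p \<in> W \<and> f p \<in> fst c \<and> h (snd c p) = snd c (f p)"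
    and dh: "\<And>p u. p \<in> fst c \<Longrightarrow> p \<in> M \<Longrightarrow> snd c p \<in> V \<Longrightarrow> u \<in> tangent_space A M p \<Longrightarrow>
       frechet_derivative h (at (snd c p)) (tcoord A c p u) = tcoord A c (f p) (df p u)"
    by (rule local_representative[OF y(1) s c(1) fy]) (rule that)
  define x0 where "x0 = snd c y"
  define uc where "uc = tcoord A c y u"
  have x0: "x0 \<in> V" "x0 \<in> L" unfolding x0_def using V slice_chart_iff[OF s c(3)] yM by auto
  have hx0: "h x0 = x0" unfolding x0_def using h[OF c(3) yM V(3)] y(2) by simp
  have pt: "chart_inv c x \<in> fst c \<and> chart_inv c x \<in> M \<and> snd c (chart_inv c x) = x" if "x \<in> V \<inter> L" for x
  proof -
    have x: "x \<in> snd c ` fst c" using that V(2) by blast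
    then have "chart_inv c x \<in> fst c" "snd c (chart_inv c x) = x" by (rule chart_inv_in, rule chart_inv_right)
    then show ?thesis using slice_chart_iff[OF s] that by simp
  qed
  have hx: "h x = snd c (f (chart_inv c x)) \<and> chart_inv c x \<in> W \<and> f (chart_inv c x) \<in> fst c" if "x \<in> V \<inter> L" for x
    using h[of "chart_inv c x"] pt[OF that] that by simp
  have hL: "h x \<in> L" if x: "x \<in> V \<inter> L" for x
  proof -
    have "f (chart_inv c x) \<in> M" using hx[OF x] f_W W_M by blast
    then show ?thesis using slice_chart_iff[OF s, of "f (chart_inv c x)"] hx[OF x] by simp
  qed
  have hh: "h (h x) = h x" if x: "x \<in> V \<inter> L" and hV: "h x \<in> V" for x
  proof -
    let ?q = "f (chart_inv c x)"
    have q: "?q \<in> fst c" "?q \<in> M" "h x = snd c ?q" "f ?q = ?q" using hx[OF x] f_W W_M f_idem by blast+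
    then show ?thesis using h[of ?q] hV by simp
  qed
  have ucL: "uc \<in> L" unfolding uc_def using u(1) tangent_space_slice[OF atlas s] by blast
  have "frechet_derivative h (at x0) uc = tcoord A c y 0"
    using dh[OF c(3) yM V(3) u(1)] u(2) y(2) unfolding x0_def uc_def by simp
  then have duc: "frechet_derivative h (at x0) uc = 0" using linear_0[OF tcoord_linear(1)[OF atlas c(1,3)]] by simp
  obtain \<epsilon> \<gamma> \<gamma>' where \<epsilon>: "\<epsilon> > 0" and \<gamma>0: "\<gamma> 0 = x0"
    and \<gamma>: "\<And>t::real. \<bar>t\<bar> < \<epsilon> \<Longrightarrow> \<gamma> t \<in> V \<inter> L \<and> h (\<gamma> t) = x0 \<and> (\<gamma> has_vector_derivative \<gamma>' t) (at t)"
    and \<gamma>': "(\<gamma>' \<longlongrightarrow> uc) (at 0)"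
    by (rule idempotent_fibre_curve[OF V(4,1) x0 c(2) hx0 hL hh ucL duc]) (assumption | rule that)+
  define p where "p t = chart_inv c (\<gamma> t)" for t
  \<comment> \<open>From \<open>f (p t) = y\<close> it follows that \<open>y\<close> lies in the
    local fibre of \<open>p t\<close>, so the two local fibres agree: the whole curve runs in the
    local fibre of \<open>y\<close>.\<close>
  have p: "p t \<in> fst c" "p t \<in> M" "snd c (p t) = \<gamma> t" "p t \<in> F y" if t: "\<bar>t\<bar> < \<epsilon>" for t
  proof -
    have \<gamma>t: "\<gamma> t \<in> V \<inter> L" using \<gamma>[OF t] by blast
    show "p t \<in> fst c" "p t \<in> M" "snd c (p t) = \<gamma> t" unfolding p_def using pt[OF \<gamma>t] by blast+
    have "snd c (f (p t)) = snd c y" "f (p t) \<in> fst c" "p t \<in> W"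
      using hx[OF \<gamma>t] \<gamma>[OF t] unfolding p_def x0_def by auto
    then have fp: "f (p t) = y" "p t \<in> W" using chart_inv_left[OF ic] c(3) by metis+
    then have yF: "y \<in> F (p t)" using f_in by metis
    show "p t \<in> F y" using local_fibre_eq(1)[OF yF] local_fibre_eq(3)[OF yF] by simp
  qed
  obtain \<N> where \<N>: "countable \<N>" "\<And>N. N \<in> \<N> \<Longrightarrow> integral_mfd N" "F y \<subseteq> \<Union>\<N>"
    by (rule connectedin_countable_cover[OF local_fibre_connectedin self_in_fibre[OF y(1)]]) (rule that)
  \<comment> \<open>Tangency to the kernel is obtained at times arbitrarily close to 0, not at 0
    itself. The limit of \<open>\<gamma>'\<close> at 0 then carries it to \<open>uc\<close>, as the
    condition of lying in the kernel is closed.\<close>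
  have tangent: "\<exists>t. 0 < t \<and> t < \<delta> \<and> t < \<epsilon> \<and> \<gamma>' t \<in> fkernel L (\<Omega> c) (\<gamma> t)" if "\<delta> > 0" for \<delta>
  proof -
    define \<delta>' where "\<delta>' = min \<delta> \<epsilon>"
    have \<delta>': "\<delta>' > 0" using that \<epsilon> by (simp add: \<delta>'_def)
    have abs: "\<bar>t\<bar> < \<epsilon>" if "t \<in> {0<..<\<delta>'}" for t using that by (simp add: \<delta>'_def)
    have "{0<..<\<delta>'} \<subseteq> (\<Union>N\<in>\<N>. {t\<in>{0<..<\<delta>'}. p t \<in> N})"
    proof
      fix t assume t: "t \<in> {0<..<\<delta>'}"
      then have "p t \<in> F y" using p(4) abs by blast
      then obtain N where "N \<in> \<N>" "p t \<in> N" using \<N>(3) by blast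
      then show "t \<in> (\<Union>N\<in>\<N>. {t\<in>{0<..<\<delta>'}. p t \<in> N})" using t by blast
    qed
    moreover have "uncountable {0<..<\<delta>'}" using \<delta>' by (simp add: uncountable_open_interval)
    ultimately have "uncountable (\<Union>N\<in>\<N>. {t\<in>{0<..<\<delta>'}. p t \<in> N})"
      using countable_subset by blast
    then have "\<not> (\<forall>N\<in>\<N>. countable {t\<in>{0<..<\<delta>'}. p t \<in> N})"
      using countable_UN[OF \<N>(1)] by (rule contrapos_nn) blast
    then obtain N where N: "N \<in> \<N>" "uncountable {t\<in>{0<..<\<delta>'}. p t \<in> N}" by blast
    obtain t0 where t0: "t0 \<in> {t\<in>{0<..<\<delta>'}. p t \<in> N}" "t0 islimpt {t\<in>{0<..<\<delta>'}. p t \<in> N}"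
      by (rule uncountable_imp_islimpt[OF N(2)]) (rule that)
    have t0': "\<bar>t0\<bar> < \<epsilon>" "p t0 \<in> N" "0 < t0" "t0 < \<delta>'" using t0(1) abs by auto
    note pt0 = p(1-3)[OF t0'(1)]
    have iN: "integral_mfd N" by (rule \<N>(2)[OF N(1)])
    obtain d L1 where sd: "slice_chart A N d L1 (p t0)" using integral_slice[OF iN t0'(2)] by blast
    have d: "d \<in> maximal_atlas A" "subspace L1" "p t0 \<in> fst d" using sd unfolding slice_chart_def by blast+
    have id: "is_chart d" using d maximal_atlas_is_chart by blast
    define \<tau> where "\<tau> = snd d \<circ> chart_inv c"
    define X where "X = snd c ` (fst c \<inter> fst d)"
    have s\<tau>: "smooth_on X \<tau>" unfolding X_def \<tau>_def by (rule maximal_atlas_transition[OF atlas c(1) d(1)])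
    have oX: "open X" unfolding X_def
      by (rule chart_image_open[OF ic open_Int[OF is_chart_open(1)[OF ic] is_chart_open(1)[OF id]]]) blast
    have \<gamma>X: "\<gamma> t0 \<in> X" unfolding X_def using pt0 d(3) by (metis IntI imageI)
    have \<gamma>d: "(\<gamma> has_vector_derivative \<gamma>' t0) (at t0)" using \<gamma>[OF t0'(1)] by blast
    have D: "((\<lambda>t. \<tau> (\<gamma> t)) has_vector_derivative frechet_derivative \<tau> (at (\<gamma> t0)) (\<gamma>' t0)) (at t0)"
      by (rule has_vector_derivative_smooth_compose[OF \<gamma>d s\<tau> \<gamma>X])
    have "isCont \<gamma> t0" using \<gamma>d has_vector_derivative_continuous by blast
    then have evX: "\<forall>\<^sub>F t in at t0. \<gamma> t \<in> X"
      using \<gamma>X oX topological_tendstoD unfolding isCont_def by blast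
    have fr: "\<exists>\<^sub>F t in at t0. t \<in> {t\<in>{0<..<\<delta>'}. p t \<in> N}"
      using t0(2) by (simp only: islimpt_conv_frequently_at)
    have \<tau>L: "\<tau> (\<gamma> t) \<in> L1" if t: "t \<in> {t\<in>{0<..<\<delta>'}. p t \<in> N}" and X: "\<gamma> t \<in> X" for t
    proof -
      obtain q where q: "q \<in> fst c" "q \<in> fst d" "\<gamma> t = snd c q" using X unfolding X_def by blast
      have "p t = q" unfolding p_def q(3) by (rule chart_inv_left[OF ic q(1)])
      then show ?thesis using slice_chart_iff[OF sd q(2)] t unfolding \<tau>_def p_def by simp
    qed
    have "\<exists>\<^sub>F t in at t0. \<tau> (\<gamma> t) \<in> L1"
      by (rule frequently_mono[OF _ frequently_eventually_conj[OF fr evX]]) (use \<tau>L in blast)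
    then have "frechet_derivative \<tau> (at (\<gamma> t0)) (\<gamma>' t0) \<in> L1"
      by (rule has_vector_derivative_in_subspace[OF D d(2) \<tau>L[OF t0(1) \<gamma>X]])
    moreover have "frechet_derivative \<tau> (at (\<gamma> t0)) (\<gamma>' t0) = tcoord A d (p t0) (tcoord_inv A c (p t0) (\<gamma>' t0))"
      using tcoord_transition[OF atlas c(1) pt0(1) d(1,3)] unfolding \<tau>_def pt0(3) .
    ultimately have "tcoord_inv A c (p t0) (\<gamma>' t0) \<in> K (p t0)"
      using tangent_space_slice[OF atlas sd] integral_kernel[OF iN t0'(2)] by simp
    then have "\<gamma>' t0 \<in> fkernel L (\<Omega> c) (\<gamma> t0)"
      using kernel_in_slice_chart[OF slice_chart_at[OF s pt0(1,2)]] tcoord_inverse(1)[OF atlas c(1) pt0(1)] pt0(3) by simp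
    then show ?thesis using t0' unfolding \<delta>'_def by auto
  qed
  have sf: "smooth_form_on (snd c ` fst c) (\<Omega> c)" using closed_\<Omega>[OF c(1)] unfolding closed_form_on_def by blast
  have "\<Omega> c x0 uc v = 0" if v: "v \<in> L" for v
  proof (rule ccontr)
    assume ne: "\<Omega> c x0 uc v \<noteq> 0"
    have \<gamma>lim: "(\<gamma> \<longlongrightarrow> x0) (at 0)"
      using \<gamma>[of 0] \<epsilon> has_vector_derivative_continuous[of \<gamma> "\<gamma>' 0" 0 UNIV] \<gamma>0 by (simp add: isCont_def)
    have lim: "((\<lambda>t. \<Omega> c (\<gamma> t) i v) \<longlongrightarrow> \<Omega> c x0 i v) (at 0)" for i
    proof (rule isCont_tendsto_compose[OF _ \<gamma>lim])
      have "smooth_on (snd c ` fst c) (\<lambda>x. \<Omega> c x i v)" using sf unfolding smooth_form_on_def by blast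
      then show "isCont (\<lambda>x. \<Omega> c x i v) x0"
        using smooth_on_imp_continuous_on is_chart_open(2)[OF ic] x0(1) V(2) continuous_on_eq_continuous_at by blast
    qed
    have exp: "\<Omega> c x a v = (\<Sum>i\<in>Basis. (a \<bullet> i) *\<^sub>R \<Omega> c x i v)" if "x \<in> V" for x a
    proof -
      have "x \<in> snd c ` fst c" using that V(2) by blast
      then show ?thesis by (rule linear_expand_Basis[OF smooth_form_on_linear(2)[OF sf]])
    qed
    \<comment> \<open>The expansion in \<open>Basis\<close> separates the convergence of the vector
      \<open>\<gamma>' t\<close> from that of the base point \<open>\<gamma> t\<close>.\<close>
    have "((\<lambda>t. \<Sum>i\<in>Basis. (\<gamma>' t \<bullet> i) *\<^sub>R \<Omega> c (\<gamma> t) i v) \<longlongrightarrow> \<Omega> c x0 uc v) (at 0)"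
      unfolding exp[OF x0(1), of uc] by (intro tendsto_intros \<gamma>' lim)
    then have "\<forall>\<^sub>F t in at 0. (\<Sum>i\<in>Basis. (\<gamma>' t \<bullet> i) *\<^sub>R \<Omega> c (\<gamma> t) i v) \<noteq> 0"
      using ne tendsto_imp_eventually_ne by blast
    then obtain \<delta> where \<delta>: "\<delta> > 0" "\<And>t. t \<noteq> 0 \<Longrightarrow> \<bar>t\<bar> < \<delta> \<Longrightarrow> (\<Sum>i\<in>Basis. (\<gamma>' t \<bullet> i) *\<^sub>R \<Omega> c (\<gamma> t) i v) \<noteq> 0"
      unfolding eventually_at by (auto simp: dist_real_def)
    obtain t where t: "0 < t" "t < \<delta>" "t < \<epsilon>" "\<gamma>' t \<in> fkernel L (\<Omega> c) (\<gamma> t)" using tangent[OF \<delta>(1)] by blast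
    have "\<Omega> c (\<gamma> t) (\<gamma>' t) v = 0" using t(4) v unfolding fkernel_def by blast
    moreover have "\<gamma> t \<in> V" using \<gamma>[of t] t by auto
    ultimately show False using \<delta>(2)[of t] t exp by auto
  qed
  then have "uc \<in> fkernel L (\<Omega> c) x0" using ucL unfolding fkernel_def by blast
  then show ?thesis using kernel_in_slice_chart[OF s] unfolding uc_def x0_def by blast
qed

section \<open>Preservation of the form along local fibres\<close>

text \<open>For \<open>p\<close> in \<open>W\<close> this is \<open>f\<^sup>*\<nu> = \<nu>\<close>
  at \<open>p\<close>, written with \<omega>: the two forms agree on vectors tangent to
  \<open>M\<close>, and \<open>df\<close> maps such vectors to such vectors.\<close>

definition preserved :: "'a \<Rightarrow> bool" where
  "preserved p \<longleftrightarrow> (\<forall>u\<in>tangent_space A M p. \<forall>v\<in>tangent_space A M p. \<omega> (f p) (df p u) (df p v) = \<omega> p u v)"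

text \<open>Since \<open>df\<close> is idempotent at \<open>y\<close>, the vector
  \<open>w - df y w\<close> lies in its kernel and therefore in that of \<nu>. Replacing both
  arguments by their images changes the value only by terms with an argument in the kernel.\<close>

lemma preserved_at_fixed_point:
  assumes y: "y \<in> W" "f y = y"
  shows "preserved y"
  unfolding preserved_def
proof (intro ballI)
  fix u v assume u: "u \<in> tangent_space A M y" and v: "v \<in> tangent_space A M y"
  have yM: "y \<in> M" using y W_M by blast
  have T: "df y w \<in> tangent_space A M y" if "w \<in> tangent_space A M y" for w
    using df_tangent[OF y(1) that] y(2) by simp
  have ker: "w - df y w \<in> K y" if w: "w \<in> tangent_space A M y" for w
  proof (rule ker_df_subset_kernel[OF y tangent_space_diff[OF yM w T[OF w]]])
    obtain \<gamma> e where \<gamma>: "e > 0" "smooth_map std_atlas A {-e<..<e} \<gamma>" "\<gamma> ` {-e<..<e} \<subseteq> W" "has_velocity A \<gamma> y w"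
      by (rule tangent_curve[OF W y(1) w]) (rule that)
    note ev = eventually_in_interval[OF \<gamma>(1,3)]
    have 1: "has_velocity A (\<lambda>t. f (\<gamma> t)) y (df y w)"
      using has_velocity_tangent_map[OF atlas atlas f_smooth y(1) \<gamma>(4) ev] y(2) by simp
    have "\<forall>\<^sub>F t in nhds 0. f (\<gamma> t) \<in> W" using ev by eventually_elim (rule f_W)
    then have 2: "has_velocity A (\<lambda>t. f (f (\<gamma> t))) y (df y (df y w))"
      using has_velocity_tangent_map[OF atlas atlas f_smooth y(1) 1] y(2) by simp
    have "\<forall>\<^sub>F t in nhds 0. f (f (\<gamma> t)) = f (\<gamma> t)" using ev by eventually_elim (rule f_idem)
    then have "df y (df y w) = df y w" using has_velocity_unique[OF has_velocity_cong[OF 2] 1] by blast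
    then show "df y (w - df y w) = 0" using linear_diff[OF df_linear[OF y(1)]] by simp
  qed
  have "\<omega> y u v = \<omega> y (df y u) v + \<omega> y (u - df y u) v"
    using bilinear_ladd[OF bilinear_\<omega>, of y "df y u" "u - df y u" v] by simp
  also have "\<omega> y (u - df y u) v = 0" by (rule kernel_\<omega>(1)[OF yM ker[OF u] v])
  also have "\<omega> y (df y u) v = \<omega> y (df y u) (df y v) + \<omega> y (df y u) (v - df y v)"
    using bilinear_radd[OF bilinear_\<omega>, of y "df y u" "df y v" "v - df y v"] by simp
  also have "\<omega> y (df y u) (v - df y v) = 0" by (rule kernel_\<omega>(2)[OF yM ker[OF v] T[OF u]])
  finally show "\<omega> (f y) (df y u) (df y v) = \<omega> y u v" using y(2) by simp
qed

text \<open>\<open>B\<close> is a plaque through \<open>z\<close>. Any two of its points are joined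
  by a curve tangent to the kernel, along which the closed form \<beta> keeps vanishing on
  \<open>L\<close>.\<close>

lemma preserved_locally_constant:
  assumes z: "z \<in> W"
  obtains B where "openin leaf_top B" "z \<in> B" "\<And>w w'. w \<in> B \<Longrightarrow> w' \<in> B \<Longrightarrow> preserved w \<Longrightarrow> preserved w'"
proof -
  have zM: "z \<in> M" using z W_M by blast
  obtain N where N: "integral_mfd N" "z \<in> N" using W_topspace[OF z] unfolding topspace_leaf_top by blast
  obtain c L where s: "slice_chart A M c L z" using submanifold_slice[OF submanifold zM] by metis
  have c: "c \<in> maximal_atlas A" "subspace L" "z \<in> fst c" using s unfolding slice_chart_def by blast+
  have ic: "is_chart c" using c maximal_atlas_is_chart by blast
  let ?d = "chart_at A (f z)"
  note d = chart_at[OF atlas, of "f z"]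
  obtain V h where V: "open V" "V \<subseteq> snd c ` fst c" "snd c z \<in> V" "smooth_on V h" "h ` V \<subseteq> snd ?d ` fst ?d"
    and h: "\<And>p. p \<in> fst c \<Longrightarrow> p \<in> M \<Longrightarrow> snd c p \<in> V \<Longrightarrow> p \<in> W \<and> f p \<in> fst ?d \<and> h (snd c p) = snd ?d (f p)"
    and dh: "\<And>p u. p \<in> fst c \<Longrightarrow> p \<in> M \<Longrightarrow> snd c p \<in> V \<Longrightarrow> u \<in> tangent_space A M p \<Longrightarrow>
       frechet_derivative h (at (snd c p)) (tcoord A c p u) = tcoord A ?d (f p) (df p u)"
    by (rule local_representative[OF z s d(3,2)]) (rule that)
  obtain r C where r: "r > 0" "C > 0" "ball (snd c z) r \<subseteq> snd c ` fst c"
    "lipschitz_distribution C (ball (snd c z) r \<inter> L) (fkernel L (\<Omega> c))"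
    by (rule kernel_lipschitz_in_slice[OF s]) (rule that)
  obtain r' where r': "r' > 0" "ball (snd c z) r' \<subseteq> V" using V(1,3) open_contains_ball by blast
  define \<rho> where "\<rho> = min r r'"
  define X where "X = ball (snd c z) \<rho>"
  have \<rho>: "\<rho> > 0" and XV: "X \<subseteq> V" and Xr: "X \<subseteq> ball (snd c z) r" using r r' unfolding \<rho>_def X_def by auto
  have oX: "open X" unfolding X_def by simp
  \<comment> \<open>The difference of the pulled back and the original form, made with the extension
    \<open>h\<close> so that it is a closed form on an open set; only its values on \<open>L\<close>
    at points of \<open>L\<close> have a meaning for \<open>f\<close>.\<close>
  define \<beta> where "\<beta> x u v = pull h (\<Omega> ?d) x u v - \<Omega> c x u v" for x u v
  have cl: "closed_form_on X \<beta>"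
    unfolding \<beta>_def[abs_def]
  proof (rule closed_form_on_diff[OF _ _ oX])
    show "closed_form_on X (pull h (\<Omega> ?d))"
      by (rule closed_form_on_subset[OF pull_closed[OF closed_\<Omega>[OF d(3)] is_chart_open(2)[OF d(4)] V(1,4,5)] XV])
    show "closed_form_on X (\<Omega> c)"
      by (rule closed_form_on_subset[OF closed_\<Omega>[OF c(1)]]) (use XV V(2) in blast)
  qed
  have \<beta>: "\<beta> (snd c p) (tcoord A c p u) (tcoord A c p v) = \<omega> (f p) (df p u) (df p v) - \<omega> p u v"
    if p: "p \<in> fst c" "p \<in> M" "snd c p \<in> V" and u: "u \<in> tangent_space A M p" and v: "v \<in> tangent_space A M p" for p u v
  proof -
    have fp: "f p \<in> fst ?d" "h (snd c p) = snd ?d (f p)" using h[OF p] by blast+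
    show ?thesis
      unfolding \<beta>_def pull_def dh[OF p u] dh[OF p v] fp(2)
      by (simp add: chart_form_tcoord[OF atlas d(3) fp(1)] chart_form_tcoord[OF atlas c(1) p(1)])
  qed
  have lift: "tcoord_inv A c p w \<in> tangent_space A M p \<and> tcoord A c p (tcoord_inv A c p w) = w"
    if "p \<in> fst c" "p \<in> M" "w \<in> L" for p w
    using tangent_space_slice[OF atlas slice_chart_at[OF s that(1,2)]] tcoord_inverse(1)[OF atlas c(1) that(1)] that(3) by simp
  have preserved_iff: "preserved p \<longleftrightarrow> (\<forall>v\<in>L. \<forall>w\<in>L. \<beta> (snd c p) v w = 0)"
    if p: "p \<in> fst c" "p \<in> M" "snd c p \<in> V" for p
  proof
    assume pr: "preserved p"
    show "\<forall>v\<in>L. \<forall>w\<in>L. \<beta> (snd c p) v w = 0"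
    proof (intro ballI)
      fix v w assume v: "v \<in> L" and w: "w \<in> L"
      show "\<beta> (snd c p) v w = 0"
        using \<beta>[OF p, of "tcoord_inv A c p v" "tcoord_inv A c p w"] lift[OF p(1,2) v] lift[OF p(1,2) w]
          pr unfolding preserved_def by simp
    qed
  next
    assume z0: "\<forall>v\<in>L. \<forall>w\<in>L. \<beta> (snd c p) v w = 0"
    show "preserved p"
      unfolding preserved_def
    proof (intro ballI)
      fix u v assume u: "u \<in> tangent_space A M p" and v: "v \<in> tangent_space A M p"
      have "tcoord A c p u \<in> L" "tcoord A c p v \<in> L"
        using u v tangent_space_slice[OF atlas slice_chart_at[OF s p(1,2)]] by blast+
      then show "\<omega> (f p) (df p u) (df p v) = \<omega> p u v" using \<beta>[OF p u v] z0 by simp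
    qed
  qed
  have pt: "\<exists>p. p \<in> fst c \<and> p \<in> M \<and> snd c p = x" if x: "x \<in> X \<inter> L" for x
  proof -
    obtain p where p: "p \<in> fst c" "x = snd c p" using x XV V(2) by blast
    then show ?thesis using slice_chart_iff[OF s p(1)] x by blast
  qed
  \<comment> \<open>Both terms vanish separately: \<open>df\<close> annihilates the kernel, and the
    kernel is \<omega>-orthogonal to the tangent space of \<open>M\<close>.\<close>
  have ann: "\<beta> x e w = 0" if x: "x \<in> X \<inter> L" and e: "e \<in> fkernel L (\<Omega> c) x" and w: "w \<in> L" for x e w
  proof -
    obtain p where p: "p \<in> fst c" "p \<in> M" "snd c p = x" using pt[OF x] by blast
    have pV: "snd c p \<in> V" using p(3) x XV by blast
    have pW: "p \<in> W" using h[OF p(1,2) pV] by blast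
    let ?u = "tcoord_inv A c p e" and ?v = "tcoord_inv A c p w"
    have eL: "e \<in> L" using e unfolding fkernel_def by blast
    have uK: "?u \<in> K p"
      using kernel_in_slice_chart[OF slice_chart_at[OF s p(1,2)], of ?u] lift[OF p(1,2) eL] e p(3) by simp
    have "\<beta> x e w = \<omega> (f p) (df p ?u) (df p ?v) - \<omega> p ?u ?v"
      using \<beta>[OF p(1,2) pV, of ?u ?v] lift[OF p(1,2) eL] lift[OF p(1,2) w] p(3) by simp
    also have "\<dots> = 0"
      using df_kernel[OF pW uK] kernel_\<omega>(1)[OF p(2) uK, of ?v] lift[OF p(1,2) w] bilinear_lzero[OF bilinear_\<omega>] by simp
    finally show ?thesis .
  qed
  have lip: "lipschitz_distribution C (X \<inter> L) (fkernel L (\<Omega> c))"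
    using r(4) Xr unfolding lipschitz_distribution_def by blast
  have Xc: "ball (snd c z) \<rho> \<subseteq> snd c ` fst c" using XV V(2) unfolding X_def by blast
  obtain U D where U: "open U" "z \<in> U" "U \<subseteq> fst c"
    and curves: "\<And>w w'. w \<in> N \<inter> U \<Longrightarrow> w' \<in> N \<inter> U \<Longrightarrow> kernel_curve c L (ball (snd c z) \<rho>) D (snd c w) (snd c w')"
    by (rule plaque_curves[OF N s \<rho> Xc open_UNIV UNIV_I]) (rule that)
  have transport: "preserved w'" if w: "w \<in> N \<inter> U" and w': "w' \<in> N \<inter> U" and pr: "preserved w" for w w'
  proof -
    from curves[OF w w', unfolded kernel_curve_def] obtain \<gamma> \<gamma>' where
      "\<gamma> 0 = snd c w \<and> \<gamma> 1 = snd c w' \<and>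
       (\<forall>t\<in>{0..1}. \<gamma> t \<in> ball (snd c z) \<rho> \<inter> L \<and> (\<gamma> has_vector_derivative \<gamma>' t) (at t) \<and>
          \<gamma>' t \<in> fkernel L (\<Omega> c) (\<gamma> t) \<and> norm (\<gamma>' t) \<le> D)" by (elim exE)
    then have \<gamma>: "\<gamma> 0 = snd c w" "\<gamma> 1 = snd c w'" "\<And>t. t \<in> {0..1} \<Longrightarrow> \<gamma> t \<in> X \<inter> L"
      "\<And>t. t \<in> {0..1} \<Longrightarrow> (\<gamma> has_vector_derivative \<gamma>' t) (at t)"
      "\<And>t. t \<in> {0..1} \<Longrightarrow> \<gamma>' t \<in> fkernel L (\<Omega> c) (\<gamma> t)" "\<And>t. t \<in> {0..1} \<Longrightarrow> norm (\<gamma>' t) \<le> D"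
      unfolding X_def by simp_all
    have wc: "w \<in> fst c" "w \<in> M" "w' \<in> fst c" "w' \<in> M" using w w' U(3) integral_subset[OF N(1)] by blast+
    have wV: "snd c w \<in> V" "snd c w' \<in> V" using \<gamma>(3)[of 0] \<gamma>(3)[of 1] \<gamma>(1,2) XV by auto
    have zero: "\<beta> (\<gamma> 0) u v = 0" if "u \<in> L" "v \<in> L" for u v
      using preserved_iff[OF wc(1,2) wV(1)] pr that unfolding \<gamma>(1) by blast
    have sub: "fkernel L (\<Omega> c) x \<subseteq> L" for x unfolding fkernel_def by blast
    have "\<beta> (\<gamma> 1) u v = 0" if "u \<in> L" "v \<in> L" for u v
      by (rule closed_form_transport_zero[OF cl oX c(2) lip r(2) sub ann \<gamma>(3-6) zero that])
    then show ?thesis using preserved_iff[OF wc(3,4) wV(2)] unfolding \<gamma>(2) by blast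
  qed
  show ?thesis
  proof (rule that[of "N \<inter> U"])
    show "openin leaf_top (N \<inter> U)" by (rule openin_integral[OF integral_Int_open[OF N(1) U(1)]])
    show "z \<in> N \<inter> U" using N(2) U(2) by simp
    show "preserved w'" if "w \<in> N \<inter> U" "w' \<in> N \<inter> U" "preserved w" for w w'
      by (rule transport[OF that])
  qed
qed

lemma fibre_retraction_presymplectic:
  assumes z: "z \<in> W" and uv: "u \<in> tangent_space A M z" "v \<in> tangent_space A M z"
  shows "\<omega> (f z) (df z u) (df z v) = \<omega> z u v"
proof -
  have FW: "w \<in> W" if "w \<in> F z" for w using that local_fibre_subset(1) by blast
  have "\<exists>B. openin leaf_top B \<and> w \<in> B \<and> (\<forall>p\<in>B. \<forall>p'\<in>B. preserved p \<longrightarrow> preserved p')" if "w \<in> F z" for w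
    by (rule preserved_locally_constant[OF FW[OF that]]) blast
  then have "\<exists>B. \<forall>w\<in>F z. openin leaf_top (B w) \<and> w \<in> B w \<and> (\<forall>p\<in>B w. \<forall>p'\<in>B w. preserved p \<longrightarrow> preserved p')"
    by (intro bchoice ballI)
  then obtain B where B: "\<And>w. w \<in> F z \<Longrightarrow> openin leaf_top (B w)" "\<And>w. w \<in> F z \<Longrightarrow> w \<in> B w"
    "\<And>w p p'. w \<in> F z \<Longrightarrow> p \<in> B w \<Longrightarrow> p' \<in> B w \<Longrightarrow> preserved p \<Longrightarrow> preserved p'"
    by auto
  \<comment> \<open>The neighbourhoods around points where the form is preserved and around the
    others are disjoint on the local fibre, which is connected and meets \<open>E1\<close> in
    \<open>f z\<close>; so it misses \<open>E2\<close>.\<close>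
  define E1 where "E1 = (\<Union>w\<in>{w\<in>F z. preserved w}. B w)"
  define E2 where "E2 = (\<Union>w\<in>{w\<in>F z. \<not> preserved w}. B w)"
  have o: "openin leaf_top E1" "openin leaf_top E2" unfolding E1_def E2_def using B(1) by (auto intro!: openin_Union)
  have "F z \<subseteq> E1 \<union> E2" unfolding E1_def E2_def using B(2) by auto
  moreover have "E1 \<inter> E2 \<inter> F z = {}" unfolding E1_def E2_def using B(2,3) by blast
  moreover have "E1 \<inter> F z \<noteq> {}"
  proof -
    have "preserved (f z)" by (rule preserved_at_fixed_point[OF f_W[OF z] f_idem[OF z]])
    then show ?thesis unfolding E1_def using f_in[OF z] B(2) by blast
  qed
  ultimately have "E2 \<inter> F z = {}" using connectedinD[OF local_fibre_connectedin o] by blast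
  then have "preserved z" unfolding E2_def using B(2) self_in_fibre[OF z] by blast
  then show ?thesis using uv unfolding preserved_def by blast
qed

end

section \<open>SHAKE and RATTLE\<close>

theorem proposition4p6:
  fixes A :: "('p::{t2_space,second_countable_topology}, 'e::euclidean_space) chart set"
    and \<omega> \<nu> :: "'p \<Rightarrow> 'e \<Rightarrow> 'e \<Rightarrow> real"
    and H :: "'p \<Rightarrow> real"
    and M W :: "'p set"
    and m k :: nat
    and I :: "real set"
    and \<phi> :: "real \<Rightarrow> 'p \<Rightarrow> 'p"
    and h0 :: real
  assumes "symplectic_manifold A \<omega>"
    and "smooth_map A std_atlas UNIV H"
    and "submanifold A m M"
    and "\<nu> = pullback_form A A M (\<lambda>x. x) \<omega>"
    and "\<forall>z\<in>M. dim (form_kernel A M \<nu> z) = k"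
    and "symplectic_method A \<omega> H I \<phi>"
    and "{-h0<..<h0} \<subseteq> I"
    and "shake_rattle_well_defined A M \<nu> H \<phi> W h0"
  shows "\<forall>h. 0 < \<bar>h\<bar> \<and> \<bar>h\<bar> < h0 \<longrightarrow>
    presymplectic_map A M \<nu> W (shake A M \<nu> \<phi> W h) \<and>
    presymplectic_map A M \<nu> W (rattle A M \<nu> H \<phi> W h)"
proof (intro allI impI)
  fix h :: real assume h: "0 < \<bar>h\<bar> \<and> \<bar>h\<bar> < h0"
  interpret presymplectic_submanifold A \<omega> \<nu> M m k
    by unfold_locales (use assms in auto)
  note wd = assms(8)[unfolded shake_rattle_well_defined_def]
  define \<Gamma> where "\<Gamma> = fibre_step A M \<nu> \<phi> W h"
  \<comment> \<open>The projection \<Pi> onto the hidden constraint set.\<close>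
  define \<rho> where "\<rho> = hidden_projection A M \<nu> H W"
  have W: "openin (top_of_set M) W" using wd by blast
  have WM: "W \<subseteq> M" using openin_subset[OF W] by simp
  have "h \<in> {-h0<..<h0}" using h by (simp add: abs_less_iff minus_less_iff)
  then have "h \<in> I" using assms(7) by blast
  then have \<phi>: "smooth_map A A UNIV (\<phi> h)" "pullback_form A A UNIV (\<phi> h) \<omega> = \<omega>"
    using assms(6) unfolding symplectic_method_def is_method_def diffeomorphism_def by blast+
  have ex\<Gamma>: "\<exists>!y. y \<in> local_fibre A M \<nu> W z \<and> \<phi> h y \<in> M" if "z \<in> W" for z
    using wd h that by blast
  have ex\<rho>: "\<exists>!y. y \<in> local_fibre A M \<nu> W z \<inter> hidden_constraint_set A M \<nu> H" if "z \<in> W" for z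
    using wd that by blast
  interpret \<Gamma>: fibre_retraction A \<omega> \<nu> M m k W \<Gamma>
  proof unfold_locales
    show "openin (top_of_set M) W" by (rule W)
    show "smooth_map A A W \<Gamma>" unfolding \<Gamma>_def using wd h by blast
    show "\<Gamma> z \<in> local_fibre A M \<nu> W z" if "z \<in> W" for z
      using theI'[OF ex\<Gamma>[OF that]] unfolding \<Gamma>_def fibre_step_def by blast
    \<comment> \<open>The definite description behind \<open>fibre_step\<close> refers to its point
      only through the local fibre, which is the same for \<open>z\<close> and
      \<open>z'\<close>.\<close>
    show "\<Gamma> z' = \<Gamma> z" if "z' \<in> local_fibre A M \<nu> W z" for z z'
      unfolding \<Gamma>_def fibre_step_def local_fibre_eq(1)[OF that] ..
  qed
  interpret \<rho>: fibre_retraction A \<omega> \<nu> M m k W \<rho>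
  proof unfold_locales
    show "openin (top_of_set M) W" by (rule W)
    show "smooth_map A A W \<rho>" unfolding \<rho>_def using wd by blast
    show "\<rho> z \<in> local_fibre A M \<nu> W z" if "z \<in> W" for z
      using theI'[OF ex\<rho>[OF that]] unfolding \<rho>_def hidden_projection_def by blast
    show "\<rho> z' = \<rho> z" if "z' \<in> local_fibre A M \<nu> W z" for z z'
      unfolding \<rho>_def hidden_projection_def local_fibre_eq(1)[OF that] ..
  qed
  define S where "S = \<phi> h \<circ> \<Gamma>"
  have shake: "shake A M \<nu> \<phi> W h = S" unfolding shake_def S_def \<Gamma>_def ..
  have rattle: "rattle A M \<nu> H \<phi> W h = \<rho> \<circ> S" unfolding rattle_def shake \<rho>_def ..
  have SW: "S ` W \<subseteq> W" using wd h unfolding S_def \<Gamma>_def by (simp add: image_comp)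
  have \<rho>W: "\<rho> ` W \<subseteq> W" using \<rho>.f_W by blast
  have S: "smooth_map A A W S" unfolding S_def
    by (rule smooth_map_compose[OF atlas atlas atlas \<Gamma>.f_smooth \<phi>(1)]) simp
  have R: "smooth_map A A W (\<rho> \<circ> S)"
    by (rule smooth_map_compose[OF atlas atlas atlas S \<rho>.f_smooth SW])
  \<comment> \<open>All computations are made with \<omega>; they are statements about \<nu> because
    the given vectors and their images are tangent to \<open>M\<close>.\<close>
  have presymplecticI: "presymplectic_map A M \<nu> W g"
    if g: "smooth_map A A W g" "g ` W \<subseteq> W"
      and \<omega>: "\<And>z u v. z \<in> W \<Longrightarrow> u \<in> tangent_space A M z \<Longrightarrow> v \<in> tangent_space A M z \<Longrightarrow>
        \<omega> (g z) (tangent_map A A W g z u) (tangent_map A A W g z v) = \<omega> z u v" for g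
    unfolding presymplectic_map_def
  proof (intro conjI ballI)
    show gM: "g ` W \<subseteq> M" using g(2) WM by (rule order_trans)
    show "smooth_map A A W g" by (rule g(1))
    fix z u v assume z: "z \<in> W" and u: "u \<in> tangent_space A M z" and v: "v \<in> tangent_space A M z"
    have zM: "z \<in> M" "g z \<in> M" using z WM gM by blast+
    show "pullback_form A A W g \<nu> z u v = \<nu> z u v"
      unfolding pullback_form_def
      using \<nu>_eq_\<omega>[OF zM(2) tangent_map_tangent[OF W z u g(1) gM] tangent_map_tangent[OF W z v g(1) gM]]
        \<nu>_eq_\<omega>[OF zM(1) u v] \<omega>[OF z u v] by simp
  qed
  have S\<omega>: "\<omega> (S z) (tangent_map A A W S z u) (tangent_map A A W S z v) = \<omega> z u v"
    if z: "z \<in> W" and u: "u \<in> tangent_space A M z" and v: "v \<in> tangent_space A M z" for z u v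
  proof -
    have d: "tangent_map A A W S z w = tangent_map A A UNIV (\<phi> h) (\<Gamma> z) (tangent_map A A W \<Gamma> z w)"
      if "w \<in> tangent_space A M z" for w
      unfolding S_def by (rule tangent_map_compose[OF W z that \<Gamma>.f_smooth _ \<phi>(1)]) simp
    \<comment> \<open>The method preserves \<omega> on all vectors of the ambient space, so nothing
      about tangency is needed between the two factors of \<open>S\<close>.\<close>
    have "\<omega> (\<phi> h (\<Gamma> z)) (tangent_map A A UNIV (\<phi> h) (\<Gamma> z) a) (tangent_map A A UNIV (\<phi> h) (\<Gamma> z) b) = \<omega> (\<Gamma> z) a b" for a b
      using fun_cong[OF fun_cong[OF fun_cong[OF \<phi>(2), of "\<Gamma> z"], of a], of b] unfolding pullback_form_def .
    then show ?thesis
      using \<Gamma>.fibre_retraction_presymplectic[OF z u v] unfolding d[OF u] d[OF v] by (simp add: S_def)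
  qed
  have R\<omega>: "\<omega> ((\<rho> \<circ> S) z) (tangent_map A A W (\<rho> \<circ> S) z u) (tangent_map A A W (\<rho> \<circ> S) z v) = \<omega> z u v"
    if z: "z \<in> W" and u: "u \<in> tangent_space A M z" and v: "v \<in> tangent_space A M z" for z u v
  proof -
    have SM: "S ` W \<subseteq> M" using SW WM by (rule order_trans)
    have Sz: "S z \<in> W" using SW z by blast
    have d: "tangent_map A A W (\<rho> \<circ> S) z w = tangent_map A A W \<rho> (S z) (tangent_map A A W S z w)"
      if "w \<in> tangent_space A M z" for w
      by (rule tangent_map_compose[OF W z that S SW \<rho>.f_smooth])
    show ?thesis
      unfolding d[OF u] d[OF v]
      using \<rho>.fibre_retraction_presymplectic[OF Sz tangent_map_tangent[OF W z u S SM] tangent_map_tangent[OF W z v S SM]]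
        S\<omega>[OF z u v] by simp
  qed
  show "presymplectic_map A M \<nu> W (shake A M \<nu> \<phi> W h) \<and> presymplectic_map A M \<nu> W (rattle A M \<nu> H \<phi> W h)"
    unfolding shake rattle
    by (intro conjI presymplecticI[OF S SW S\<omega>] presymplecticI[OF R _ R\<omega>]) (use SW \<rho>W in auto)
qed

end
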